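(* Let $G=(V,E)$ be a graph on $n$ vertices that is not isomorphic to any of $W_5$, $B_6$, $C_7^1$, $C_7^2$. If $\deg(u)+\deg(v)\geq n+1$ for all pairs of distinct non-adjacent vertices $u,v$ of $G$, then $G$ is rigid in $\mathbb{R}^3$.
   Context: All graphs are finite and simple. A graph is rigid in $\mathbb{R}^d$ if some (equivalently every) generic $d$-dimensional bar-and-joint framework of it (vertex positions with coordinates algebraically independent over $\mathbb{Q}$) is rigid, i.e. admits no continuous edge-length-preserving motion changing some pairwise distance. $W_5$ is the wheel on five vertices (a cone over a 4-cycle). $B_6$ is obtained from $K_6$ by deleting the edges of two vertex-disjoint paths on three vertices each. $C_7^1$ is obtained from $K_7$ by deleting the edges of two vertex-disjoint cycles, one of length three and one of length four. $C_7^2$ is obtained from $K_7$ by deleting the edges of a Hamiltonian cycle (a cycle on all seven vertices). *)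

theory Defs
  imports "HOL-Analysis.Analysis"
begin

definition simple_graph :: "'a set \<Rightarrow> ('a \<Rightarrow> 'a \<Rightarrow> bool) \<Rightarrow> bool" where
  "simple_graph V E \<longleftrightarrow> finite V \<and> (\<forall>u v. E u v \<longrightarrow> E v u) \<and> (\<forall>u. \<not> E u u)
     \<and> (\<forall>u v. E u v \<longrightarrow> u \<in> V \<and> v \<in> V)"

definition degree :: "'a set \<Rightarrow> ('a \<Rightarrow> 'a \<Rightarrow> bool) \<Rightarrow> 'a \<Rightarrow> nat" where
  "degree V E u = card {v \<in> V. E u v}"

definition graph_iso :: "'a set \<Rightarrow> ('a \<Rightarrow> 'a \<Rightarrow> bool) \<Rightarrow> 'b set \<Rightarrow> ('b \<Rightarrow> 'b \<Rightarrow> bool) \<Rightarrow> bool" where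
  "graph_iso V E W F \<longleftrightarrow>
     (\<exists>f. bij_betw f V W \<and> (\<forall>u\<in>V. \<forall>v\<in>V. E u v \<longleftrightarrow> F (f u) (f v)))"

definition complete_minus :: "(nat \<times> nat) list \<Rightarrow> nat \<Rightarrow> nat \<Rightarrow> bool" where
  "complete_minus D u v \<longleftrightarrow> u \<noteq> v \<and> (u, v) \<notin> set D \<and> (v, u) \<notin> set D"

text \<open>W5: cone (apex 0) over the 4-cycle 1-2-3-4-1, i.e. K5 minus the two diagonals.\<close>
definition W5_V :: "nat set" where "W5_V = {0..<5}"
definition W5_E :: "nat \<Rightarrow> nat \<Rightarrow> bool" where
  "W5_E u v \<longleftrightarrow> u \<in> W5_V \<and> v \<in> W5_V \<and> complete_minus [(1,3),(2,4)] u v"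

definition B6_V :: "nat set" where "B6_V = {0..<6}"
definition B6_E :: "nat \<Rightarrow> nat \<Rightarrow> bool" where
  "B6_E u v \<longleftrightarrow> u \<in> B6_V \<and> v \<in> B6_V \<and> complete_minus [(0,1),(1,2),(3,4),(4,5)] u v"

definition C71_V :: "nat set" where "C71_V = {0..<7}"
definition C71_E :: "nat \<Rightarrow> nat \<Rightarrow> bool" where
  "C71_E u v \<longleftrightarrow> u \<in> C71_V \<and> v \<in> C71_V \<and>
     complete_minus [(0,1),(1,2),(2,0),(3,4),(4,5),(5,6),(6,3)] u v"

definition C72_V :: "nat set" where "C72_V = {0..<7}"
definition C72_E :: "nat \<Rightarrow> nat \<Rightarrow> bool" where
  "C72_E u v \<longleftrightarrow> u \<in> C72_V \<and> v \<in> C72_V \<and>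
     complete_minus [(0,1),(1,2),(2,3),(3,4),(4,5),(5,6),(6,0)] u v"

text \<open>The reals x i (i in the finite index set I) are algebraically independent over Q:
no nonzero polynomial with rational coefficients in the variables indexed by I vanishes
at x. A polynomial is given by a finite set M of monomials (exponent vectors
supported on I) and rational coefficients c.\<close>
definition alg_indep_Q :: "('i \<Rightarrow> real) \<Rightarrow> 'i set \<Rightarrow> bool" where
  "alg_indep_Q x I \<longleftrightarrow>
     (\<forall>(c :: ('i \<Rightarrow> nat) \<Rightarrow> rat) (M :: ('i \<Rightarrow> nat) set).
        finite M \<longrightarrow> (\<forall>\<alpha>\<in>M. \<forall>i. i \<notin> I \<longrightarrow> \<alpha> i = 0) \<longrightarrow>
        (\<Sum>\<alpha>\<in>M. of_rat (c \<alpha>) * (\<Prod>i\<in>I. x i ^ \<alpha> i)) = 0 \<longrightarrow>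
        (\<forall>\<alpha>\<in>M. c \<alpha> = 0))"

definition generic3 :: "'a set \<Rightarrow> ('a \<Rightarrow> real^3) \<Rightarrow> bool" where
  "generic3 V p \<longleftrightarrow> alg_indep_Q (\<lambda>(v, k). p v $ k) (V \<times> (UNIV :: 3 set))"

definition framework_rigid3 :: "'a set \<Rightarrow> ('a \<Rightarrow> 'a \<Rightarrow> bool) \<Rightarrow> ('a \<Rightarrow> real^3) \<Rightarrow> bool" where
  "framework_rigid3 V E p \<longleftrightarrow>
     \<not> (\<exists>q :: real \<Rightarrow> 'a \<Rightarrow> real^3.
          (\<forall>v\<in>V. continuous_on {0..1} (\<lambda>t. q t v)) \<and>
          (\<forall>v\<in>V. q 0 v = p v) \<and>
          (\<forall>t\<in>{0..1}. \<forall>u\<in>V. \<forall>v\<in>V. E u v \<longrightarrow> dist (q t u) (q t v) = dist (p u) (p v)) \<and>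
          (\<exists>t\<in>{0..1}. \<exists>u\<in>V. \<exists>v\<in>V. dist (q t u) (q t v) \<noteq> dist (p u) (p v)))"

text \<open>A graph is rigid in R^3 if every generic framework of it is rigid
(equivalently: some generic framework is rigid).\<close>
definition rigid3 :: "'a set \<Rightarrow> ('a \<Rightarrow> 'a \<Rightarrow> bool) \<Rightarrow> bool" where
  "rigid3 V E \<longleftrightarrow> (\<forall>p. generic3 V p \<longrightarrow> framework_rigid3 V E p)"

end

theory Submission
  imports Defs
begin

text \<open>
  Fix a generic framework and add to the graph every pair whose row in the rigidity matrix is already
  spanned by the rows of the edges. A minor that does not vanish at some configuration does not vanish
  at a generic one, so adding a vertex with at least three neighbours never increases the number of
  degrees of freedom, and adding one with at least four neighbours, not all adjacent, decreases it.
  A set of at least three vertices without internal degrees of freedom is therefore a clique of the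
  closed graph.

  Suppose the closed graph is not complete. By the degree condition two nonadjacent vertices have at
  least three common neighbours, which cannot form a clique; so there is an induced 4-cycle, with two
  degrees of freedom. Build it up greedily by vertices with three neighbours. If the process stops at
  \<open>X \<noteq> V\<close> with \<open>|X| \<ge> 6\<close>, counting edges between \<open>X\<close> and \<open>V - X\<close> shows that \<open>V - X\<close> satisfies
  a strict degree condition, hence is a clique by induction, and then five of its vertices remove all
  degrees of freedom. Otherwise the vertices with three neighbours on the 4-cycle are almost
  independent, which leaves only \<open>W\<^sub>5\<close>, \<open>B\<^sub>6\<close> and the 4-regular graphs on seven vertices.

  For the passage to motions: if \<open>q\<close> and \<open>r\<close> give the edge \<open>uv\<close> the same length, then \<open>q - r\<close> is
  orthogonal to the row of \<open>uv\<close> at the configuration \<open>(q + r) / 2\<close>.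
\<close>

section \<open>Rational polynomials at algebraically independent points\<close>

text \<open>The four exceptional graphs have 8, 11, 14 and 14 edges, one fewer than the 3n - 6 that
  rigidity requires on 5, 6, 7 and 7 vertices, and every nonadjacent pair in them has degree sum
  exactly n + 1. This tightness is used twice. With surplus 2 instead of 1 no exception can occur,
  so the strict statement supports an induction over vertex subsets. And a graph whose closure is
  exceptional must equal that closure, because its own degrees obey the same bound.

  The edge count needs a set X of at least six vertices: a vertex with at most two neighbours in X
  then misses at least four. Smaller sets grown from the 4-cycle are what forces the case analysis.

  Motions are merely continuous, so they cannot be differentiated. Instead the configurations at two
  nearby times are compared directly, and independence of rows, being an open condition, makes the
  comparison local; connectedness of the unit interval does the rest.\<close>

definition rat_poly :: "'i set \<Rightarrow> (('i \<Rightarrow> real) \<Rightarrow> real) \<Rightarrow> bool" where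
  "rat_poly I f \<longleftrightarrow> (\<exists>(M :: ('i \<Rightarrow> nat) set) (c :: ('i \<Rightarrow> nat) \<Rightarrow> rat).
     finite M \<and> (\<forall>\<alpha>\<in>M. \<forall>i. i \<notin> I \<longrightarrow> \<alpha> i = 0) \<and>
     (\<forall>x. f x = (\<Sum>\<alpha>\<in>M. of_rat (c \<alpha>) * (\<Prod>i\<in>I. x i ^ \<alpha> i))))"

text \<open>Nonzeroness is witnessed by a value instead of a coefficient: if \<open>f\<close>
  vanished at \<open>p\<close>, all its coefficients would be zero and \<open>f\<close> would vanish
  at \<open>x\<close> too. A minor can thus be certified at any convenient point.\<close>

lemma rat_poly_alg_indep:
  assumes "rat_poly I f" "alg_indep_Q p I" "f x \<noteq> 0"
  shows "f p \<noteq> 0"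
proof
  assume 0: "f p = 0"
  obtain M c where M: "finite M" "\<forall>\<alpha>\<in>M. \<forall>i. i \<notin> I \<longrightarrow> \<alpha> i = 0"
    and f: "\<And>x. f x = (\<Sum>\<alpha>\<in>M. of_rat (c \<alpha>) * (\<Prod>i\<in>I. x i ^ \<alpha> i))"
    using assms(1) unfolding rat_poly_def by blast
  have "\<forall>\<alpha>\<in>M. c \<alpha> = 0"
    using assms(2) M 0 unfolding alg_indep_Q_def f by blast
  then have "f x = 0" unfolding f by simp
  with assms(3) show False by simp
qed

lemma rat_poly_const: "rat_poly I (\<lambda>x. of_rat c)"
  unfolding rat_poly_def
  by (rule exI[of _ "{\<lambda>_. 0}"], rule exI[of _ "\<lambda>_. c"]) simp

lemma rat_poly_zero: "rat_poly I (\<lambda>x. 0)"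
  using rat_poly_const[of I 0] by simp

lemma rat_poly_coord:
  assumes "finite I" "i \<in> I"
  shows "rat_poly I (\<lambda>x. x i)"
proof -
  have "(\<Prod>j\<in>I. x j ^ (if j = i then 1 else 0)) = x i" for x :: "_ \<Rightarrow> real"
  proof -
    have "(\<Prod>j\<in>I. x j ^ (if j = i then 1 else 0)) = (\<Prod>j\<in>I. if j = i then x j else 1)"
      by (rule prod.cong) auto
    then show ?thesis using assms by simp
  qed
  then show ?thesis
    unfolding rat_poly_def using assms(2)
    by (intro exI[of _ "{\<lambda>j. if j = i then 1 else 0}"] exI[of _ "\<lambda>_. 1"]) auto
qed

lemma rat_poly_add:
  assumes "rat_poly I f" "rat_poly I g"
  shows "rat_poly I (\<lambda>x. f x + g x)"
proof -
  obtain M c where M: "finite M" "\<forall>\<alpha>\<in>M. \<forall>i. i \<notin> I \<longrightarrow> \<alpha> i = 0"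
    and f: "\<And>x. f x = (\<Sum>\<alpha>\<in>M. of_rat (c \<alpha>) * (\<Prod>i\<in>I. x i ^ \<alpha> i))"
    using assms(1) unfolding rat_poly_def by blast
  obtain N d where N: "finite N" "\<forall>\<alpha>\<in>N. \<forall>i. i \<notin> I \<longrightarrow> \<alpha> i = 0"
    and g: "\<And>x. g x = (\<Sum>\<alpha>\<in>N. of_rat (d \<alpha>) * (\<Prod>i\<in>I. x i ^ \<alpha> i))"
    using assms(2) unfolding rat_poly_def by blast
  define e where "e \<alpha> = (if \<alpha> \<in> M then c \<alpha> else 0) + (if \<alpha> \<in> N then d \<alpha> else 0)" for \<alpha>
  have "f x + g x = (\<Sum>\<alpha>\<in>M \<union> N. of_rat (e \<alpha>) * (\<Prod>i\<in>I. x i ^ \<alpha> i))" for x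
  proof -
    have "f x = (\<Sum>\<alpha>\<in>M \<union> N. of_rat (if \<alpha> \<in> M then c \<alpha> else 0) * (\<Prod>i\<in>I. x i ^ \<alpha> i))"
      unfolding f by (rule sum.mono_neutral_cong_left) (use M(1) N(1) in auto)
    moreover have "g x = (\<Sum>\<alpha>\<in>M \<union> N. of_rat (if \<alpha> \<in> N then d \<alpha> else 0) * (\<Prod>i\<in>I. x i ^ \<alpha> i))"
      unfolding g by (rule sum.mono_neutral_cong_left) (use M(1) N(1) in auto)
    ultimately show ?thesis
      by (simp only: e_def of_rat_add distrib_right sum.distrib)
  qed
  then show ?thesis
    unfolding rat_poly_def using M N
    by (intro exI[of _ "M \<union> N"] exI[of _ e]) auto
qed

lemma rat_poly_mult:
  assumes "rat_poly I f" "rat_poly I g"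
  shows "rat_poly I (\<lambda>x. f x * g x)"
proof -
  obtain M c where M: "finite M" "\<forall>\<alpha>\<in>M. \<forall>i. i \<notin> I \<longrightarrow> \<alpha> i = 0"
    and f: "\<And>x. f x = (\<Sum>\<alpha>\<in>M. of_rat (c \<alpha>) * (\<Prod>i\<in>I. x i ^ \<alpha> i))"
    using assms(1) unfolding rat_poly_def by blast
  obtain N d where N: "finite N" "\<forall>\<alpha>\<in>N. \<forall>i. i \<notin> I \<longrightarrow> \<alpha> i = 0"
    and g: "\<And>x. g x = (\<Sum>\<alpha>\<in>N. of_rat (d \<alpha>) * (\<Prod>i\<in>I. x i ^ \<alpha> i))"
    using assms(2) unfolding rat_poly_def by blast
  \<comment> \<open>Addition of exponents is not injective on pairs, so \<open>e\<close> sums the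
    coefficient products over each fibre of \<open>s\<close>.\<close>
  define s where "s = (\<lambda>(\<alpha> :: 'a \<Rightarrow> nat, \<beta> :: 'a \<Rightarrow> nat) i. \<alpha> i + \<beta> i)"
  define e where "e \<gamma> = (\<Sum>z\<in>{z \<in> M \<times> N. s z = \<gamma>}. c (fst z) * d (snd z))" for \<gamma>
  have "f x * g x = (\<Sum>\<gamma>\<in>s ` (M \<times> N). of_rat (e \<gamma>) * (\<Prod>i\<in>I. x i ^ \<gamma> i))" for x
  proof -
    have "f x * g x = (\<Sum>z\<in>M \<times> N. of_rat (c (fst z) * d (snd z)) * (\<Prod>i\<in>I. x i ^ s z i))"
      unfolding f g sum_product sum.cartesian_product
      by (rule sum.cong)
        (auto simp: s_def of_rat_mult power_add prod.distrib)
    also have "\<dots> = (\<Sum>\<gamma>\<in>s ` (M \<times> N). \<Sum>z\<in>{z \<in> M \<times> N. s z = \<gamma>}.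
        of_rat (c (fst z) * d (snd z)) * (\<Prod>i\<in>I. x i ^ s z i))"
      by (rule sum.image_gen) (use M(1) N(1) in auto)
    also have "\<dots> = (\<Sum>\<gamma>\<in>s ` (M \<times> N). of_rat (e \<gamma>) * (\<Prod>i\<in>I. x i ^ \<gamma> i))"
      by (rule sum.cong) (auto simp: e_def of_rat_sum sum_distrib_right intro!: sum.cong)
    finally show ?thesis .
  qed
  moreover have "\<forall>\<alpha>\<in>s ` (M \<times> N). \<forall>i. i \<notin> I \<longrightarrow> \<alpha> i = 0"
    using M N by (auto simp: s_def)
  ultimately show ?thesis
    unfolding rat_poly_def using M N
    by (intro exI[of _ "s ` (M \<times> N)"] exI[of _ e]) auto
qed

lemma rat_poly_diff:
  assumes "rat_poly I f" "rat_poly I g"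
  shows "rat_poly I (\<lambda>x. f x - g x)"
  using rat_poly_add[OF assms(1) rat_poly_mult[OF rat_poly_const[of I "-1"] assms(2)]]
  by (simp add: of_rat_minus)

section \<open>Independence of rows\<close>

text \<open>An indexed family, so that two equal rows count as dependent. The column set is a
  parameter because columns are deleted, both in elimination and when a frame is pinned.\<close>

definition rows_indep :: "'e set \<Rightarrow> 'i set \<Rightarrow> ('e \<Rightarrow> 'i \<Rightarrow> real) \<Rightarrow> bool" where
  "rows_indep F I A \<longleftrightarrow>
     (\<forall>c. (\<forall>i\<in>I. (\<Sum>e\<in>F. c e * A e i) = 0) \<longrightarrow> (\<forall>e\<in>F. c e = 0))"

lemma rows_indepD:
  assumes "rows_indep F I A" "\<And>i. i \<in> I \<Longrightarrow> (\<Sum>e\<in>F. c e * A e i) = 0" "e \<in> F"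
  shows "c e = 0"
  using assms unfolding rows_indep_def by blast

lemma rows_indep_subset:
  assumes "rows_indep F I A" "G \<subseteq> F" "finite F"
  shows "rows_indep G I A"
  unfolding rows_indep_def
proof (intro allI impI ballI)
  fix c e assume c: "\<forall>i\<in>I. (\<Sum>e\<in>G. c e * A e i) = 0" and e: "e \<in> G"
  have "(\<Sum>e\<in>F. (if e \<in> G then c e else 0) * A e i) = (\<Sum>e\<in>G. c e * A e i)" for i
    by (rule sum.mono_neutral_cong_right) (use assms in auto)
  with c have "(if e \<in> G then c e else 0) = 0"
    using rows_indepD[OF assms(1), of "\<lambda>e. if e \<in> G then c e else 0" e] e assms(2) by auto
  then show "c e = 0" using e by simp
qed

text \<open>A fraction-free pivot step: rows are multiplied by the pivot before a multiple of the
  pivot row is subtracted. The new entries have the form a b - c d in the old ones, so they stay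
  polynomial or continuous in a parameter.\<close>

lemma rows_indep_eliminate:
  assumes "finite F" "e0 \<notin> F" "i \<in> I" "A e0 i \<noteq> 0"
  shows "rows_indep (insert e0 F) I A \<longleftrightarrow>
    rows_indep F I (\<lambda>e j. A e0 i * A e j - A e i * A e0 j)"
proof
  assume L: "rows_indep (insert e0 F) I A"
  show "rows_indep F I (\<lambda>e j. A e0 i * A e j - A e i * A e0 j)"
    unfolding rows_indep_def
  proof (intro allI impI)
    fix c assume c: "\<forall>j\<in>I. (\<Sum>e\<in>F. c e * (A e0 i * A e j - A e i * A e0 j)) = 0"
    define d where "d e = (if e = e0 then - (\<Sum>e\<in>F. c e * A e i) else c e * A e0 i)" for e
    have "(\<Sum>e\<in>insert e0 F. d e * A e j) = 0" if "j \<in> I" for j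
    proof -
      have "(\<Sum>e\<in>F. d e * A e j) = (\<Sum>e\<in>F. c e * A e0 i * A e j)"
        by (rule sum.cong) (use assms in \<open>auto simp: d_def\<close>)
      then have "(\<Sum>e\<in>insert e0 F. d e * A e j)
          = (\<Sum>e\<in>F. c e * A e0 i * A e j) - (\<Sum>e\<in>F. c e * A e i) * A e0 j"
        using assms by (simp add: d_def)
      also have "\<dots> = (\<Sum>e\<in>F. c e * (A e0 i * A e j - A e i * A e0 j))"
        by (simp add: sum_distrib_right sum_distrib_left sum_subtractf algebra_simps)
      finally show ?thesis using c that by simp
    qed
    then have "d e = 0" if "e \<in> F" for e
      using rows_indepD[OF L, of d e] that by blast
    then have "c e * A e0 i = 0" if "e \<in> F" for e
      using that assms(2) unfolding d_def by metis
    then show "\<forall>e\<in>F. c e = 0"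
      using assms(4) by simp
  qed
next
  assume R: "rows_indep F I (\<lambda>e j. A e0 i * A e j - A e i * A e0 j)"
  show "rows_indep (insert e0 F) I A"
    unfolding rows_indep_def
  proof (intro allI impI)
    fix c assume c: "\<forall>j\<in>I. (\<Sum>e\<in>insert e0 F. c e * A e j) = 0"
    have c': "(\<Sum>e\<in>F. c e * A e j) = - c e0 * A e0 j" if "j \<in> I" for j
      using c[rule_format, OF that] assms by simp
    have "(\<Sum>e\<in>F. c e * (A e0 i * A e j - A e i * A e0 j)) = 0" if "j \<in> I" for j
    proof -
      have "(\<Sum>e\<in>F. c e * (A e0 i * A e j - A e i * A e0 j))
          = A e0 i * (\<Sum>e\<in>F. c e * A e j) - (\<Sum>e\<in>F. c e * A e i) * A e0 j"
        by (simp add: sum_distrib_right sum_distrib_left sum_subtractf algebra_simps)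
      then show ?thesis by (simp add: c' that assms(3))
    qed
    then have z: "\<forall>e\<in>F. c e = 0" using R unfolding rows_indep_def by blast
    then have "c e0 * A e0 i = 0" using c'[OF assms(3)] by simp
    then show "\<forall>e\<in>insert e0 F. c e = 0" using z assms(4) by auto
  qed
qed

lemma rows_indep_nonzero:
  assumes "rows_indep F I A" "e \<in> F" "finite F"
  obtains i where "i \<in> I" "A e i \<noteq> 0"
proof -
  have "rows_indep {e} I A" using rows_indep_subset assms by blast
  then have "\<not> (\<forall>i\<in>I. A e i = 0)"
    using rows_indepD[of "{e}" I A "\<lambda>_. 1" e] by auto
  then show thesis using that by blast
qed

lemma rows_indep_card_le:
  assumes "finite F" "finite I" "rows_indep F I A"
  shows "card F \<le> card I"
  using assms
proof (induction F arbitrary: I A rule: finite_induct)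
  case empty
  then show ?case by simp
next
  case (insert e0 F)
  obtain i where i: "i \<in> I" "A e0 i \<noteq> 0"
    using rows_indep_nonzero[OF insert.prems(2), of e0] insert.hyps(1) by auto
  define B where "B = (\<lambda>e j. A e0 i * A e j - A e i * A e0 j)"
  have "rows_indep F I B"
    using rows_indep_eliminate[of F e0 i I A] insert.hyps insert.prems(2) i by (simp add: B_def)
  moreover have "B e i = 0" for e by (simp add: B_def)
  then have "(\<Sum>e\<in>F. c e * B e i) = 0" for c by simp
  ultimately have "rows_indep F (I - {i}) B"
    unfolding rows_indep_def by blast
  then have "card F \<le> card (I - {i})"
    using insert.IH insert.prems(1) by blast
  moreover have "card I = Suc (card (I - {i}))"
    using card_Suc_Diff1[OF insert.prems(1) i(1)] by simp
  ultimately show ?case using insert.hyps by simp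
qed

text \<open>Gaussian elimination only uses that a nonzero pivot stays nonzero.\<close>

lemma rows_indep_eventually:
  fixes K :: "('s \<Rightarrow> real) set"
  assumes "finite F"
    and closed: "\<And>a b c d. a \<in> K \<Longrightarrow> b \<in> K \<Longrightarrow> c \<in> K \<Longrightarrow> d \<in> K \<Longrightarrow>
        (\<lambda>s. a s * b s - c s * d s) \<in> K"
    and nonzero: "\<And>a. a \<in> K \<Longrightarrow> a s0 \<noteq> 0 \<Longrightarrow> eventually (\<lambda>s. a s \<noteq> 0) \<Phi>"
    and "\<And>e i. e \<in> F \<Longrightarrow> i \<in> I \<Longrightarrow> (\<lambda>s. A s e i) \<in> K"
    and "rows_indep F I (A s0)"
  shows "eventually (\<lambda>s. rows_indep F I (A s)) \<Phi>"
  using assms(1,4,5)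
proof (induction F arbitrary: A rule: finite_induct)
  case empty
  then show ?case by (simp add: rows_indep_def)
next
  case (insert e0 F)
  obtain i where i: "i \<in> I" "A s0 e0 i \<noteq> 0"
    using rows_indep_nonzero[OF insert.prems(2), of e0] insert.hyps(1) by auto
  define B where "B = (\<lambda>s e j. A s e0 i * A s e j - A s e i * A s e0 j)"
  have "(\<lambda>s. B s e j) \<in> K" if "e \<in> F" "j \<in> I" for e j
    unfolding B_def by (rule closed) (use that i insert.prems in auto)
  moreover have "rows_indep F I (B s0)"
    using rows_indep_eliminate[of F e0 i I "A s0"] insert.hyps insert.prems(2) i
    by (simp add: B_def)
  ultimately have ev: "eventually (\<lambda>s. rows_indep F I (B s)) \<Phi>"
    using insert.IH by blast
  have "eventually (\<lambda>s. A s e0 i \<noteq> 0) \<Phi>"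
    using nonzero[of "\<lambda>s. A s e0 i"] insert.prems(1) i by simp
  with ev show ?case
  proof eventually_elim
    case (elim s)
    then show ?case
      using rows_indep_eliminate[of F e0 i I "A s"] insert.hyps i by (simp add: B_def)
  qed
qed

definition in_span :: "'e set \<Rightarrow> ('e \<Rightarrow> 'i \<Rightarrow> real) \<Rightarrow> ('i \<Rightarrow> real) \<Rightarrow> bool" where
  "in_span F A r \<longleftrightarrow> (\<exists>c. \<forall>i. r i = (\<Sum>f\<in>F. c f * A f i))"

lemma in_span_row: "finite F \<Longrightarrow> e \<in> F \<Longrightarrow> in_span F A (A e)"
  unfolding in_span_def by (rule exI[of _ "\<lambda>f. if f = e then 1 else 0"])
    (simp add: if_distrib[of "\<lambda>x. x * _"] cong: if_cong)

lemma in_span_trans: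
  assumes "finite F" "in_span F A r" "\<And>f. f \<in> F \<Longrightarrow> in_span G A (A f)"
  shows "in_span G A r"
proof -
  obtain c where c: "\<And>i. r i = (\<Sum>f\<in>F. c f * A f i)"
    using assms(2) unfolding in_span_def by blast
  obtain d where d: "\<And>f i. f \<in> F \<Longrightarrow> A f i = (\<Sum>g\<in>G. d f g * A g i)"
    using assms(3) unfolding in_span_def by metis
  have "r i = (\<Sum>g\<in>G. (\<Sum>f\<in>F. c f * d f g) * A g i)" for i
  proof -
    have "r i = (\<Sum>f\<in>F. \<Sum>g\<in>G. c f * d f g * A g i)"
      unfolding c by (rule sum.cong) (auto simp: d sum_distrib_left mult.assoc)
    also have "\<dots> = (\<Sum>g\<in>G. \<Sum>f\<in>F. c f * d f g * A g i)"
      by (rule sum.swap)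
    finally show ?thesis by (simp add: sum_distrib_right)
  qed
  then show ?thesis unfolding in_span_def by (intro exI allI)
qed

lemma rows_indep_insert:
  assumes "finite F" "rows_indep F UNIV A" "\<not> in_span F A (A e)"
  shows "rows_indep (insert e F) UNIV A"
  unfolding rows_indep_def
proof (intro allI impI)
  fix c assume c: "\<forall>i\<in>UNIV. (\<Sum>f\<in>insert e F. c f * A f i) = 0"
  have e: "e \<notin> F" using in_span_row[OF assms(1), of e A] assms(3) by auto
  have c': "c e * A e i + (\<Sum>f\<in>F. c f * A f i) = 0" for i
    using c e assms(1) by simp
  have "c e = 0"
  proof (rule ccontr)
    assume ne: "c e \<noteq> 0"
    have "A e i = (\<Sum>f\<in>F. (- c f / c e) * A f i)" for i
    proof -
      have "(\<Sum>f\<in>F. (- c f / c e) * A f i) = - (\<Sum>f\<in>F. c f * A f i) / c e"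
        by (simp add: sum_divide_distrib sum_negf)
      also have "\<dots> = A e i" using c'[of i] ne by (simp add: field_simps)
      finally show ?thesis by simp
    qed
    then have "in_span F A (A e)" unfolding in_span_def by (intro exI allI)
    then show False using assms(3) by blast
  qed
  moreover from this have "\<forall>f\<in>F. c f = 0"
    using assms(2) c' unfolding rows_indep_def by simp
  ultimately show "\<forall>f\<in>insert e F. c f = 0" by simp
qed

lemma not_rows_indep_insert:
  assumes "finite F" "e \<notin> F" "in_span F A (A e)"
  shows "\<not> rows_indep (insert e F) I A"
proof
  assume R: "rows_indep (insert e F) I A"
  obtain c where c: "\<And>i. A e i = (\<Sum>f\<in>F. c f * A f i)"
    using assms(3) unfolding in_span_def by blast
  have "(\<Sum>f\<in>F. (if f = e then - 1 else c f) * A f i) = (\<Sum>f\<in>F. c f * A f i)" for i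
    by (rule sum.cong) (use assms in auto)
  then have "\<forall>i\<in>I. (\<Sum>f\<in>insert e F. (if f = e then - 1 else c f) * A f i) = 0"
    using assms(1,2) by (simp add: c)
  then have "\<forall>f\<in>insert e F. (if f = e then - 1 else c f) = 0"
    using R[unfolded rows_indep_def, rule_format, of "\<lambda>f. if f = e then - 1 else c f"] by blast
  then show False by simp
qed

lemma maximal_rows_indep:
  assumes "finite H"
  obtains F where "F \<subseteq> H" "rows_indep F UNIV A" "\<And>e. e \<in> H \<Longrightarrow> in_span F A (A e)"
proof -
  let ?P = "\<lambda>F. F \<subseteq> H \<and> rows_indep F UNIV A"
  have fin: "finite {F. ?P F}" by (rule finite_subset[of _ "Pow H"]) (use assms in auto)
  have "{} \<in> {F. ?P F}" by (simp add: rows_indep_def)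
  then obtain F where "F \<in> {F. ?P F}" and mx: "\<forall>G\<in>{F. ?P F}. F \<subseteq> G \<longrightarrow> F = G"
    using finite_has_maximal[OF fin] by auto
  then have F: "?P F" by simp
  have "in_span F A (A e)" if "e \<in> H" for e
  proof (rule ccontr)
    assume n: "\<not> ?thesis"
    have "finite F" using F assms finite_subset by blast
    then have "rows_indep (insert e F) UNIV A" by (rule rows_indep_insert) (use F n in auto)
    then have "F = insert e F" using mx F that by (metis insert_subset mem_Collect_eq subset_insertI)
    then show False using n in_span_row[OF \<open>finite F\<close>, of e A] by blast
  qed
  then show thesis using that F by blast
qed

section \<open>Rigidity matrices of generic frameworks\<close>

text \<open>For a pair \<open>e\<close> the term y = v of the sum is zero, which leaves the
  difference to the other end. Using the unordered pair avoids the choice of an orientation.\<close>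

definition edge_row :: "('a \<Rightarrow> real^3) \<Rightarrow> 'a set \<Rightarrow> 'a \<times> 3 \<Rightarrow> real" where
  "edge_row p e = (\<lambda>(v, k). if v \<in> e then \<Sum>y\<in>e. p v $ k - p y $ k else 0)"

definition pairs :: "'a set \<Rightarrow> 'a set set" where
  "pairs X = {{u, v} |u v. u \<in> X \<and> v \<in> X \<and> u \<noteq> v}"

definition edges :: "('a \<Rightarrow> 'a \<Rightarrow> bool) \<Rightarrow> 'a set \<Rightarrow> 'a set set" where
  "edges E X = {{u, v} |u v. u \<in> X \<and> v \<in> X \<and> E u v}"

lemma row_pair:
  "u \<noteq> v \<Longrightarrow> edge_row p {u, v} (w, k) =
    (if w = u then p u $ k - p v $ k else if w = v then p v $ k - p u $ k else 0)"
  by (auto simp: edge_row_def)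

lemma pairs_subset_Pow: "pairs X \<subseteq> Pow X"
  by (auto simp: pairs_def)

lemma finite_pairs: "finite X \<Longrightarrow> finite (pairs X)"
  using pairs_subset_Pow finite_subset by (metis finite_Pow_iff)

lemma edges_mono: "X \<subseteq> Y \<Longrightarrow> edges E X \<subseteq> edges E Y"
  by (auto simp: edges_def)

text \<open>With \<open>g\<close> constant this is the total force of the edge, which is zero; with
  \<open>g\<close> a coordinate it is a moment, symmetric in the two coordinates. So it encodes that
  rows annihilate translations and rotations.\<close>

lemma row_moment:
  assumes "finite X" "s \<in> X" "t \<in> X" "s \<noteq> t"
  shows "(\<Sum>x\<in>X. g x * edge_row p {s, t} (x, k)) = (g s - g t) * (p s $ k - p t $ k)"
proof -
  have "(\<Sum>x\<in>X. g x * edge_row p {s, t} (x, k)) = (\<Sum>x\<in>{s, t}. g x * edge_row p {s, t} (x, k))"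
    by (rule sum.mono_neutral_right) (use assms in \<open>auto simp: row_pair\<close>)
  also have "\<dots> = (g s - g t) * (p s $ k - p t $ k)"
    using assms(4) by (simp add: row_pair algebra_simps)
  finally show ?thesis .
qed

text \<open>The Gram matrix of the rows is determined by the pairwise distances.\<close>

lemma rows_indep_congruent:
  fixes p q :: "'a \<Rightarrow> real^3"
  assumes "finite V" "F \<subseteq> Pow V"
    and d: "\<And>u v. u \<in> V \<Longrightarrow> v \<in> V \<Longrightarrow> dist (q u) (q v) = dist (p u) (p v)"
    and p: "rows_indep F UNIV (edge_row p)"
  shows "rows_indep F UNIV (edge_row q)"
  unfolding rows_indep_def
proof (intro allI impI)
  fix c assume c: "\<forall>i\<in>UNIV. (\<Sum>e\<in>F. c e * edge_row q e i) = 0"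
  have finF: "finite F" using assms(1,2) finite_subset by blast
  \<comment> \<open>\<open>Y r v\<close> is the resultant at \<open>v\<close> of the stress
    \<open>c\<close> in the configuration \<open>r\<close>. By \<open>ip\<close> its squared length
    depends on distances only, so equilibrium at \<open>q\<close> implies equilibrium at
    \<open>p\<close>.\<close>
  define Y where "Y r v = (\<Sum>e\<in>{e \<in> F. v \<in> e}. \<Sum>x\<in>e. c e *\<^sub>R (r v - r x))"
    for r :: "'a \<Rightarrow> real^3" and v
  have Y: "Y r v $ k = (\<Sum>e\<in>F. c e * edge_row r e (v, k))" for r v k
  proof -
    have "Y r v $ k = (\<Sum>e\<in>{e \<in> F. v \<in> e}. c e * edge_row r e (v, k))"
      unfolding Y_def sum_component edge_row_def
      by (rule sum.cong) (auto simp: sum_distrib_left)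
    also have "\<dots> = (\<Sum>e\<in>F. c e * edge_row r e (v, k))"
      by (rule sum.mono_neutral_left) (use finF in \<open>auto simp: edge_row_def\<close>)
    finally show ?thesis .
  qed
  have ip: "(r v - r x) \<bullet> (r v - r y) =
      ((dist (r v) (r x))\<^sup>2 + (dist (r v) (r y))\<^sup>2 - (dist (r x) (r y))\<^sup>2) / 2"
    for r :: "'a \<Rightarrow> real^3" and v x y
    unfolding dist_norm power2_norm_eq_inner by (simp add: algebra_simps inner_commute)
  have Y_eq: "Y p v \<bullet> Y p v = Y q v \<bullet> Y q v" if v: "v \<in> V" for v
    unfolding Y_def inner_sum_left inner_sum_right
  proof (intro sum.cong refl)
    fix e x f y assume "e \<in> {e \<in> F. v \<in> e}" "x \<in> e" "f \<in> {e \<in> F. v \<in> e}" "y \<in> f"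
    then have "x \<in> V" "y \<in> V" using assms(2) by auto
    then have "(p v - p x) \<bullet> (p v - p y) = (q v - q x) \<bullet> (q v - q y)"
      unfolding ip using d v by simp
    then show "(c e *\<^sub>R (p v - p x)) \<bullet> (c f *\<^sub>R (p v - p y)) =
        (c e *\<^sub>R (q v - q x)) \<bullet> (c f *\<^sub>R (q v - q y))"
      by simp
  qed
  have "Y q v = 0" for v
    using c by (simp add: vec_eq_iff Y)
  then have "Y p v = 0" if "v \<in> V" for v
    using Y_eq[OF that] by simp
  moreover have "Y p v = 0" if "v \<notin> V" for v
  proof -
    have "{e \<in> F. v \<in> e} = {}" using that assms(2) by auto
    then show ?thesis by (simp only: Y_def sum.empty)
  qed
  ultimately have "Y p v = 0" for v by blast
  then have z: "(\<Sum>e\<in>F. c e * edge_row p e (v, k)) = 0" for v k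
    using Y[of p v k] by simp
  have "(\<Sum>e\<in>F. c e * edge_row p e i) = 0" for i
    using z[of "fst i" "snd i"] by simp
  then show "\<forall>e\<in>F. c e = 0"
    using rows_indepD[OF p, of c] by blast
qed

section \<open>Transfer of independence from special configurations to the generic one\<close>

locale generic_framework =
  fixes V :: "'a set" and p :: "'a \<Rightarrow> real^3"
  assumes finV: "finite V" and generic: "generic3 V p"
begin

definition poly_fun :: "(('a \<Rightarrow> real^3) \<Rightarrow> real) \<Rightarrow> bool" where
  "poly_fun g \<longleftrightarrow> (\<exists>f. rat_poly (V \<times> UNIV) f \<and> (\<forall>q. g q = f (\<lambda>(v, k). q v $ k)))"

lemma poly_fun_generic:
  assumes "poly_fun g" "g q \<noteq> 0"
  shows "g p \<noteq> 0"
proof -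
  obtain f where f: "rat_poly (V \<times> UNIV) f" "\<And>q. g q = f (\<lambda>(v, k). q v $ k)"
    using assms(1) unfolding poly_fun_def by blast
  show ?thesis
    using rat_poly_alg_indep[OF f(1) generic[unfolded generic3_def]] assms(2) f(2) by simp
qed

lemma poly_fun_zero: "poly_fun (\<lambda>q. 0)"
  unfolding poly_fun_def using rat_poly_zero by blast

lemma poly_fun_coord: "v \<in> V \<Longrightarrow> poly_fun (\<lambda>q. q v $ k)"
  unfolding poly_fun_def
  by (rule exI[of _ "\<lambda>x. x (v, k)"]) (auto intro!: rat_poly_coord finite_SigmaI finV)

lemma poly_fun_diff: "poly_fun f \<Longrightarrow> poly_fun g \<Longrightarrow> poly_fun (\<lambda>q. f q - g q)"
  unfolding poly_fun_def using rat_poly_diff by fastforce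

lemma poly_fun_mult: "poly_fun f \<Longrightarrow> poly_fun g \<Longrightarrow> poly_fun (\<lambda>q. f q * g q)"
  unfolding poly_fun_def using rat_poly_mult by fastforce

lemma poly_fun_add: "poly_fun f \<Longrightarrow> poly_fun g \<Longrightarrow> poly_fun (\<lambda>q. f q + g q)"
  unfolding poly_fun_def using rat_poly_add by fastforce

lemma poly_fun_sum:
  "(\<And>a. a \<in> A \<Longrightarrow> poly_fun (f a)) \<Longrightarrow> poly_fun (\<lambda>q. \<Sum>a\<in>A. f a q)"
  by (induction A rule: infinite_finite_induct) (auto intro: poly_fun_zero poly_fun_add)

lemma rows_indep_generic:
  assumes "finite F" "\<And>e i. e \<in> F \<Longrightarrow> i \<in> I \<Longrightarrow> poly_fun (\<lambda>q. A q e i)" "rows_indep F I (A q)"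
  shows "rows_indep F I (A p)"
proof -
  \<comment> \<open>For the principal filter at \<open>p\<close>, holding eventually means holding
    at \<open>p\<close>.\<close>
  have "eventually (\<lambda>r. rows_indep F I (A r)) (principal {p})"
  proof (rule rows_indep_eventually[where K = "Collect poly_fun"])
    show "(\<lambda>s. a s * b s - c s * d s) \<in> Collect poly_fun"
      if "a \<in> Collect poly_fun" "b \<in> Collect poly_fun" "c \<in> Collect poly_fun" "d \<in> Collect poly_fun"
      for a b c d
      using that by (auto intro!: poly_fun_diff poly_fun_mult)
    show "\<forall>\<^sub>F s in principal {p}. a s \<noteq> 0" if "a \<in> Collect poly_fun" "a q \<noteq> 0" for a
      using that poly_fun_generic by (auto simp: eventually_principal)
  qed (use assms in auto)
  then show ?thesis by (simp add: eventually_principal)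
qed

lemma row_indep_generic:
  assumes "F \<subseteq> Pow V" "rows_indep F UNIV (edge_row q)"
  shows "rows_indep F UNIV (edge_row p)"
proof (rule rows_indep_generic[where A = edge_row and q = q])
  show "finite F" using assms(1) finV finite_subset by blast
  show "rows_indep F UNIV (edge_row q)" by (rule assms(2))
  show "poly_fun (\<lambda>q. edge_row q e i)" if "e \<in> F" for e i
  proof (cases "fst i \<in> e")
    case True
    then have "(\<lambda>q. edge_row q e i) = (\<lambda>q. \<Sum>y\<in>e. q (fst i) $ snd i - q y $ snd i)"
      by (auto simp: edge_row_def case_prod_beta)
    then show ?thesis
      using that assms(1) True by (auto intro!: poly_fun_sum poly_fun_diff poly_fun_coord)
  next
    case False
    then have "(\<lambda>q. edge_row q e i) = (\<lambda>q. 0)"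
      by (auto simp: edge_row_def case_prod_beta)
    then show ?thesis using poly_fun_zero by simp
  qed
qed

lemma directions_indep:
  assumes "w \<in> V" "N \<subseteq> V" "w \<notin> N" "card N \<le> 3"
  shows "rows_indep N UNIV (\<lambda>x k. p w $ k - p x $ k)"
proof -
  have finN: "finite N" using assms(2) finV finite_subset by blast
  have "card N \<le> card (UNIV :: 3 set)" using assms(4) by simp
  then obtain g :: "'a \<Rightarrow> 3" where g: "inj_on g N"
    using finN by (meson card_le_inj finite_class.finite_UNIV)
  \<comment> \<open>Test configuration: \<open>w\<close> at the origin, the vertices of
    \<open>N\<close> at distinct unit coordinate vectors.\<close>
  define q :: "'a \<Rightarrow> real^3" where "q x = (if x \<in> N then axis (g x) 1 else 0)" for x
  have "rows_indep N UNIV (\<lambda>x k. q w $ k - q x $ k)"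
    unfolding rows_indep_def
  proof (intro allI impI ballI)
    fix c x assume c: "\<forall>i\<in>UNIV. (\<Sum>x\<in>N. c x * (q w $ i - q x $ i)) = 0" and x: "x \<in> N"
    have "(\<Sum>y\<in>N. c y * (q w $ g x - q y $ g x)) = (\<Sum>y\<in>N. if y = x then - c x else 0)"
      using x assms(3) g by (intro sum.cong) (auto simp: q_def axis_def dest: inj_onD)
    also have "\<dots> = - c x" using x finN by simp
    finally show "c x = 0" using c by simp
  qed
  then show ?thesis
    using assms(1,2) by (intro rows_indep_generic[OF finN, where q = q and A = "\<lambda>p x k. p w $ k - p x $ k"])
      (auto intro!: poly_fun_diff poly_fun_coord)
qed

text \<open>A combination of rows is a system of forces with zero total force and zero torque. If it
  vanishes outside six suitable coordinates of three vertices, the balance equations make it vanish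
  there as well. So independence survives the deletion of six of the 3 |X| columns.\<close>

lemma card_rows_indep_le:
  assumes X: "X \<subseteq> V" "3 \<le> card X" and F: "F \<subseteq> pairs X" "rows_indep F UNIV (edge_row p)"
  shows "card F + 6 \<le> 3 * card X"
proof -
  have finX: "finite X" using X(1) finV finite_subset by blast
  have finF: "finite F" using F(1) finite_pairs[OF finX] finite_subset by blast
  obtain T where T: "T \<subseteq> X" "card T = 3"
    using X(2) by (metis obtain_subset_with_card_n)
  then obtain a b c where abc: "T = {a, b, c}" "a \<noteq> b" "a \<noteq> c" "b \<noteq> c"
    by (metis card_3_iff)
  then have mem: "a \<in> X" "b \<in> X" "c \<in> X" "a \<in> V" "b \<in> V" "c \<in> V" using T X by auto
  \<comment> \<open>\<open>a\<close> lies at the origin, \<open>b\<close> and \<open>c\<close> at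
    unit vectors along the first two axes, so that the quantities in \<open>n1\<close> and
    \<open>n2\<close> both equal 1 there.\<close>
  define q :: "'a \<Rightarrow> real^3" where "q x = (if x = b then axis 1 1 else if x = c then axis 2 1 else 0)" for x
  have neq: "(1::3) \<noteq> 2" "(2::3) \<noteq> 1" "(1::3) \<noteq> 3" "(3::3) \<noteq> 1" "(2::3) \<noteq> 3" "(3::3) \<noteq> 2" by auto
  have n1: "p b $ 1 - p a $ 1 \<noteq> 0"
    by (rule poly_fun_generic[where g = "\<lambda>p. p b $ 1 - p a $ 1" and q = q])
      (use mem abc in \<open>auto intro!: poly_fun_diff poly_fun_coord simp: q_def axis_def\<close>)
  have n2: "(p b $ 1 - p a $ 1) * (p c $ 2 - p a $ 2) - (p b $ 2 - p a $ 2) * (p c $ 1 - p a $ 1) \<noteq> 0"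
    by (rule poly_fun_generic[where q = q and
          g = "\<lambda>p. (p b $ 1 - p a $ 1) * (p c $ 2 - p a $ 2) - (p b $ 2 - p a $ 2) * (p c $ 1 - p a $ 1)"])
      (use mem abc neq in \<open>auto intro!: poly_fun_diff poly_fun_mult poly_fun_coord simp: q_def axis_def\<close>)
  \<comment> \<open>Three coordinates of \<open>a\<close>, two of \<open>b\<close> and one of
    \<open>c\<close>: pinning them fixes a frame.\<close>
  define P where "P = {(a, 1::3), (a, 2), (a, 3), (b, 2), (b, 3), (c, 3)}"
  have P: "P \<subseteq> X \<times> UNIV" "card P = 6" using mem abc neq by (auto simp: P_def)
  have cardK: "card (X \<times> (UNIV :: 3 set) - P) = 3 * card X - 6"
    using P finX by (subst card_Diff_subset) (auto simp: P_def card_cartesian_product)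
  have "rows_indep F (X \<times> UNIV - P) (edge_row p)"
    unfolding rows_indep_def
  proof (intro allI impI)
    fix d assume d: "\<forall>i\<in>X \<times> UNIV - P. (\<Sum>e\<in>F. d e * edge_row p e i) = 0"
    define y where "y v k = (\<Sum>e\<in>F. d e * edge_row p e (v, k))" for v k
    have yK: "y v k = 0" if "v \<in> X" "(v, k) \<notin> P" for v k
      using d that by (auto simp: y_def)
    have yX: "y v k = 0" if "v \<notin> X" for v k
    proof -
      have "edge_row p e (v, k) = 0" if "e \<in> F" for e
        using that \<open>v \<notin> X\<close> F(1) pairs_subset_Pow[of X] by (auto simp: edge_row_def)
      then show ?thesis by (simp add: y_def)
    qed
    have moment: "(\<Sum>v\<in>X. g v * y v k) = (\<Sum>e\<in>F. d e * (\<Sum>v\<in>X. g v * edge_row p e (v, k)))" for g k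
    proof -
      have "(\<Sum>v\<in>X. g v * y v k) = (\<Sum>v\<in>X. \<Sum>e\<in>F. d e * (g v * edge_row p e (v, k)))"
        unfolding y_def sum_distrib_left by (intro sum.cong refl) simp
      also have "\<dots> = (\<Sum>e\<in>F. \<Sum>v\<in>X. d e * (g v * edge_row p e (v, k)))" by (rule sum.swap)
      finally show ?thesis by (simp add: sum_distrib_left)
    qed
    have force: "(\<Sum>v\<in>X. y v k) = 0" for k
    proof -
      have "(\<Sum>v\<in>X. 1 * edge_row p e (v, k)) = 0" if e: "e \<in> F" for e
      proof -
        obtain s t where "e = {s, t}" "s \<in> X" "t \<in> X" "s \<noteq> t"
          using F(1) e by (auto simp: pairs_def)
        then show ?thesis using row_moment[OF finX, of s t "\<lambda>_. 1" p k] by simp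
      qed
      then show ?thesis using moment[of "\<lambda>_. 1" k] by simp
    qed
    have torque: "(\<Sum>v\<in>X. p v $ i * y v j) = (\<Sum>v\<in>X. p v $ j * y v i)" for i j
      unfolding moment
    proof (intro sum.cong refl)
      fix e assume "e \<in> F"
      then obtain s t where "e = {s, t}" "s \<in> X" "t \<in> X" "s \<noteq> t"
        using F(1) by (auto simp: pairs_def)
      then show "d e * (\<Sum>v\<in>X. p v $ i * edge_row p e (v, j)) = d e * (\<Sum>v\<in>X. p v $ j * edge_row p e (v, i))"
        by (simp add: row_moment[OF finX])
    qed
    have reduce: "(\<Sum>v\<in>X. g v * y v k) = g a * y a k + g b * y b k + g c * y c k" for g k
    proof -
      have "(\<Sum>v\<in>X. g v * y v k) = (\<Sum>v\<in>{a, b, c}. g v * y v k)"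
        by (rule sum.mono_neutral_right) (use finX mem yK in \<open>auto simp: P_def\<close>)
      then show ?thesis using abc by (simp add: add.assoc)
    qed
    have z: "y b 1 = 0" "y c 1 = 0" "y c 2 = 0"
      using yK mem abc neq by (auto simp: P_def)
    have f: "y a k + y b k + y c k = 0" for k
      using force[of k] reduce[of "\<lambda>_. 1" k] by simp
    have ya: "y a 1 = 0" "y a 2 = - y b 2" "y a 3 = - y b 3 - y c 3"
      using f[of 1] f[of 2] f[of 3] z by auto
    have "p a $ 1 * y a 2 + p b $ 1 * y b 2 = 0"
      using torque[of 1 2] z ya unfolding reduce by simp
    then have "(p b $ 1 - p a $ 1) * y b 2 = 0"
      unfolding ya by (simp add: algebra_simps)
    then have b2: "y b 2 = 0" using n1 by simp
    \<comment> \<open>\<open>t13\<close> and \<open>t23\<close> form a linear system in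
      \<open>y b 3\<close> and \<open>y c 3\<close> whose determinant is the quantity in
      \<open>n2\<close>.\<close>
    have t13: "(p b $ 1 - p a $ 1) * y b 3 + (p c $ 1 - p a $ 1) * y c 3 = 0"
      using torque[of 1 3] z ya unfolding reduce by (simp add: algebra_simps)
    have t23: "(p b $ 2 - p a $ 2) * y b 3 + (p c $ 2 - p a $ 2) * y c 3 = 0"
      using torque[of 2 3] z ya b2 unfolding reduce by (simp add: algebra_simps)
    have "((p b $ 1 - p a $ 1) * (p c $ 2 - p a $ 2) - (p b $ 2 - p a $ 2) * (p c $ 1 - p a $ 1)) * y c 3 = 0"
    proof -
      have "((p b $ 1 - p a $ 1) * (p c $ 2 - p a $ 2) - (p b $ 2 - p a $ 2) * (p c $ 1 - p a $ 1)) * y c 3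
        = (p b $ 1 - p a $ 1) * ((p b $ 2 - p a $ 2) * y b 3 + (p c $ 2 - p a $ 2) * y c 3)
          - (p b $ 2 - p a $ 2) * ((p b $ 1 - p a $ 1) * y b 3 + (p c $ 1 - p a $ 1) * y c 3)"
        by (simp add: algebra_simps)
      then show ?thesis unfolding t13 t23 by simp
    qed
    then have c3: "y c 3 = 0" using n2 by simp
    then have b3: "y b 3 = 0" using t13 n1 by simp
    have "y v k = 0" for v k
    proof (cases "v \<in> X \<and> (v, k) \<in> P")
      case True
      then show ?thesis using ya b2 b3 c3 by (auto simp: P_def)
    next
      case False
      then show ?thesis using yK yX by blast
    qed
    then have "(\<Sum>e\<in>F. d e * edge_row p e i) = 0" for i
      unfolding y_def by (metis surj_pair)
    then show "\<forall>e\<in>F. d e = 0"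
      using rows_indepD[OF F(2), of d] by blast
  qed
  then have "card F \<le> 3 * card X - 6"
    using rows_indep_card_le[OF finF, of "X \<times> UNIV - P"] finX cardK by simp
  then show ?thesis using X(2) by simp
qed

end

section \<open>Adding a vertex to an independent set of rows\<close>

definition star :: "'a \<Rightarrow> 'a set \<Rightarrow> 'a set set" where
  "star w N = (\<lambda>x. {w, x}) ` N"

lemma inj_on_star: "w \<notin> N \<Longrightarrow> inj_on (\<lambda>x. {w, x}) N"
  by (auto simp: inj_on_def doubleton_eq_iff)

lemma star_disjoint: "\<forall>e\<in>F. w \<notin> e \<Longrightarrow> F \<inter> star w N = {}"
  by (auto simp: star_def)

lemma sum_Un_star:
  assumes "finite F" "\<forall>e\<in>F. w \<notin> e" "finite N" "w \<notin> N"
  shows "(\<Sum>e\<in>F \<union> star w N. h e) = (\<Sum>e\<in>F. h e) + (\<Sum>x\<in>N. h {w, x})"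
proof -
  have "(\<Sum>e\<in>F \<union> star w N. h e) = (\<Sum>e\<in>F. h e) + (\<Sum>e\<in>star w N. h e)"
    by (rule sum.union_disjoint)
      (use assms star_disjoint[of F w N] in \<open>auto simp: star_def\<close>)
  then show ?thesis
    unfolding star_def by (simp add: sum.reindex[OF inj_on_star[OF assms(4)]])
qed

lemma card_Un_star:
  assumes "finite F" "\<forall>e\<in>F. w \<notin> e" "finite N" "w \<notin> N"
  shows "card (F \<union> star w N) = card F + card N"
  using sum_Un_star[OF assms, of "\<lambda>_. 1 :: nat"] by simp

text \<open>In the columns of \<open>w\<close> only the star has entries, and they are the direction
  vectors. Their independence kills the star coefficients, and the remaining dependency lives on
  \<open>F\<close>.\<close>

lemma rows_indep_Un_star:
  fixes q :: "'a \<Rightarrow> real^3"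
  assumes "finite F" "\<forall>e\<in>F. w \<notin> e" "finite N" "w \<notin> N"
    and F: "rows_indep F UNIV (edge_row q)"
    and N: "rows_indep N UNIV (\<lambda>x k. q w $ k - q x $ k)"
  shows "rows_indep (F \<union> star w N) UNIV (edge_row q)"
  unfolding rows_indep_def
proof (intro allI impI)
  fix c assume "\<forall>i\<in>UNIV. (\<Sum>e\<in>F \<union> star w N. c e * edge_row q e i) = 0"
  then have c: "(\<Sum>e\<in>F. c e * edge_row q e i) + (\<Sum>x\<in>N. c {w, x} * edge_row q {w, x} i) = 0" for i
    unfolding sum_Un_star[OF assms(1-4)] by blast
  have "(\<Sum>x\<in>N. c {w, x} * (q w $ k - q x $ k)) = 0" for k
  proof -
    have "(\<Sum>e\<in>F. c e * edge_row q e (w, k)) = 0"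
      by (rule sum.neutral) (use assms(2) in \<open>auto simp: edge_row_def\<close>)
    moreover have "(\<Sum>x\<in>N. c {w, x} * edge_row q {w, x} (w, k)) = (\<Sum>x\<in>N. c {w, x} * (q w $ k - q x $ k))"
    proof (rule sum.cong[OF refl])
      fix x assume "x \<in> N"
      then have "w \<noteq> x" using assms(4) by auto
      then show "c {w, x} * edge_row q {w, x} (w, k) = c {w, x} * (q w $ k - q x $ k)"
        by (simp add: row_pair)
    qed
    ultimately show ?thesis using c[of "(w, k)"] by simp
  qed
  then have z: "c {w, x} = 0" if "x \<in> N" for x
    using rows_indepD[OF N, of "\<lambda>x. c {w, x}" x] that by blast
  then have "(\<Sum>e\<in>F. c e * edge_row q e i) = 0" for i
    using c[of i] by simp
  then have "\<forall>e\<in>F. c e = 0" using rows_indepD[OF F, of c] by blast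
  then show "\<forall>e\<in>F \<union> star w N. c e = 0" using z by (auto simp: star_def)
qed

text \<open>A 1-extension: the new vertex is placed in the middle of the segment \<open>ab\<close>, so that its
  rows to \<open>a\<close> and \<open>b\<close> add up to a multiple of the row of \<open>ab\<close>.\<close>

lemma rows_indep_midpoint_star:
  fixes q :: "'a \<Rightarrow> real^3"
  assumes "finite F" "\<forall>e\<in>F. w \<notin> e"
    and dist: "distinct [w, a, b, c, d]"
    and mid: "q w = (1/2) *\<^sub>R (q a + q b)"
    and ab: "{a, b} \<notin> F"
    and F: "rows_indep (insert {a, b} F) UNIV (edge_row q)"
    and N: "rows_indep {b, c, d} UNIV (\<lambda>x k. q a $ k - q x $ k)"
  shows "rows_indep (F \<union> star w {a, b, c, d}) UNIV (edge_row q)"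
  unfolding rows_indep_def
proof (intro allI impI)
  let ?N = "{a, b, c, d}"
  fix g assume g: "\<forall>i\<in>UNIV. (\<Sum>e\<in>F \<union> star w ?N. g e * edge_row q e i) = 0"
  have "(\<Sum>e\<in>F \<union> star w ?N. h e) = (\<Sum>e\<in>F. h e) + (\<Sum>x\<in>?N. h {w, x})" for h :: "'a set \<Rightarrow> real"
    by (rule sum_Un_star) (use assms in auto)
  then have S: "(\<Sum>e\<in>F \<union> star w ?N. h e) =
      (\<Sum>e\<in>F. h e) + h {w, a} + h {w, b} + h {w, c} + h {w, d}" for h :: "'a set \<Rightarrow> real"
    using dist by (simp add: add.assoc)
  have c: "(\<Sum>e\<in>F. g e * edge_row q e i) + g {w, a} * edge_row q {w, a} i + g {w, b} * edge_row q {w, b} i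
      + g {w, c} * edge_row q {w, c} i + g {w, d} * edge_row q {w, d} i = 0" for i
    using g unfolding S by blast
  have mid': "q w $ k = (q a $ k + q b $ k) / 2" for k
    unfolding mid by simp
  \<comment> \<open>As \<open>w\<close> is the midpoint of \<open>a\<close> and \<open>b\<close>,
    the equilibrium at \<open>w\<close> can be rewritten in the three directions between
    \<open>a\<close> and \<open>b\<close>, \<open>c\<close>, \<open>d\<close>; all four edges
    contribute to the coefficient of the direction of \<open>b\<close>.\<close>
  define r where "r x = (if x = b then (g {w, b} - g {w, a} - g {w, c} - g {w, d}) / 2 else g {w, x})" for x
  have "(\<Sum>x\<in>{b, c, d}. r x * (q a $ k - q x $ k)) = 0" for k
  proof -
    have "(\<Sum>e\<in>F. g e * edge_row q e (w, k)) = 0"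
      by (rule sum.neutral) (use assms(2) in \<open>auto simp: edge_row_def\<close>)
    then have "g {w, a} * (q w $ k - q a $ k) + g {w, b} * (q w $ k - q b $ k)
        + g {w, c} * (q w $ k - q c $ k) + g {w, d} * (q w $ k - q d $ k) = 0"
      using c[of "(w, k)"] dist by (simp add: row_pair)
    moreover have "(\<Sum>x\<in>{b, c, d}. r x * (q a $ k - q x $ k)) =
        r b * (q a $ k - q b $ k) + r c * (q a $ k - q c $ k) + r d * (q a $ k - q d $ k)"
      using dist by (simp add: add.assoc)
    moreover have "r b * (q a $ k - q b $ k) + r c * (q a $ k - q c $ k) + r d * (q a $ k - q d $ k) =
        g {w, a} * (q w $ k - q a $ k) + g {w, b} * (q w $ k - q b $ k)
        + g {w, c} * (q w $ k - q c $ k) + g {w, d} * (q w $ k - q d $ k)"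
    proof -
      have "g {w, b} = 2 * r b + g {w, a} + g {w, c} + g {w, d}" "r c = g {w, c}" "r d = g {w, d}"
        using dist by (auto simp: r_def field_simps)
      then show ?thesis unfolding mid' by (simp only:) (simp add: field_simps)
    qed
    ultimately show ?thesis by simp
  qed
  then have "r x = 0" if "x \<in> {b, c, d}" for x
    by (rule rows_indepD[OF N _ that])
  then have "r b = 0" "r c = 0" "r d = 0" by auto
  then have gs: "g {w, c} = 0" "g {w, d} = 0" "g {w, b} = g {w, a}"
    using dist by (auto simp: r_def split: if_splits)
  have half: "edge_row q {w, a} i + edge_row q {w, b} i = edge_row q {a, b} i / 2" for i
  proof (cases i)
    case (Pair x k)
    have "w \<noteq> a" "w \<noteq> b" "a \<noteq> b" using dist by auto
    then show ?thesis unfolding Pair by (simp add: row_pair mid' field_simps)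
  qed
  \<comment> \<open>By \<open>half\<close>, equal weights on \<open>wa\<close> and \<open>wb\<close>
    act like half that weight on \<open>ab\<close>, which turns the dependency into one of
    \<open>insert {a, b} F\<close>.\<close>
  define h where "h e = (if e = {a, b} then g {w, a} / 2 else g e)" for e
  have "(\<Sum>e\<in>insert {a, b} F. h e * edge_row q e i) = 0" for i
  proof -
    have "(\<Sum>e\<in>F. h e * edge_row q e i) = (\<Sum>e\<in>F. g e * edge_row q e i)"
      by (rule sum.cong) (use ab in \<open>auto simp: h_def\<close>)
    then have "(\<Sum>e\<in>insert {a, b} F. h e * edge_row q e i)
        = (\<Sum>e\<in>F. g e * edge_row q e i) + g {w, a} * (edge_row q {w, a} i + edge_row q {w, b} i)"
      unfolding half using ab assms(1) by (simp add: h_def)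
    also have "\<dots> = 0" using c[of i] unfolding gs by (simp add: algebra_simps)
    finally show ?thesis .
  qed
  then have h0: "\<forall>e\<in>insert {a, b} F. h e = 0"
    using rows_indepD[OF F, of h] by blast
  then have "g {w, a} = 0" by (auto simp: h_def)
  moreover have "\<forall>e\<in>F. g e = 0" using h0 ab by (auto simp: h_def split: if_splits)
  ultimately show "\<forall>e\<in>F \<union> star w ?N. g e = 0" using gs by (auto simp: star_def)
qed

section \<open>Linked pairs and degrees of freedom of vertex sets\<close>

context generic_framework
begin

text \<open>The closure of the edge set in the generic three-dimensional rigidity matroid, with rows
  taken at \<open>p\<close>.\<close>

definition linked :: "('a \<Rightarrow> 'a \<Rightarrow> bool) \<Rightarrow> 'a \<Rightarrow> 'a \<Rightarrow> bool" where
  "linked E u v \<longleftrightarrow> u \<in> V \<and> v \<in> V \<and> u \<noteq> v \<and> in_span (edges E V) (edge_row p) (edge_row p {u, v})"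

text \<open>\<open>k\<close> bounds the internal degrees of freedom of the framework on \<open>X\<close>; for the empty set the
  convention gives \<open>k = - 6\<close>.\<close>

definition dof_le :: "('a \<Rightarrow> 'a \<Rightarrow> bool) \<Rightarrow> 'a set \<Rightarrow> int \<Rightarrow> bool" where
  "dof_le L X k \<longleftrightarrow> (\<exists>F\<subseteq>edges L X. rows_indep F UNIV (edge_row p) \<and>
     3 * int (card X) \<le> int (card F) + 6 + k)"

lemma finite_edges: "finite (edges E V)"
  by (rule finite_subset[of _ "Pow V"]) (use finV in \<open>auto simp: edges_def\<close>)

lemma linked_sym: "linked E u v \<Longrightarrow> linked E v u"
  by (auto simp: linked_def insert_commute)

lemma edge_linked: "simple_graph V E \<Longrightarrow> E u v \<Longrightarrow> linked E u v"
  unfolding linked_def simple_graph_def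
  by (intro conjI in_span_row finite_edges) (auto 0 4 simp: edges_def)

lemma linked_edges_subset: "edges (linked E) X \<subseteq> pairs X"
  by (auto simp: edges_def pairs_def linked_def)

text \<open>Idempotence of the closure: linked pairs may be used as edges without producing any new
  spanned row.\<close>

lemma in_span_linked:
  assumes "F \<subseteq> edges (linked E) X" "finite F" "in_span F (edge_row p) r"
  shows "in_span (edges E V) (edge_row p) r"
proof (rule in_span_trans[OF assms(2,3)])
  fix f assume "f \<in> F"
  then obtain u v where "f = {u, v}" "linked E u v" using assms(1) by (auto simp: edges_def)
  then show "in_span (edges E V) (edge_row p) (edge_row p f)" by (simp add: linked_def)
qed

lemma dof_le_empty: "dof_le L {} (- 6)"
  unfolding dof_le_def by (rule exI[of _ "{}"]) (simp add: rows_indep_def)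

lemma dof_le_mono: "dof_le L X k \<Longrightarrow> k \<le> l \<Longrightarrow> dof_le L X l"
  unfolding dof_le_def by (elim exE conjE) (intro exI conjI, assumption+, linarith)

lemma finite_linked_edges: "F \<subseteq> edges (linked E) X \<Longrightarrow> X \<subseteq> V \<Longrightarrow> finite F"
  by (meson finV finite_pairs finite_subset linked_edges_subset)

lemma linked_edges_avoid:
  "F \<subseteq> edges (linked E) X \<Longrightarrow> w \<notin> X \<Longrightarrow> \<forall>e\<in>F. w \<notin> e"
  by (auto simp: edges_def)

lemma star_linked_edges:
  assumes "N \<subseteq> X" "\<forall>x\<in>N. linked E w x"
  shows "star w N \<subseteq> edges (linked E) (insert w X)"
proof
  fix e assume "e \<in> star w N"
  then obtain x where "x \<in> N" "e = {w, x}" by (auto simp: star_def)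
  then show "e \<in> edges (linked E) (insert w X)"
    using assms unfolding edges_def by blast
qed

lemma dof_le_insert:
  assumes "dof_le (linked E) X k" "X \<subseteq> V" "w \<in> V" "w \<notin> X"
    and N: "N \<subseteq> X" "card N \<le> 3" "\<forall>x\<in>N. linked E w x"
  shows "dof_le (linked E) (insert w X) (k + 3 - int (card N))"
proof -
  obtain F where F: "F \<subseteq> edges (linked E) X" "rows_indep F UNIV (edge_row p)"
    and card: "3 * int (card X) \<le> int (card F) + 6 + k"
    using assms(1) unfolding dof_le_def by blast
  have fin: "finite F" "finite N" "finite X"
    using finite_linked_edges[OF F(1) assms(2)] finite_subset[OF N(1)] finite_subset[OF assms(2) finV]
    by blast+
  have w: "w \<notin> N" "\<forall>e\<in>F. w \<notin> e"
    using assms(4) N(1) linked_edges_avoid[OF F(1) assms(4)] by blast+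
  have "rows_indep (F \<union> star w N) UNIV (edge_row p)"
    using fin w F(2) assms N by (intro rows_indep_Un_star directions_indep) auto
  moreover have "card (F \<union> star w N) = card F + card N"
    by (rule card_Un_star[OF fin(1) w(2) fin(2) w(1)])
  moreover have "F \<union> star w N \<subseteq> edges (linked E) (insert w X)"
    by (intro Un_least star_linked_edges[OF N(1,3)] order_trans[OF F(1)] edges_mono) auto
  ultimately show ?thesis
    using card fin assms(4) unfolding dof_le_def by (intro exI[of _ "F \<union> star w N"]) auto
qed

text \<open>Four rows are gained for three coordinates. Four directions at \<open>w\<close> are
  always dependent, so the additional rank must come from elsewhere: the row of \<open>ab\<close>
  lies outside the span of \<open>F\<close>, and with \<open>w\<close> at the midpoint the star
  reproduces it.\<close>

lemma dof_le_insert_nonclique: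
  assumes "dof_le (linked E) X k" "X \<subseteq> V" "w \<in> V" "w \<notin> X"
    and N: "{a, b, c, d} \<subseteq> X" "distinct [a, b, c, d]" "\<forall>x\<in>{a, b, c, d}. linked E w x"
    and ab: "\<not> linked E a b"
  shows "dof_le (linked E) (insert w X) (k - 1)"
proof -
  let ?N = "{a, b, c, d}"
  obtain F where F: "F \<subseteq> edges (linked E) X" "rows_indep F UNIV (edge_row p)"
    and card: "3 * int (card X) \<le> int (card F) + 6 + k"
    using assms(1) unfolding dof_le_def by blast
  have fin: "finite F" "finite X"
    using finite_linked_edges[OF F(1) assms(2)] finite_subset[OF assms(2) finV] by blast+
  have w: "w \<notin> ?N" "\<forall>e\<in>F. w \<notin> e"
    using assms(4) N(1) by (blast) (rule linked_edges_avoid[OF F(1) assms(4)])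
  have ns: "\<not> in_span F (edge_row p) (edge_row p {a, b})"
  proof
    assume "in_span F (edge_row p) (edge_row p {a, b})"
    then have "in_span (edges E V) (edge_row p) (edge_row p {a, b})" by (rule in_span_linked[OF F(1) fin(1)])
    then show False using ab N(1,2) assms(2) unfolding linked_def by auto
  qed
  \<comment> \<open>Only \<open>w\<close> moves, so rows avoiding \<open>w\<close> are unchanged.
    The position is special; independence returns to \<open>p\<close> through
    \<open>row_indep_generic\<close>.\<close>
  define q where "q = p(w := (1/2) *\<^sub>R (p a + p b))"
  have rq: "edge_row q e = edge_row p e" if "w \<notin> e" for e
    using that by (auto simp: edge_row_def q_def fun_eq_iff intro!: sum.cong)
  have "rows_indep (insert {a, b} F) UNIV (edge_row p)"
    using rows_indep_insert[OF fin(1) F(2) ns] .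
  moreover have "(\<Sum>e\<in>insert {a, b} F. h e * edge_row q e i) = (\<Sum>e\<in>insert {a, b} F. h e * edge_row p e i)" for h i
    by (intro sum.cong refl) (use w rq in auto)
  ultimately have 1: "rows_indep (insert {a, b} F) UNIV (edge_row q)"
    by (simp add: rows_indep_def)
  have "card {b, c, d} \<le> 3" by (simp add: card_insert_if)
  then have "rows_indep {b, c, d} UNIV (\<lambda>x k. p a $ k - p x $ k)"
    using N assms(2) by (intro directions_indep) auto
  moreover have "(\<Sum>x\<in>{b, c, d}. h x * (q a $ k - q x $ k)) = (\<Sum>x\<in>{b, c, d}. h x * (p a $ k - p x $ k))" for h k
    by (intro sum.cong refl) (use w in \<open>auto simp: q_def\<close>)
  ultimately have 2: "rows_indep {b, c, d} UNIV (\<lambda>x k. q a $ k - q x $ k)"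
    unfolding rows_indep_def by simp
  have "rows_indep (F \<union> star w ?N) UNIV (edge_row q)"
  proof (rule rows_indep_midpoint_star[OF fin(1) w(2) _ _ _ 1 2])
    show "distinct [w, a, b, c, d]" using N(2) w(1) by auto
    show "q w = (1/2) *\<^sub>R (q a + q b)" using w(1) by (auto simp: q_def)
    show "{a, b} \<notin> F" using ns in_span_row[OF fin(1), of "{a, b}" "edge_row p"] by blast
  qed
  moreover have sub: "F \<union> star w ?N \<subseteq> edges (linked E) (insert w X)"
    by (intro Un_least star_linked_edges[OF N(1,3)] order_trans[OF F(1)] edges_mono) auto
  moreover have "\<dots> \<subseteq> Pow V"
    using linked_edges_subset[of E "insert w X"] pairs_subset_Pow[of "insert w X"] assms(2,3) by blast
  ultimately have "rows_indep (F \<union> star w ?N) UNIV (edge_row p)"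
    by (intro row_indep_generic) auto
  moreover have "card (F \<union> star w ?N) = card F + card ?N"
    by (rule card_Un_star[OF fin(1) w(2) _ w(1)]) simp
  moreover have "card ?N = 4" using N(2) by auto
  ultimately show ?thesis
    using card fin assms(4) sub unfolding dof_le_def by (intro exI[of _ "F \<union> star w ?N"]) auto
qed

text \<open>The chosen rows already reach the maximum 3 |X| - 6, so the row of any further pair
  inside \<open>X\<close> depends on them.\<close>

lemma dof_le_clique:
  assumes "dof_le (linked E) X 0" "X \<subseteq> V" "3 \<le> card X" "u \<in> X" "v \<in> X" "u \<noteq> v"
  shows "linked E u v"
proof -
  obtain F where F: "F \<subseteq> edges (linked E) X" "rows_indep F UNIV (edge_row p)"
    and card: "3 * int (card X) \<le> int (card F) + 6 + 0"
    using assms(1) unfolding dof_le_def by blast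
  have fin: "finite F" using finite_linked_edges[OF F(1) assms(2)] .
  have "in_span F (edge_row p) (edge_row p {u, v})"
  proof (rule ccontr)
    assume n: "\<not> ?thesis"
    have "rows_indep (insert {u, v} F) UNIV (edge_row p)"
      using rows_indep_insert[OF fin F(2) n] .
    moreover have "insert {u, v} F \<subseteq> pairs X"
      using F(1) linked_edges_subset[of E X] assms(4-6) by (auto simp: pairs_def)
    ultimately have "card (insert {u, v} F) + 6 \<le> 3 * card X"
      using card_rows_indep_le assms(2,3) by blast
    moreover have "{u, v} \<notin> F" using n in_span_row[OF fin, of "{u, v}" "edge_row p"] by blast
    ultimately show False using card fin by simp
  qed
  then have "in_span (edges E V) (edge_row p) (edge_row p {u, v})" by (rule in_span_linked[OF F(1) fin])
  then show ?thesis using assms(2,4-6) unfolding linked_def by auto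
qed

section \<open>Continuous motions of a framework in which all pairs are linked\<close>

lemma rows_indep_eventually_at:
  assumes "F \<subseteq> Pow V" "\<And>v. v \<in> V \<Longrightarrow> continuous (at t within S) (\<lambda>s. m s v)"
    and "rows_indep F UNIV (edge_row (m t))"
  shows "\<forall>\<^sub>F s in at t within S. rows_indep F UNIV (edge_row (m s))"
proof (rule rows_indep_eventually[where K = "{a. continuous (at t within S) a}"])
  show "finite F" using assms(1) finV finite_subset by blast
  show "(\<lambda>s. a s * b s - c s * d s) \<in> {a. continuous (at t within S) a}"
    if "a \<in> {a. continuous (at t within S) a}" "b \<in> {a. continuous (at t within S) a}"
      "c \<in> {a. continuous (at t within S) a}" "d \<in> {a. continuous (at t within S) a}" for a b c d :: "_ \<Rightarrow> real"
    using that by (auto intro!: continuous_intros)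
  show "\<forall>\<^sub>F s in at t within S. a s \<noteq> 0"
    if "a \<in> {a. continuous (at t within S) a}" "a t \<noteq> 0" for a :: "_ \<Rightarrow> real"
    using that tendsto_imp_eventually_ne by (auto simp: continuous_within)
  show "(\<lambda>s. edge_row (m s) e i) \<in> {a. continuous (at t within S) a}" if "e \<in> F" for e i
  proof (cases "fst i \<in> e")
    case True
    then have "(\<lambda>s. edge_row (m s) e i) = (\<lambda>s. \<Sum>y\<in>e. m s (fst i) $ snd i - m s y $ snd i)"
      by (auto simp: edge_row_def case_prod_beta)
    moreover have "continuous (at t within S) (\<lambda>s. m s v $ k)" if "v \<in> e" for v k
      using assms(1,2) that \<open>e \<in> F\<close> by (intro continuous_intros) auto
    ultimately show ?thesis
      using True by (auto intro!: continuous_sum continuous_diff)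
  next
    case False
    then have "(\<lambda>s. edge_row (m s) e i) = (\<lambda>s. 0)"
      by (auto simp: edge_row_def case_prod_beta)
    then show ?thesis by simp
  qed
qed (rule assms(3))

text \<open>Polarisation: with s = q u - q v and t = r u - r v the left side is the inner product of
  s - t and (s + t) / 2. The identity is exact, not a first-order approximation.\<close>

lemma row_midpoint:
  assumes "u \<in> V" "v \<in> V" "u \<noteq> v"
  shows "(\<Sum>x\<in>V. \<Sum>k\<in>UNIV. (q x - r x) $ k * edge_row (\<lambda>v. (1/2) *\<^sub>R (q v + r v)) {u, v} (x, k)) =
    ((dist (q u) (q v))\<^sup>2 - (dist (r u) (r v))\<^sup>2) / 2"
proof -
  let ?m = "\<lambda>v. (1/2) *\<^sub>R (q v + r v)"
  have "(\<Sum>x\<in>V. \<Sum>k\<in>UNIV. (q x - r x) $ k * edge_row ?m {u, v} (x, k))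
      = (\<Sum>k\<in>UNIV. \<Sum>x\<in>V. (q x - r x) $ k * edge_row ?m {u, v} (x, k))"
    by (rule sum.swap)
  also have "\<dots> = (\<Sum>k\<in>UNIV. ((q u - r u) $ k - (q v - r v) $ k) * (?m u $ k - ?m v $ k))"
    by (intro sum.cong refl row_moment finV assms)
  also have "\<dots> = ((q u - r u) - (q v - r v)) \<bullet> (?m u - ?m v)"
    by (simp add: inner_vec_def)
  also have "\<dots> = ((dist (q u) (q v))\<^sup>2 - (dist (r u) (r v))\<^sup>2) / 2"
    unfolding dist_norm power2_norm_eq_inner by (simp add: algebra_simps inner_commute)
  finally show ?thesis .
qed

text \<open>The set \<open>T\<close> of times at which all distances are the original ones is
  closed, open and contains 0. For openness at \<open>t0\<close>, note that \<open>q t0\<close> is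
  congruent to \<open>p\<close>, though perhaps not generic, so \<open>F\<close> is independent
  there and hence at nearby midpoint configurations. There \<open>F\<close> spans every row, and
  \<open>q t - q t0\<close> is orthogonal to \<open>F\<close> since edge lengths agree.\<close>

theorem linked_imp_rigid:
  assumes E: "\<And>u v. E u v \<Longrightarrow> u \<noteq> v"
    and linked: "\<And>u v. u \<in> V \<Longrightarrow> v \<in> V \<Longrightarrow> u \<noteq> v \<Longrightarrow> linked E u v"
  shows "framework_rigid3 V E p"
  unfolding framework_rigid3_def
proof
  assume "\<exists>q. (\<forall>v\<in>V. continuous_on {0..1} (\<lambda>t. q t v)) \<and> (\<forall>v\<in>V. q 0 v = p v) \<and>
    (\<forall>t\<in>{0..1}. \<forall>u\<in>V. \<forall>v\<in>V. E u v \<longrightarrow> dist (q t u) (q t v) = dist (p u) (p v)) \<and>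
    (\<exists>t\<in>{0..1::real}. \<exists>u\<in>V. \<exists>v\<in>V. dist (q t u) (q t v) \<noteq> dist (p u) (p v))"
  then obtain q where cont: "\<And>v. v \<in> V \<Longrightarrow> continuous_on {0..1::real} (\<lambda>t. q t v)"
    and q0: "\<And>v. v \<in> V \<Longrightarrow> q 0 v = p v"
    and len: "\<And>t u v. t \<in> {0..1} \<Longrightarrow> u \<in> V \<Longrightarrow> v \<in> V \<Longrightarrow> E u v \<Longrightarrow> dist (q t u) (q t v) = dist (p u) (p v)"
    and flex: "\<exists>t\<in>{0..1::real}. \<exists>u\<in>V. \<exists>v\<in>V. dist (q t u) (q t v) \<noteq> dist (p u) (p v)"
    by blast
  obtain F where F: "F \<subseteq> edges E V" "rows_indep F UNIV (edge_row p)"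
    and span: "\<And>e. e \<in> edges E V \<Longrightarrow> in_span F (edge_row p) (edge_row p e)"
    using maximal_rows_indep[OF finite_edges, of E "edge_row p"] by blast
  have finF: "finite F" using F(1) finite_edges finite_subset by blast
  have FV: "F \<subseteq> Pow V" using F(1) by (auto simp: edges_def)
  have spanp: "in_span F (edge_row p) (edge_row p {u, v})" if "u \<in> V" "v \<in> V" "u \<noteq> v" for u v
    by (rule in_span_trans[OF finite_edges[of E] _ span])
      (use linked[OF that] in \<open>auto simp: linked_def\<close>)
  text \<open>At every configuration where \<open>F\<close> is independent it spans all rows, since
    independence carries over to the generic point.\<close>
  have span_any: "in_span F (edge_row m) (edge_row m {u, v})"
    if "rows_indep F UNIV (edge_row m)" "u \<in> V" "v \<in> V" "u \<noteq> v" for m u v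
  proof (rule ccontr)
    assume n: "\<not> ?thesis"
    have "{u, v} \<notin> F" using n in_span_row[OF finF, of "{u, v}" "edge_row m"] by blast
    moreover have "rows_indep (insert {u, v} F) UNIV (edge_row p)"
      using rows_indep_insert[OF finF that(1) n] FV that(2,3) by (intro row_indep_generic) auto
    ultimately show False
      using not_rows_indep_insert[OF finF, of "{u, v}" "edge_row p"] spanp that by blast
  qed
  define T where "T = {t \<in> {0..1}. \<forall>u\<in>V. \<forall>v\<in>V. dist (q t u) (q t v) = dist (p u) (p v)}"
  define d where "d t = (\<Sum>u\<in>V. \<Sum>v\<in>V. \<bar>dist (q t u) (q t v) - dist (p u) (p v)\<bar>)" for t
  have "T = {t \<in> {0..1}. d t = 0}"
    unfolding T_def d_def using finV by (auto simp: sum_nonneg_eq_0_iff sum_nonneg)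
  moreover have "continuous_on {0..1} d"
    unfolding d_def by (intro continuous_intros cont)
  ultimately have closed: "closedin (top_of_set {0..1}) T"
    using continuous_closedin_preimage_constant[of "{0..1}" d 0] by simp
  have near: "\<forall>\<^sub>F t in at t0 within {0..1}. t \<in> {0..1} \<longrightarrow> t \<in> T" if t0: "t0 \<in> T" for t0
  proof -
    define m where "m t = (\<lambda>v. (1/2) *\<^sub>R (q t v + q t0 v))" for t
    have t01: "t0 \<in> {0..1}" and t0d: "\<And>u v. u \<in> V \<Longrightarrow> v \<in> V \<Longrightarrow> dist (q t0 u) (q t0 v) = dist (p u) (p v)"
      using t0 by (auto simp: T_def)
    have "rows_indep F UNIV (edge_row (q t0))"
      by (rule rows_indep_congruent[OF finV FV t0d F(2)])
    moreover have "m t0 = q t0" unfolding m_def by (auto simp flip: scaleR_2)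
    ultimately have "rows_indep F UNIV (edge_row (m t0))" by simp
    moreover have "continuous (at t0 within {0..1}) (\<lambda>t. m t v)" if "v \<in> V" for v
      using cont[OF that] t01 unfolding m_def
      by (intro continuous_intros) (auto simp: continuous_on_eq_continuous_within)
    ultimately have "\<forall>\<^sub>F t in at t0 within {0..1}. rows_indep F UNIV (edge_row (m t))"
      using rows_indep_eventually_at[OF FV, of t0 "{0..1}" m] by blast
    then show ?thesis
    proof eventually_elim
      case (elim t)
      show ?case
      proof
        assume t: "t \<in> {0..1}"
        define B where "B e = (\<Sum>x\<in>V. \<Sum>k\<in>UNIV. (q t x - q t0 x) $ k * edge_row (m t) e (x, k))" for e
        have B: "B {u, v} = ((dist (q t u) (q t v))\<^sup>2 - (dist (q t0 u) (q t0 v))\<^sup>2) / 2"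
          if "u \<in> V" "v \<in> V" "u \<noteq> v" for u v
          unfolding B_def m_def by (rule row_midpoint[OF that])
        have BF: "B e = 0" if "e \<in> F" for e
        proof -
          have "e \<in> edges E V" using that F(1) by blast
          then obtain u v where "e = {u, v}" "u \<in> V" "v \<in> V" "E u v"
            unfolding edges_def by blast
          then show ?thesis
            using B[of u v] len[OF t, of u v] len[OF t01, of u v] E[of u v] by simp
        qed
        have "dist (q t u) (q t v) = dist (p u) (p v)" if uv: "u \<in> V" "v \<in> V" for u v
        proof (cases "u = v")
          case False
          obtain c where c: "\<And>i. edge_row (m t) {u, v} i = (\<Sum>f\<in>F. c f * edge_row (m t) f i)"
            using span_any[OF elim uv False] unfolding in_span_def by blast
          have "B {u, v} = (\<Sum>x\<in>V. \<Sum>k\<in>UNIV. \<Sum>f\<in>F. c f * ((q t x - q t0 x) $ k * edge_row (m t) f (x, k)))"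
            unfolding B_def c by (simp add: sum_distrib_left mult.left_commute)
          also have "\<dots> = (\<Sum>x\<in>V. \<Sum>f\<in>F. \<Sum>k\<in>UNIV. c f * ((q t x - q t0 x) $ k * edge_row (m t) f (x, k)))"
            by (intro sum.cong refl sum.swap)
          also have "\<dots> = (\<Sum>f\<in>F. \<Sum>x\<in>V. \<Sum>k\<in>UNIV. c f * ((q t x - q t0 x) $ k * edge_row (m t) f (x, k)))"
            by (rule sum.swap)
          also have "\<dots> = (\<Sum>f\<in>F. c f * B f)"
            by (simp add: B_def sum_distrib_left)
          also have "\<dots> = 0" using BF by simp
          finally have "(dist (q t u) (q t v))\<^sup>2 = (dist (q t0 u) (q t0 v))\<^sup>2"
            using B[OF uv False] by simp
          then show ?thesis using t0d[OF uv] by (simp add: power2_eq_iff_nonneg)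
        qed simp
        then show "t \<in> T" using t by (simp add: T_def)
      qed
    qed
  qed
  have "openin (top_of_set {0..1}) T"
    unfolding openin_euclidean_subtopology_iff
  proof (intro conjI ballI)
    show "T \<subseteq> {0..1}" by (auto simp: T_def)
    fix t0 assume "t0 \<in> T"
    then obtain e where "e > 0" "\<And>t. t \<in> {0..1} \<Longrightarrow> t \<noteq> t0 \<Longrightarrow> dist t t0 < e \<Longrightarrow> t \<in> T"
      using near[of t0] unfolding eventually_at by blast
    then show "\<exists>e>0. \<forall>x'\<in>{0..1}. dist x' t0 < e \<longrightarrow> x' \<in> T"
      using \<open>t0 \<in> T\<close> by metis
  qed
  moreover have "connected {0..1::real}" by simp
  ultimately have "T = {} \<or> T = {0..1}"
    using closed unfolding connected_clopen by blast
  moreover have "0 \<in> T" using q0 by (simp add: T_def)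
  ultimately show False using flex unfolding T_def by blast
qed

end

section \<open>Ore-type graphs\<close>

definition complete_on :: "('a \<Rightarrow> 'a \<Rightarrow> bool) \<Rightarrow> 'a set \<Rightarrow> bool" where
  "complete_on E X \<longleftrightarrow> (\<forall>u\<in>X. \<forall>v\<in>X. u \<noteq> v \<longrightarrow> E u v)"

text \<open>\<open>k\<close> is the surplus, with degrees counted inside \<open>X\<close>. The
  theorem concerns surplus 1; the induction uses surplus 2.\<close>

definition ore :: "('a \<Rightarrow> 'a \<Rightarrow> bool) \<Rightarrow> 'a set \<Rightarrow> nat \<Rightarrow> bool" where
  "ore E X k \<longleftrightarrow> (\<forall>u\<in>X. \<forall>v\<in>X. u \<noteq> v \<and> \<not> E u v \<longrightarrow> card X + k \<le> degree X E u + degree X E v)"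

lemma degree_Un:
  "finite A \<Longrightarrow> finite B \<Longrightarrow> A \<inter> B = {} \<Longrightarrow> degree (A \<union> B) E w = degree A E w + degree B E w"
proof -
  assume "finite A" "finite B" "A \<inter> B = {}"
  moreover have "{v \<in> A \<union> B. E w v} = {v \<in> A. E w v} \<union> {v \<in> B. E w v}" by auto
  ultimately show ?thesis unfolding degree_def by (simp add: card_Un_disjoint disjoint_iff)
qed

lemma degree_mono: "finite B \<Longrightarrow> A \<subseteq> B \<Longrightarrow> degree A E w \<le> degree B E w"
  unfolding degree_def by (rule card_mono) auto

lemma degree_le_card: "finite A \<Longrightarrow> degree A E w \<le> card A"
  unfolding degree_def by (rule card_mono) auto

lemma degree_insert:
  "finite A \<Longrightarrow> x \<notin> A \<Longrightarrow> degree (insert x A) E w = (if E w x then 1 else 0) + degree A E w"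
proof -
  assume "finite A" "x \<notin> A"
  moreover have "{v \<in> {x}. E w v} = (if E w x then {x} else {})" by auto
  ultimately show ?thesis using degree_Un[of "{x}" A E w] by (simp add: degree_def)
qed

lemma degree_empty: "degree {} E w = 0"
  by (simp add: degree_def)

lemma degree_pos: "finite A \<Longrightarrow> x \<in> A \<Longrightarrow> E w x \<Longrightarrow> 1 \<le> degree A E w"
  unfolding degree_def by (metis (mono_tags, lifting) One_nat_def Suc_leI card_gt_0_iff empty_iff
      finite_subset mem_Collect_eq subsetI)

lemma degree_posD: "1 \<le> degree A E w \<Longrightarrow> \<exists>x\<in>A. E w x"
  unfolding degree_def by (metis (mono_tags, lifting) Collect_empty_eq card.empty not_one_le_zero)

lemma degree_less_card: "degree A E w < card A \<Longrightarrow> \<exists>x\<in>A. \<not> E w x"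
  unfolding degree_def by (metis (mono_tags, lifting) Collect_mem_eq Collect_cong less_irrefl)

text \<open>Double counting of the adjacent pairs with one end in \<open>A\<close> and the other in
  \<open>B\<close>.\<close>

lemma sum_degree_swap:
  assumes "finite A" "finite B" "\<And>u v. E u v \<Longrightarrow> E v u"
  shows "(\<Sum>a\<in>A. degree B E a) = (\<Sum>b\<in>B. degree A E b)"
proof -
  have "degree B E a = (\<Sum>b\<in>B. if E a b then 1 else 0)" for a
    using assms(2) by (simp add: degree_def flip: sum.inter_filter)
  moreover have "degree A E b = (\<Sum>a\<in>A. if E a b then 1 else 0)" for b
  proof -
    have "{v \<in> A. E b v} = {v \<in> A. E v b}" using assms(3) by blast
    then show ?thesis using assms(1) by (simp add: degree_def flip: sum.inter_filter)
  qed
  ultimately show ?thesis by (simp add: sum.swap[of _ A B])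
qed

section \<open>Graphs with an abstract bound on degrees of freedom\<close>

locale dof_graph =
  fixes V :: "'a set" and E :: "'a \<Rightarrow> 'a \<Rightarrow> bool" and D :: "'a set \<Rightarrow> int \<Rightarrow> bool"
  assumes finV: "finite V"
    and E_sym: "E u v \<Longrightarrow> E v u"
    and E_irrefl: "\<not> E u u"
    and D_empty: "D {} (- 6)"
    and D_mono: "D X k \<Longrightarrow> k \<le> l \<Longrightarrow> D X l"
    and D_insert: "D X k \<Longrightarrow> X \<subseteq> V \<Longrightarrow> w \<in> V \<Longrightarrow> w \<notin> X \<Longrightarrow> N \<subseteq> X \<Longrightarrow> card N \<le> 3 \<Longrightarrow>
      \<forall>x\<in>N. E w x \<Longrightarrow> D (insert w X) (k + 3 - int (card N))"
    and D_nonclique: "D X k \<Longrightarrow> X \<subseteq> V \<Longrightarrow> w \<in> V \<Longrightarrow> w \<notin> X \<Longrightarrow> {a, b, c, d} \<subseteq> X \<Longrightarrow>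
      distinct [a, b, c, d] \<Longrightarrow> \<forall>x\<in>{a, b, c, d}. E w x \<Longrightarrow> \<not> E a b \<Longrightarrow> D (insert w X) (k - 1)"
    and D_complete: "D X 0 \<Longrightarrow> X \<subseteq> V \<Longrightarrow> 3 \<le> card X \<Longrightarrow> u \<in> X \<Longrightarrow> v \<in> X \<Longrightarrow> u \<noteq> v \<Longrightarrow> E u v"
begin

text \<open>The purpose of the abstraction: in the induction the vertex set shrinks while
  \<open>E\<close> and \<open>D\<close> stay those of the whole framework, so no closure is
  recomputed on a subset.\<close>

lemma dof_graph_subset: "W \<subseteq> V \<Longrightarrow> dof_graph W E D"
proof
  assume W: "W \<subseteq> V"
  show "finite W" using W finV finite_subset by blast
  show "D (insert w X) (k - 1)"
    if "D X k" "X \<subseteq> W" "w \<in> W" "w \<notin> X" "{a, b, c, d} \<subseteq> X" "distinct [a, b, c, d]"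
      "\<forall>x\<in>{a, b, c, d}. E w x" "\<not> E a b" for X k w a b c d
    by (rule D_nonclique[of X k w a b c d]) (use that W in auto)
  show "D (insert w X) (k + 3 - int (card N))"
    if "D X k" "X \<subseteq> W" "w \<in> W" "w \<notin> X" "N \<subseteq> X" "card N \<le> 3" "\<forall>x\<in>N. E w x" for X k w N
    by (rule D_insert) (use that W in auto)
  show "E u v" if "D X 0" "X \<subseteq> W" "3 \<le> card X" "u \<in> X" "v \<in> X" "u \<noteq> v" for X u v
    by (rule D_complete[of X]) (use that W in auto)
qed (use E_sym E_irrefl D_empty D_mono in auto)

lemma E_commute: "E u v \<longleftrightarrow> E v u"
  using E_sym by blast

lemma fin: "X \<subseteq> V \<Longrightarrow> finite X"
  using finV finite_subset by blast

lemma D_degree: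
  assumes "D X k" "X \<subseteq> V" "w \<in> V" "w \<notin> X" "j \<le> degree X E w" "j \<le> 3"
  shows "D (insert w X) (k + 3 - int j)"
proof -
  obtain N where "N \<subseteq> {v \<in> X. E w v}" "card N = j"
    using assms(5) unfolding degree_def by (metis obtain_subset_with_card_n)
  then show ?thesis using D_insert[OF assms(1-4), of N] assms(6) by auto
qed

lemma D_degree3:
  assumes "D X k" "X \<subseteq> V" "w \<in> V" "w \<notin> X" "3 \<le> degree X E w"
  shows "D (insert w X) k"
  using D_degree[OF assms(1-4), of 3] assms(5) by simp

lemma D_degree4:
  assumes "D X k" "X \<subseteq> V" "w \<in> V" "w \<notin> X" "4 \<le> degree X E w"
    and ab: "a \<in> X" "b \<in> X" "E w a" "E w b" "a \<noteq> b" "\<not> E a b"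
  shows "D (insert w X) (k - 1)"
proof -
  have "card ({v \<in> X. E w v} - {a, b}) = degree X E w - 2"
    unfolding degree_def using ab fin[OF assms(2)] by (subst card_Diff_subset) auto
  then have "2 \<le> card ({v \<in> X. E w v} - {a, b})" using assms(5) by simp
  then obtain S where "S \<subseteq> {v \<in> X. E w v} - {a, b}" "card S = 2"
    by (metis obtain_subset_with_card_n)
  then obtain c d where "{c, d} \<subseteq> {v \<in> X. E w v} - {a, b}" "c \<noteq> d"
    by (metis card_2_iff)
  then show ?thesis
    by (intro D_nonclique[OF assms(1-4), of a b c d]) (use ab in auto)
qed

text \<open>The three neighbours lie in \<open>Y\<close> itself, so the vertices of \<open>S\<close>
  can be added in any order.\<close>

lemma D_Un:
  assumes "D Y k" "Y \<subseteq> V" "S \<subseteq> V" "\<And>x. x \<in> S \<Longrightarrow> 3 \<le> degree Y E x"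
  shows "D (Y \<union> S) k"
proof -
  have "finite S" by (rule fin[OF assms(3)])
  then show ?thesis using assms(3,4)
  proof (induction S rule: finite_induct)
    case empty
    then show ?case using assms(1) by simp
  next
    case (insert x S)
    show ?case
    proof (cases "x \<in> Y \<union> S")
      case True
      then show ?thesis using insert by (simp add: insert_absorb)
    next
      case False
      have "degree Y E x \<le> degree (Y \<union> S) E x"
        by (rule degree_mono) (use insert.prems assms(2) fin in auto)
      moreover have "3 \<le> degree Y E x" using insert.prems(2) by simp
      ultimately have "3 \<le> degree (Y \<union> S) E x" by linarith
      then have "D (insert x (Y \<union> S)) k"
        by (intro D_degree3) (use insert assms(2) False in auto)
      then show ?thesis by simp
    qed
  qed
qed

text \<open>The bound runs through -6, -3, -1, 0 for the empty set, a vertex, an edge and a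
  triangle; every further vertex sees the whole triangle.\<close>

lemma complete_D:
  assumes "complete_on E K" "K \<subseteq> V" "3 \<le> card K"
  shows "D K 0"
proof -
  obtain T where T: "T \<subseteq> K" "card T = 3" using assms(3) by (metis obtain_subset_with_card_n)
  then obtain a b c where abc: "T = {a, b, c}" "a \<noteq> b" "a \<noteq> c" "b \<noteq> c" by (metis card_3_iff)
  then have mem: "a \<in> K" "b \<in> K" "c \<in> K" using T by auto
  then have E: "E b a" "E c a" "E c b" using assms(1) abc by (auto simp: complete_on_def)
  have "D {a} (- 3)" using D_insert[OF D_empty, of a "{}"] mem assms(2) by auto
  then have "D {b, a} (- 1)" using D_insert[of "{a}" "-3" b "{a}"] mem assms(2) abc E by auto
  then have "D {c, b, a} 0" using D_insert[of "{b, a}" "-1" c "{b, a}"] mem assms(2) abc E by auto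
  moreover have "3 \<le> degree T E x" if "x \<in> K - T" for x
  proof -
    have "E x v" if "v \<in> T" for v
      using assms(1)[unfolded complete_on_def, rule_format, of x v] T(1) that \<open>x \<in> K - T\<close> by auto
    then have "{v \<in> T. E x v} = T" by blast
    then show ?thesis unfolding degree_def using T(2) by simp
  qed
  ultimately have "D (T \<union> (K - T)) 0"
    using abc(1) T(1) assms(2) by (intro D_Un) (auto simp: insert_commute)
  then show ?thesis using T(1) by (simp add: Un_absorb1)
qed

lemma complete_adjacent:
  assumes "complete_on E K" "K \<subseteq> V" "3 \<le> card K" "w \<in> V" "w \<notin> K" "3 \<le> degree K E w" "x \<in> K"
  shows "E w x"
proof -
  have "D (insert w K) 0"
    using D_degree3[OF complete_D[OF assms(1-3)] assms(2,4,5,6)] .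
  then show ?thesis
    by (rule D_complete) (use assms fin[of K] in auto)
qed

end

section \<open>Noncomplete graphs satisfying the degree condition\<close>

locale ore_graph = dof_graph +
  assumes ore: "ore E V 1" and noncomplete: "\<not> complete_on E V"
begin

lemma ore_degree: "u \<in> V \<Longrightarrow> v \<in> V \<Longrightarrow> u \<noteq> v \<Longrightarrow> \<not> E u v \<Longrightarrow>
    card V + 1 \<le> degree V E u + degree V E v"
  using ore unfolding ore_def by blast

text \<open>Inclusion and exclusion: the neighbourhoods have total size at least n + 1 and both lie
  among the n - 2 vertices other than \<open>u\<close> and \<open>v\<close>.\<close>

lemma common_neighbours:
  assumes "u \<in> V" "v \<in> V" "u \<noteq> v" "\<not> E u v"
  shows "3 \<le> card {x \<in> V. E u x \<and> E v x}"
proof -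
  let ?A = "{x \<in> V. E u x}" and ?B = "{x \<in> V. E v x}"
  have "?A \<union> ?B \<subseteq> V - {u, v}" using assms E_irrefl E_sym by blast
  then have "card (?A \<union> ?B) \<le> card (V - {u, v})" using finV by (intro card_mono) auto
  also have "\<dots> = card V - 2" using assms finV by (subst card_Diff_subset) auto
  finally have "card (?A \<union> ?B) \<le> card V - 2" .
  moreover have "card ?A + card ?B = card (?A \<union> ?B) + card (?A \<inter> ?B)"
    using finV by (intro card_Un_Int) auto
  moreover have "card V + 1 \<le> card ?A + card ?B"
    using ore_degree[OF assms] by (simp add: degree_def)
  moreover have "2 \<le> card V"
    using card_mono[OF finV, of "{u, v}"] assms by simp
  moreover have "?A \<inter> ?B = {x \<in> V. E u x \<and> E v x}" by auto
  ultimately show ?thesis by simp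
qed

text \<open>If the common neighbours formed a clique, adding \<open>u\<close> would keep it one.
  Then \<open>v\<close>, with three neighbours in it, would be adjacent to all of it, including
  \<open>u\<close>.\<close>

lemma common_nonclique:
  assumes "u \<in> V" "v \<in> V" "u \<noteq> v" "\<not> E u v"
  obtains x y where "x \<in> V" "y \<in> V" "x \<noteq> y" "\<not> E x y" "E u x" "E v x" "E u y" "E v y"
proof -
  let ?C = "{x \<in> V. E u x \<and> E v x}"
  have "\<not> complete_on E ?C"
  proof
    assume c: "complete_on E ?C"
    have u: "u \<notin> ?C" "v \<notin> insert u ?C" using E_irrefl assms by auto
    have c': "complete_on E (insert u ?C)"
      unfolding complete_on_def
    proof (intro ballI impI)
      fix a b assume ab: "a \<in> insert u ?C" "b \<in> insert u ?C" "a \<noteq> b"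
      show "E a b"
      proof (cases "a = u \<or> b = u")
        case True
        then show ?thesis using ab E_commute by auto
      next
        case False
        then show ?thesis using ab c unfolding complete_on_def by blast
      qed
    qed
    have "card (insert u ?C) = Suc (card ?C)" using u finV by simp
    then have k: "3 \<le> card (insert u ?C)" using common_neighbours[OF assms] by simp
    have "card ?C \<le> degree (insert u ?C) E v"
      unfolding degree_def using finV by (intro card_mono) auto
    then have d: "3 \<le> degree (insert u ?C) E v" using common_neighbours[OF assms] by simp
    have "insert u ?C \<subseteq> V" using assms(1) by auto
    then have "E v u" by (rule complete_adjacent[OF c' _ k assms(2) u(2) d]) simp
    then show False using E_commute[of u v] assms(4) by simp
  qed
  then show thesis using that unfolding complete_on_def by blast
qed

text \<open>If \<open>z\<close> is adjacent to all other vertices, any nonadjacent pair will do;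
  otherwise a non-neighbour of \<open>z\<close> supplies the pair among the common
  neighbours.\<close>

lemma neighbourhood_nonclique:
  assumes "z \<in> V"
  obtains a b where "a \<in> V" "b \<in> V" "a \<noteq> b" "\<not> E a b" "E z a" "E z b"
proof (cases "\<forall>u\<in>V. u \<noteq> z \<longrightarrow> E z u")
  case True
  obtain a b where ab: "a \<in> V" "b \<in> V" "a \<noteq> b" "\<not> E a b"
    using noncomplete unfolding complete_on_def by blast
  moreover have "a \<noteq> z" using True ab by metis
  moreover have "b \<noteq> z" using True ab E_commute by metis
  ultimately show thesis using that[of a b] True by simp
next
  case False
  then obtain u where "u \<in> V" "u \<noteq> z" "\<not> E z u" by blast
  then show thesis using common_nonclique[of z u] assms that by metis
qed

definition square :: "'a \<Rightarrow> 'a \<Rightarrow> 'a \<Rightarrow> 'a \<Rightarrow> bool" where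
  "square u v x y \<longleftrightarrow> {u, v, x, y} \<subseteq> V \<and> distinct [u, v, x, y] \<and> \<not> E u v \<and> \<not> E x y \<and>
     E u x \<and> E u y \<and> E v x \<and> E v y"

lemma square_exists: obtains u v x y where "square u v x y"
proof -
  obtain u v where uv: "u \<in> V" "v \<in> V" "u \<noteq> v" "\<not> E u v"
    using noncomplete unfolding complete_on_def by blast
  obtain x y where "x \<in> V" "y \<in> V" "x \<noteq> y" "\<not> E x y" "E u x" "E v x" "E u y" "E v y"
    using common_nonclique[OF uv] .
  then have "square u v x y" using uv E_irrefl unfolding square_def by auto
  then show thesis using that by blast
qed

lemma square_D:
  assumes "square u v x y"
  shows "D {u, v, x, y} 2"
proof -
  note s = assms[unfolded square_def]
  \<comment> \<open>Successive vertices are attached by 0, 1, 1 and 2 edges, which gives the bounds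
    -3, -1, 1, 2.\<close>
  have "D {u} (- 3)" using D_insert[OF D_empty, of u "{}"] s by auto
  then have "D {x, u} (- 1)" using D_insert[of "{u}" "-3" x "{u}"] s by (auto simp: E_commute)
  then have "D {v, x, u} 1" using D_insert[of "{x, u}" "-1" v "{x}"] s by (auto simp: E_commute)
  then have "D {y, v, x, u} 2" using D_insert[of "{v, x, u}" 1 y "{u, v}"] s by (auto simp: E_commute)
  moreover have "{y, v, x, u} = {u, v, x, y}" by auto
  ultimately show ?thesis by simp
qed

text \<open>The contradiction aimed at throughout: bound 0 would make the set a clique, against the
  diagonals of the square.\<close>

lemma D_nonneg:
  assumes "square u v x y" "{u, v, x, y} \<subseteq> X" "X \<subseteq> V" "D X 0"
  shows False
proof -
  have "card {u, v, x, y} = 4" using assms(1) by (simp add: square_def)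
  then have "3 \<le> card X" using card_mono[OF fin[OF assms(3)] assms(2)] by simp
  then have "E u v" using D_complete[OF assms(4,3)] assms(1,2) by (auto simp: square_def)
  then show False using assms(1) by (simp add: square_def)
qed

text \<open>Three of the four vertices of the square include one of its two nonadjacent pairs.\<close>

lemma square_neighbours:
  assumes "square u v x y" "3 \<le> degree {u, v, x, y} E w"
  obtains a b where "a \<in> {u, v, x, y}" "b \<in> {u, v, x, y}" "E w a" "E w b" "a \<noteq> b" "\<not> E a b"
proof -
  have "E w u \<and> E w v \<or> E w x \<and> E w y"
    using assms unfolding square_def
    by (auto simp: degree_insert degree_empty split: if_splits)
  then show thesis using that[of u v] that[of x y] assms(1) by (auto simp: square_def)
qed

text \<open>Every vertex outside \<open>X\<close> has few neighbours in \<open>X\<close>, which by the degree condition makes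
  \<open>W = V - X\<close> so dense that the induction hypothesis applies to it.\<close>

lemma sparse_extension:
  assumes IH: "\<And>W. W \<subset> V \<Longrightarrow> ore E W 2 \<Longrightarrow> complete_on E W"
    and sq: "square u v x y" and C: "{u, v, x, y} \<subseteq> X" and X: "X \<subset> V" "6 \<le> card X" and D: "D X 2"
    and sparse: "\<And>w. w \<in> V - X \<Longrightarrow> degree X E w \<le> 2"
  shows False
proof -
  let ?C = "{u, v, x, y}"
  define W where "W = V - X"
  \<comment> \<open>\<open>\<kappa> z\<close> counts the other vertices of \<open>X\<close> not
    adjacent to \<open>z\<close>, and \<open>c w\<close> does the same inside \<open>W\<close>. In
    these terms the degree condition for a nonadjacent pair between \<open>X\<close> and
    \<open>W\<close> is \<open>star\<close>.\<close>
  define \<kappa> where "\<kappa> z = card X - 1 - degree X E z" for z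
  define c where "c w = card W - 1 - degree W E w" for w
  have XV: "X \<subseteq> V" "W \<subseteq> V" "X \<inter> W = {}" "X \<union> W = V" using X(1) by (auto simp: W_def)
  have finX: "finite X" and finW: "finite W" using XV fin by auto
  have cardC: "card ?C = 4" using sq by (simp add: square_def)
  have cardV: "card V = card X + card W"
    using card_Un_disjoint[OF finX finW] XV by simp
  have degV: "degree V E z = degree X E z + degree W E z" for z
    using degree_Un[OF finX finW, of E z] XV by simp
  have deg_self: "degree A E z \<le> card A - 1" if "finite A" "z \<in> A" for A z
  proof -
    have "{v \<in> A. E z v} \<subseteq> A - {z}" using E_irrefl by auto
    then have "degree A E z \<le> card (A - {z})" unfolding degree_def using that by (intro card_mono) auto
    then show ?thesis using that by simp
  qed
  have \<kappa>: "degree X E z + \<kappa> z = card X - 1" if "z \<in> X" for z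
    using deg_self[OF finX that] by (simp add: \<kappa>_def)
  have c: "degree W E w + c w = card W - 1" if "w \<in> W" for w
    using deg_self[OF finW that] by (simp add: c_def)
  have star: "\<kappa> z + c w + 3 \<le> degree W E z + degree X E w" if "z \<in> X" "w \<in> W" "\<not> E w z" for z w
  proof -
    have "card V + 1 \<le> degree V E z + degree V E w"
      using ore_degree[of z w] that XV E_commute by blast
    moreover have "1 \<le> card X" "1 \<le> card W"
      using that finX finW by (auto simp: Suc_le_eq card_gt_0_iff)
    ultimately show ?thesis
      using \<kappa>[OF that(1)] c[OF that(2)] unfolding cardV degV by linarith
  qed
  have b2: "degree X E w \<le> 2" if "w \<in> W" for w using sparse that by (simp add: W_def)
  obtain w0 where w0: "w0 \<in> W" using X(1) by (auto simp: W_def)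
  have out1: "1 \<le> degree W E z" if "z \<in> X" for z
  proof (cases "E w0 z")
    case True
    then show ?thesis using degree_pos[OF finW w0, of E z] E_commute by blast
  next
    case False
    then show ?thesis using star[OF that w0] b2[OF w0] by linarith
  qed
  have \<kappa>C: "1 \<le> \<kappa> z" if "z \<in> ?C" for z
  proof -
    have "\<not> E u v" "\<not> E v u" "\<not> E x y" "\<not> E y x" "u \<noteq> v" "x \<noteq> y"
      using sq E_commute[of u v] E_commute[of x y] unfolding square_def by auto
    then have "\<exists>z'\<in>?C. z' \<noteq> z \<and> \<not> E z z'" using that by auto
    then obtain z' where z': "z' \<in> X" "z' \<noteq> z" "\<not> E z z'" using C by blast
    have "{v \<in> X. E z v} \<subseteq> X - {z, z'}" using z' E_irrefl by auto
    then have "degree X E z \<le> card (X - {z, z'})"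
      unfolding degree_def using finX by (intro card_mono) auto
    also have "\<dots> = card X - 2" using z' that C finX by (subst card_Diff_subset) auto
    finally show ?thesis using X(2) by (simp add: \<kappa>_def)
  qed
  have total: "(\<Sum>z\<in>X. degree W E z) = (\<Sum>w\<in>W. degree X E w)"
    by (rule sum_degree_swap[OF finX finW E_sym])
  also have "\<dots> \<le> (\<Sum>w\<in>W. 2)" by (rule sum_mono) (use b2 in auto)
  finally have total2: "(\<Sum>z\<in>X. degree W E z) \<le> 2 * card W" by simp
  \<comment> \<open>\<open>star\<close> is summed over the non-neighbours \<open>?Z\<close> of
    \<open>w\<close> in \<open>X\<close>. At least two corners of the square are in
    \<open>?Z\<close>, so the values of \<open>\<kappa>\<close> add up to at least 2; by
    \<open>out1\<close>, each neighbour of \<open>w\<close> in \<open>X\<close> takes at least one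
    of the at most 2 |W| edges away from \<open>?Z\<close>.\<close>
  have c_bound: "2 * c w + 4 \<le> card W" if w: "w \<in> W" for w
  proof -
    let ?Z = "{z \<in> X. \<not> E w z}" and ?A = "{z \<in> X. E w z}"
    let ?b = "degree X E w"
    have ZA: "?Z \<union> ?A = X" "?Z \<inter> ?A = {}" "finite ?Z" "finite ?A" using finX by auto
    have cA: "card ?A = ?b" by (simp add: degree_def)
    have cZ: "card ?Z = card X - ?b"
      using card_Un_disjoint[OF ZA(3,4,2)] ZA(1) cA by simp
    have "(\<Sum>z\<in>X. degree W E z) = (\<Sum>z\<in>?Z. degree W E z) + (\<Sum>z\<in>?A. degree W E z)"
      using sum.union_disjoint[OF ZA(3,4,2), of "degree W E"] ZA(1) by simp
    moreover have "(\<Sum>z\<in>?A. 1) \<le> (\<Sum>z\<in>?A. degree W E z)" by (rule sum_mono) (use out1 in auto)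
    ultimately have le: "(\<Sum>z\<in>?Z. degree W E z) + ?b \<le> 2 * card W" using total2 cA by simp
    have "2 \<le> card (?C \<inter> ?Z)"
    proof -
      have "?C \<inter> ?Z = ?C - ?A" using C by auto
      moreover have "card ?C - card ?A \<le> card (?C - ?A)" by (rule diff_card_le_card_Diff) (rule ZA(4))
      ultimately show ?thesis using cardC cA b2[OF w] by simp
    qed
    also have "card (?C \<inter> ?Z) = (\<Sum>z\<in>?C \<inter> ?Z. 1)" by simp
    also have "\<dots> \<le> (\<Sum>z\<in>?C \<inter> ?Z. \<kappa> z)" by (rule sum_mono) (use \<kappa>C in auto)
    also have "\<dots> \<le> (\<Sum>z\<in>?Z. \<kappa> z)" by (rule sum_mono2) (use ZA in auto)
    finally have k2: "2 \<le> (\<Sum>z\<in>?Z. \<kappa> z)" .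
    have "(\<Sum>z\<in>?Z. \<kappa> z + (c w + 3)) \<le> (\<Sum>z\<in>?Z. degree W E z + ?b)"
      by (rule sum_mono) (use star w in \<open>auto simp: add.assoc\<close>)
    then have main: "2 + card ?Z * (c w + 3) + ?b \<le> 2 * card W + card ?Z * ?b"
      using le k2 by (simp add: sum.distrib)
    define m where "m = card ?Z"
    \<comment> \<open>This is where \<open>6 \<le> card X\<close> enters. The extreme case is
      \<open>?b = 2\<close> with four non-neighbours, where the inequality is exactly twice the
      claim.\<close>
    have m: "6 \<le> m + ?b" using cZ X(2) b2[OF w] unfolding m_def by simp
    consider "?b = 0" | "?b = 1" | "?b = 2" using b2[OF w] by linarith
    then show ?thesis
    proof cases
      case 1
      then have "2 + m * (c w + 3) \<le> 2 * card W" using main unfolding m_def by simp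
      moreover have "6 * (c w + 3) \<le> m * (c w + 3)" using m 1 by (intro mult_right_mono) auto
      ultimately show ?thesis by simp
    next
      case 2
      then have "2 + m * (c w + 2) + 1 \<le> 2 * card W"
        using main unfolding m_def[symmetric] by (simp add: algebra_simps)
      moreover have "5 * (c w + 2) \<le> m * (c w + 2)" using m 2 by (intro mult_right_mono) auto
      ultimately show ?thesis by simp
    next
      case 3
      then have "2 + m * (c w + 1) + 2 \<le> 2 * card W"
        using main unfolding m_def[symmetric] by (simp add: algebra_simps)
      moreover have "4 * (c w + 1) \<le> m * (c w + 1)" using m 3 by (intro mult_right_mono) auto
      ultimately show ?thesis by simp
    qed
  qed
  have cW4: "4 \<le> card W" using c_bound[OF w0] by simp
  \<comment> \<open>Two vertices of \<open>W\<close> have degree sum at least 2 |W| - 2 - (|W| - 4)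
    = |W| + 2.\<close>
  have "ore E W 2"
    unfolding ore_def
  proof (intro ballI impI)
    fix w w' assume "w \<in> W" "w' \<in> W"
    then show "card W + 2 \<le> degree W E w + degree W E w'"
      using c_bound[of w] c_bound[of w'] c[of w] c[of w'] cW4 by linarith
  qed
  moreover have "W \<subset> V" using XV C sq by (auto simp: square_def)
  ultimately have cW: "complete_on E W" using IH by blast
  have all: "E z w" if "z \<in> X" "w \<in> W" "3 \<le> degree W E z" for z w
  proof (rule complete_adjacent[OF cW XV(2) _ _ _ that(3,2)])
    show "3 \<le> card W" using cW4 by simp
    show "z \<in> V" "z \<notin> W" using that(1) XV(1,3) by blast+
  qed
  \<comment> \<open>With fewer than two neighbours in \<open>X\<close>, \<open>w\<close> misses a
    corner \<open>z\<close>; then \<open>star\<close> and \<open>\<kappa>C\<close> give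
    \<open>z\<close> three neighbours in the clique \<open>W\<close>, and by \<open>all\<close> it
    is adjacent to \<open>w\<close> after all.\<close>
  have b: "degree X E w = 2" if w: "w \<in> W" for w
  proof (rule ccontr)
    assume "degree X E w \<noteq> 2"
    then have lt: "degree X E w < 2" using b2[OF w] by simp
    have "degree ?C E w \<le> degree X E w" by (rule degree_mono[OF finX C])
    then have "degree ?C E w < card ?C" using lt cardC by simp
    then obtain z where z: "z \<in> ?C" "\<not> E w z" by (elim degree_less_card[THEN bexE])
    then have "z \<in> X" using C by blast
    have "3 \<le> degree W E z" using star[OF \<open>z \<in> X\<close> w z(2)] \<kappa>C[OF z(1)] lt by linarith
    then have "E z w" by (rule all[OF \<open>z \<in> X\<close> w])
    then show False using z(2) E_commute[of z w] by simp
  qed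
  have out2: "2 \<le> degree W E z" if z: "z \<in> ?C" for z
  proof (cases "E w0 z \<and> degree W E z = card W")
    case True
    then show ?thesis using cW4 by simp
  next
    case False
    have zX: "z \<in> X" using z C by blast
    obtain w where w: "w \<in> W" "\<not> E w z"
    proof (cases "E w0 z")
      case True
      then have "degree W E z < card W"
        using False degree_le_card[OF finW, of E z] by simp
      then obtain w where "w \<in> W" "\<not> E z w" by (elim degree_less_card[THEN bexE])
      then show ?thesis using that[of w] E_commute[of z w] by simp
    qed (use that w0 in blast)
    then show ?thesis using star[OF zX w] \<kappa>C[OF z] b[OF w(1)] by linarith
  qed
  \<comment> \<open>Every vertex of \<open>X\<close> sends an edge to \<open>W\<close> and each of
    the four corners a second one, out of at most 2 |W|.\<close>
  have "card X + 4 \<le> 2 * card W"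
  proof -
    have "(\<Sum>z\<in>X. 1 + (if z \<in> ?C then 1 else 0)) \<le> (\<Sum>z\<in>X. degree W E z)"
    proof (rule sum_mono)
      fix z assume "z \<in> X"
      show "1 + (if z \<in> ?C then 1 else 0) \<le> degree W E z"
      proof (cases "z \<in> ?C")
        case True
        then show ?thesis using out2[OF True] by (simp only: if_True)
      next
        case False
        then show ?thesis using out1[OF \<open>z \<in> X\<close>] by (simp only: if_False add_0_right)
      qed
    qed
    moreover have "(\<Sum>z\<in>X. if z \<in> ?C then 1 else 0) = card ?C"
    proof -
      have "{z \<in> X. z \<in> ?C} = ?C" using C by blast
      then show ?thesis using finX by (simp flip: sum.inter_filter)
    qed
    moreover have "(\<Sum>z\<in>X. 1 + (if z \<in> ?C then 1 else 0)) = card X + (\<Sum>z\<in>X. if z \<in> ?C then 1 else 0)"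
      by (simp only: sum.distrib card_eq_sum)
    ultimately show ?thesis using total2 cardC by linarith
  qed
  then have cW5: "5 \<le> card W" using X(2) by simp
  \<comment> \<open>\<open>z\<close> separates the neighbourhoods of \<open>w0\<close> and
    \<open>w1\<close> in \<open>X\<close>. The two neighbours of a further \<open>w\<close> cannot
    be those of both, which provides the nonadjacent pair that \<open>step\<close> needs.\<close>
  have "degree X E w0 < card X" using b[OF w0] X(2) by simp
  then obtain z where z: "z \<in> X" "\<not> E w0 z" by (elim degree_less_card[THEN bexE])
  obtain w1 where w1: "w1 \<in> W" "E z w1" using degree_posD[OF out1[OF z(1)]] by (elim bexE)
  have ne: "w1 \<noteq> w0" using z(2) w1(2) E_commute[of z w0] by auto
  have nbs: "{a \<in> X. E w0 a} \<noteq> {a \<in> X. E w1 a}"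
  proof -
    have "z \<notin> {a \<in> X. E w0 a}" "z \<in> {a \<in> X. E w1 a}"
      using z w1(2) E_commute[of z w1] by auto
    then show ?thesis by metis
  qed
  have "card (W - {w0, w1}) = card W - 2" using ne w0 w1 finW by (subst card_Diff_subset) auto
  then have "3 \<le> card (W - {w0, w1})" using cW5 by simp
  then obtain S where S: "S \<subseteq> W - {w0, w1}" "card S = 3" by (metis obtain_subset_with_card_n)
  then obtain w2 w3 w4 where w234: "S = {w2, w3, w4}" "w2 \<noteq> w3" "w2 \<noteq> w4" "w3 \<noteq> w4"
    by (metis card_3_iff)
  then have ws: "w2 \<in> W" "w3 \<in> W" "w4 \<in> W" "w2 \<notin> {w0, w1}" "w3 \<notin> {w0, w1}" "w4 \<notin> {w0, w1}"
    using S by auto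
  have step: "D (insert w Y) (k - 1)"
    if Y: "D Y k" "Y \<subseteq> V" "insert w1 (insert w0 X) \<subseteq> Y" and w: "w \<in> W" "w \<notin> Y" for w Y k
  proof -
    have adj: "E w w0" "E w w1" using cW w Y(3) w0 w1 by (auto simp: complete_on_def)
    have "degree (insert w1 (insert w0 X)) E w \<le> degree Y E w"
      by (rule degree_mono[OF fin[OF Y(2)] Y(3)])
    moreover have "degree (insert w1 (insert w0 X)) E w = 4"
      using adj ne w0 w1 finX b[OF w(1)] XV(3) by (subst degree_insert; (subst degree_insert)?) auto
    ultimately have d4: "4 \<le> degree Y E w" by simp
    have "\<exists>a\<in>X. \<exists>w'\<in>{w0, w1}. E w a \<and> \<not> E w' a"
    proof (rule ccontr)
      assume "\<not> ?thesis"
      then have s: "{a \<in> X. E w a} \<subseteq> {a \<in> X. E w' a}" if "w' \<in> {w0, w1}" for w' using that by blast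
      have "card {a \<in> X. E w a} = 2" "card {a \<in> X. E w0 a} = 2" "card {a \<in> X. E w1 a} = 2"
        using b w(1) w0 w1(1) by (auto simp: degree_def)
      then have "{a \<in> X. E w a} = {a \<in> X. E w0 a}" "{a \<in> X. E w a} = {a \<in> X. E w1 a}"
        using finX by (intro card_subset_eq s; simp)+
      then show False using nbs by simp
    qed
    then obtain a w' where a: "a \<in> X" "w' \<in> {w0, w1}" "E w a" "\<not> E w' a" by blast
    moreover have "w' \<noteq> a" using a w0 w1 XV(3) by auto
    ultimately show ?thesis
      using adj Y w XV by (intro D_degree4[OF Y(1,2) _ w(2) d4, of w' a]) auto
  qed
  have in_V: "w0 \<in> V" "w1 \<in> V" "w2 \<in> V" "w3 \<in> V" "w4 \<in> V" using w0 w1 ws XV by auto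
  have notX: "w0 \<notin> X" "w1 \<notin> X" "w2 \<notin> X" "w3 \<notin> X" "w4 \<notin> X" using w0 w1 ws XV by auto
  \<comment> \<open>\<open>w0\<close> has two neighbours and raises the bound to 3,
    \<open>w1\<close> keeps it, and three further vertices of the clique bring it to 0.\<close>
  have D0: "D (insert w0 X) 3"
    using D_degree[OF D XV(1) in_V(1) notX(1), of 2] b[OF w0] by simp
  have "E w1 w0" using cW ne w0 w1 by (auto simp: complete_on_def)
  then have "degree (insert w0 X) E w1 = 3"
    using b[OF w1(1)] notX finX by (subst degree_insert) auto
  then have D1: "D (insert w1 (insert w0 X)) 3"
    using D_degree3[OF D0 _ in_V(2)] XV in_V notX ne by auto
  have D2: "D (insert w2 (insert w1 (insert w0 X))) 2"
    using step[OF D1 _ _ ws(1)] XV(1) in_V notX ws by auto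
  have D3: "D (insert w3 (insert w2 (insert w1 (insert w0 X)))) 1"
    using step[OF D2 _ _ ws(2)] XV(1) in_V notX ws w234 by auto
  have "D (insert w4 (insert w3 (insert w2 (insert w1 (insert w0 X))))) 0"
    using step[OF D3 _ _ ws(3)] XV(1) in_V notX ws w234 by auto
  then show False
    by (rule D_nonneg[OF sq, rotated 2]) (use C XV(1) in_V in auto)
qed

text \<open>Take a maximal proper \<open>X\<close> with bound 1. A vertex with three neighbours in
  \<open>X\<close> would complete \<open>V\<close>; it then has at least four neighbours in
  \<open>X\<close>, not all adjacent, and the bound drops to 0. So there is no such vertex, and
  \<open>sparse_extension\<close> applies.\<close>

lemma tight_extension:
  assumes IH: "\<And>W. W \<subset> V \<Longrightarrow> ore E W 2 \<Longrightarrow> complete_on E W"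
    and deg4: "\<And>z. z \<in> V \<Longrightarrow> 4 \<le> degree V E z"
    and sq: "square u v x y" and C: "{u, v, x, y} \<subseteq> X0" and X0: "X0 \<subset> V" "6 \<le> card X0" and D: "D X0 1"
  shows False
proof -
  let ?P = "{X. X0 \<subseteq> X \<and> X \<subset> V \<and> D X 1}"
  have "finite ?P" by (rule finite_subset[of _ "Pow V"]) (use finV in auto)
  moreover have "X0 \<in> ?P" using X0 D by simp
  ultimately obtain X where X: "X \<in> ?P" and mx: "\<forall>Y\<in>?P. X \<subseteq> Y \<longrightarrow> X = Y"
    using finite_has_maximal[of ?P] by auto
  then have XP: "X0 \<subseteq> X" "X \<subset> V" "D X 1" by auto
  have sparse: "degree X E w \<le> 2" if w: "w \<in> V - X" for w
  proof (rule ccontr)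
    assume "\<not> degree X E w \<le> 2"
    then have "D (insert w X) 1" using D_degree3[OF XP(3), of w] XP(2) w by auto
    moreover have "X \<noteq> insert w X" using w by blast
    ultimately have V: "insert w X = V" using mx XP w by blast
    have "degree V E w = degree X E w"
      using degree_insert[of X w E w] w XP(2) E_irrefl fin[of X] V by auto
    then have 4: "4 \<le> degree X E w" using deg4[of w] w by simp
    obtain a b where ab: "a \<in> V" "b \<in> V" "a \<noteq> b" "\<not> E a b" "E w a" "E w b"
      using neighbourhood_nonclique[of w] w by auto
    have "a \<noteq> w" "b \<noteq> w" using ab E_irrefl by auto
    then have "D (insert w X) (1 - 1)"
      using ab V w XP(2) by (intro D_degree4[OF XP(3) _ _ _ 4, of a b]) auto
    then show False
      using D_nonneg[OF sq, of "insert w X"] C XP V by auto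
  qed
  have "6 \<le> card X" using card_mono[OF fin[of X] XP(1)] XP(2) X0(2) by auto
  then show False
    using sparse_extension[OF IH sq _ XP(2) _ D_mono[OF XP(3)] sparse] C XP(1) by auto
qed

end

section \<open>Exceptional graphs by their missing edges, and how they arise\<close>

definition complement_is :: "('a \<Rightarrow> 'a \<Rightarrow> bool) \<Rightarrow> 'a set \<Rightarrow> 'a set set \<Rightarrow> bool" where
  "complement_is E V L \<longleftrightarrow> (\<forall>s\<in>V. \<forall>t\<in>V. E s t \<longleftrightarrow> s \<noteq> t \<and> {s, t} \<notin> L)"

definition wheel_like :: "('a \<Rightarrow> 'a \<Rightarrow> bool) \<Rightarrow> 'a set \<Rightarrow> bool" where
  "wheel_like E V \<longleftrightarrow> (\<exists>a b c d e. distinct [a, b, c, d, e] \<and> V = {a, b, c, d, e} \<and>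
     complement_is E V {{a, b}, {c, d}})"

definition B6_like :: "('a \<Rightarrow> 'a \<Rightarrow> bool) \<Rightarrow> 'a set \<Rightarrow> bool" where
  "B6_like E V \<longleftrightarrow> (\<exists>a b c d e f. distinct [a, b, c, d, e, f] \<and> V = {a, b, c, d, e, f} \<and>
     complement_is E V {{a, b}, {b, c}, {d, e}, {e, f}})"

text \<open>Covers both exceptional graphs on seven vertices at once; their isomorphism type is
  separated only at the end.\<close>

definition four_regular7 :: "('a \<Rightarrow> 'a \<Rightarrow> bool) \<Rightarrow> 'a set \<Rightarrow> bool" where
  "four_regular7 E V \<longleftrightarrow> card V = 7 \<and> (\<forall>z\<in>V. degree V E z = 4)"

context ore_graph
begin

lemma wheel_likeI:
  assumes "distinct [x, y, u, v, z]" "V = {x, y, u, v, z}" "\<not> E x y" "\<not> E u v"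
    and "E x u" "E x v" "E x z" "E y u" "E y v" "E y z" "E u z" "E v z"
  shows "wheel_like E V"
  unfolding wheel_like_def complement_is_def
proof (intro exI conjI)
  have "\<not> E y x" "\<not> E v u" "E u x" "E v x" "E z x" "E u y" "E v y" "E z y" "E z u" "E z v"
    using assms(3-) E_commute by metis+
  moreover have "distinct [z, v, u, y, x]" using assms(1) by auto
  ultimately show "\<forall>s\<in>V. \<forall>t\<in>V. E s t \<longleftrightarrow> s \<noteq> t \<and> {s, t} \<notin> {{x, y}, {u, v}}"
    using assms E_irrefl by (simp add: doubleton_eq_iff)
qed (rule assms(1,2))+

lemma B6_likeI:
  assumes "distinct [x, y, z, u, v, w]" "V = {x, y, z, u, v, w}"
    and "\<not> E x y" "\<not> E y z" "\<not> E u v" "\<not> E v w"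
    and "E x z" "E x u" "E x v" "E x w" "E y u" "E y v" "E y w" "E z u" "E z v" "E z w" "E u w"
  shows "B6_like E V"
  unfolding B6_like_def complement_is_def
proof (intro exI conjI)
  have "\<not> E y x" "\<not> E z y" "\<not> E v u" "\<not> E w v" "E z x" "E u x" "E v x" "E w x" "E u y" "E v y"
    "E w y" "E u z" "E v z" "E w z" "E w u"
    using assms(3-) E_commute by metis+
  moreover have "distinct [w, v, u, z, y, x]" using assms(1) by auto
  ultimately show "\<forall>s\<in>V. \<forall>t\<in>V. E s t \<longleftrightarrow> s \<noteq> t \<and> {s, t} \<notin> {{x, y}, {y, z}, {u, v}, {v, w}}"
    using assms E_irrefl by (simp add: doubleton_eq_iff)
qed (rule assms(1,2))+

text \<open>A non-neighbour \<open>u\<close> shares three neighbours with \<open>v\<close>, so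
  \<open>v\<close> has degree exactly 3, and by the degree condition each vertex of \<open>U\<close>
  is adjacent to all others except \<open>v\<close>. Among the neighbours of \<open>v\<close> there
  is a nonadjacent pair \<open>x\<close>, \<open>y\<close>. One vertex in \<open>U\<close> leads to
  the wheel, two lead to \<open>B6_like\<close>; with three or more, \<open>insert x U\<close> is a
  clique in which \<open>y\<close> has three neighbours, which is impossible.\<close>

lemma low_degree:
  assumes v: "v \<in> V" "degree V E v \<le> 3"
  shows "wheel_like E V \<or> B6_like E V"
proof -
  let ?N = "{x \<in> V. E v x}"
  have cardN: "card ?N \<le> 3" using v(2) by (simp add: degree_def)
  obtain a b where ab: "a \<in> V" "b \<in> V" "a \<noteq> b" "\<not> E a b"
    using noncomplete unfolding complete_on_def by blast
  have "card (insert a (insert b {x \<in> V. E a x \<and> E b x})) = 2 + card {x \<in> V. E a x \<and> E b x}"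
    using ab finV E_irrefl by simp
  moreover have "card (insert a (insert b {x \<in> V. E a x \<and> E b x})) \<le> card V"
    using ab finV by (intro card_mono) auto
  ultimately have n5: "5 \<le> card V" using common_neighbours[OF ab] by simp
  have "\<exists>u\<in>V. u \<noteq> v \<and> \<not> E v u"
  proof (rule ccontr)
    assume "\<not> ?thesis"
    then have "V - {v} \<subseteq> ?N" by blast
    then have "card (V - {v}) \<le> card ?N" using finV by (intro card_mono) auto
    then show False using cardN n5 v(1) finV by simp
  qed
  then obtain u where u: "u \<in> V" "u \<noteq> v" "\<not> E v u" by blast
  let ?M = "{x \<in> V. E v x \<and> E u x}"
  have M3: "3 \<le> card ?M" using common_neighbours[OF v(1) u(1) _ u(3)] u(2) by simp
  have "?M \<subseteq> ?N" by blast
  moreover have "finite ?N" using finV by simp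
  ultimately have card3: "card ?N = 3"
    using card_mono[of ?N ?M] M3 cardN by linarith
  define U where "U = V - insert v ?N"
  have uU: "u \<in> U" using u by (simp add: U_def)
  have finU: "finite U" using finV by (simp add: U_def)
  have "card (insert v ?N) = 4" using card3 finV E_irrefl by simp
  then have cardV: "card V = 4 + card U"
    using card_Diff_subset[of "insert v ?N" V] card_mono[of V "insert v ?N"] finV v(1) by (simp add: U_def)
  have EU: "E s t" if s: "s \<in> U" "t \<in> V" "t \<noteq> s" "t \<noteq> v" for s t
  proof -
    have s': "s \<in> V" "s \<noteq> v" "\<not> E v s" "\<not> E s v" using s(1) E_commute[of v s] by (auto simp: U_def)
    have "card V + 1 \<le> degree V E v + degree V E s" using ore_degree[of v s] v(1) s' by auto
    then have "card V - 2 \<le> card {x \<in> V. E s x}" using v(2) unfolding degree_def by linarith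
    moreover have "card (V - {s, v}) = card V - 2" using s' v(1) finV by (subst card_Diff_subset) auto
    moreover have "{x \<in> V. E s x} \<subseteq> V - {s, v}" using s' E_irrefl by auto
    ultimately have "{x \<in> V. E s x} = V - {s, v}" using finV by (intro card_seteq) auto
    then show ?thesis using s by blast
  qed
  obtain x y where xy: "x \<in> V" "y \<in> V" "x \<noteq> y" "\<not> E x y" "E v x" "E u x" "E v y" "E u y"
    using common_nonclique[OF v(1) u(1) _ u(3)] u(2) by metis
  have "card (?N - {x, y}) = 1"
    using card3 xy finV by (subst card_Diff_subset) auto
  then obtain z where "?N - {x, y} = {z}" by (metis card_1_singletonE)
  then have N: "?N = {x, y, z}" and z: "z \<noteq> x" "z \<noteq> y" using xy by auto
  then have zV: "z \<in> V" "E v z" by blast+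
  have V: "V = {x, y, z} \<union> insert v U" using N v(1) by (auto simp: U_def)
  have ne: "x \<noteq> v" "y \<noteq> v" "z \<noteq> v" using xy zV E_irrefl by auto
  have notU: "v \<notin> U" "x \<notin> U" "y \<notin> U" "z \<notin> U" using xy zV by (auto simp: U_def)
  have sym: "E x v" "E y v" "E z v" "\<not> E u v" "\<not> E y x"
    using xy zV u(3) E_commute by metis+
  have Ux: "E s x" "E s y" "E s z" "E x s" "E y s" "E z s" if "s \<in> U" for s
  proof -
    show "E s x" "E s y" "E s z" using EU[OF that] xy zV ne notU that by auto
    then show "E x s" "E y s" "E z s" using E_commute by metis+
  qed
  have sum: "card V + 1 \<le> degree V E x + degree V E y" using ore_degree xy by blast
  have clique_False: False
    if K: "K \<subseteq> V" "complete_on E K" "3 \<le> card K" "x \<in> K" "y \<notin> K" "3 \<le> degree K E y" for K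
    using complete_adjacent[OF K(2,1,3) xy(2) K(5,6,4)] sym by blast
  consider "card U = 1" | "card U = 2" | "3 \<le> card U"
    using uU finU by (metis One_nat_def Suc_1 Suc_leI card_gt_0_iff empty_iff le_neq_implies_less
        numeral_3_eq_3)
  then show ?thesis
  proof cases
    case 1
    then have "U = {u}" using uU by (metis card_1_singletonE singletonD)
    then have V': "V = {x, y, u, v, z}" using V by auto
    have dist: "distinct [x, y, u, v, z]" using xy z ne notU uU u(2) by auto
    have "degree V E x = 2 + (if E x z then 1 else 0)" "degree V E y = 2 + (if E y z then 1 else 0)"
      unfolding V' using dist sym xy E_irrefl Ux[OF uU] by (auto simp: degree_insert degree_empty)
    then have "E x z" "E y z" using sum cardV 1 by (auto split: if_splits)
    then have "wheel_like E V"
      by (intro wheel_likeI[OF dist V']) (use sym xy zV Ux[OF uU] in auto)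
    then show ?thesis ..
  next
    case 2
    then have "card (U - {u}) = 1" using uU finU by simp
    then obtain w where "U - {u} = {w}" by (metis card_1_singletonE)
    then have U: "U = {u, w}" and w: "w \<noteq> u" "w \<in> U" using uU by auto
    have V': "V = {x, y, z, u, v, w}" using V U by auto
    have dist: "distinct [x, y, z, u, v, w]" using xy z ne notU uU u(2) w by auto
    have uw: "E u w" "E w u" using EU[of u w] EU[of w u] uU w u V' notU by auto
    have wv: "\<not> E v w" "\<not> E w v" using w(2) E_commute[of v w] V' by (auto simp: U_def)
    have "degree V E x = 3 + (if E x z then 1 else 0)" "degree V E y = 3 + (if E y z then 1 else 0)"
      unfolding V' using dist sym xy E_irrefl Ux[OF uU] Ux[OF w(2)]
      by (auto simp: degree_insert degree_empty)
    then have or: "E x z \<or> E y z" using sum cardV 2 by (auto split: if_splits)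
    \<comment> \<open>Both edges would make \<open>{x, z, u, w}\<close> a clique in which
      \<open>y\<close> has three neighbours, forcing the missing edge \<open>xy\<close>.\<close>
    have nand: "\<not> (E x z \<and> E y z)"
    proof
      assume e: "E x z \<and> E y z"
      then have e': "E z x" "E z y" using E_commute by metis+
      have "complete_on E {x, z, u, w}"
        using e e' uw Ux[OF uU] Ux[OF w(2)] by (auto simp: complete_on_def)
      moreover have "degree {x, z, u, w} E y = 3" "card {x, z, u, w} = 4"
        using dist e sym uw Ux[OF uU] Ux[OF w(2)] by (auto simp: degree_insert degree_empty)
      ultimately show False using clique_False[of "{x, z, u, w}"] V' dist by auto
    qed
    have "B6_like E V"
    proof (cases "E x z")
      case True
      then have "\<not> E y z" using nand by blast
      then show ?thesis
        by (intro B6_likeI[OF dist V']) (use True sym xy zV u wv uw Ux[OF uU] Ux[OF w(2)] in auto)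
    next
      case False
      then have "E y z" using or by blast
      have "distinct [y, x, z, u, v, w]" "V = {y, x, z, u, v, w}" using dist V' by auto
      then show ?thesis
        by (rule B6_likeI) (use False \<open>E y z\<close> sym xy zV u wv uw Ux[OF uU] Ux[OF w(2)] in auto)
    qed
    then show ?thesis ..
  next
    case 3
    have "complete_on E (insert x U)"
      unfolding complete_on_def
    proof (intro ballI impI)
      fix s t assume st: "s \<in> insert x U" "t \<in> insert x U" "s \<noteq> t"
      show "E s t"
      proof (cases "s \<in> U")
        case True
        then show ?thesis using EU[of s t] st V ne notU by auto
      next
        case False
        then show ?thesis using st Ux by auto
      qed
    qed
    moreover have "degree (insert x U) E y = card U"
    proof -
      have "{s \<in> insert x U. E y s} = U" using Ux sym notU by auto
      then show ?thesis by (simp add: degree_def)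
    qed
    moreover have "3 \<le> card (insert x U)" using 3 finU notU by simp
    ultimately have False using clique_False[of "insert x U"] 3 V xy notU by auto
    then show ?thesis ..
  qed
qed

text \<open>The square starts with bound 2, so two uses of \<open>bonus\<close> give a
  contradiction. A single one already forces a set with six vertices to be all of \<open>V\<close>,
  by \<open>tight\<close>. The cases locate these two uses; one configuration escapes.\<close>

lemma min_degree_four:
  assumes IH: "\<And>W. W \<subset> V \<Longrightarrow> ore E W 2 \<Longrightarrow> complete_on E W"
    and deg4: "\<And>z. z \<in> V \<Longrightarrow> 4 \<le> degree V E z"
  shows "four_regular7 E V"
proof -
  obtain u v x y where sq: "square u v x y" by (rule square_exists)
  note sqD = sq[unfolded square_def]
  define C where "C = {u, v, x, y}"
  define W where "W = V - C"
  define i where "i w = degree C E w" for w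
  define P where "P = {w \<in> W. 3 \<le> i w}"
  have CV: "C \<subseteq> V" and cardC: "card C = 4" using sqD by (auto simp: C_def)
  have WV: "W \<subseteq> V" "C \<inter> W = {}" "C \<union> W = V" using CV by (auto simp: W_def)
  have finC: "finite C" and finW: "finite W" using CV WV fin by auto
  have PW: "P \<subseteq> W" by (auto simp: P_def)
  have finP: "finite P" using PW finW finite_subset by blast
  have cardV: "card V = 4 + card W"
    using card_Un_disjoint[OF finC finW WV(2)] WV(3) cardC by simp
  have degV: "degree V E z = i z + degree W E z" for z
    using degree_Un[OF finC finW WV(2), of E z] WV(3) by (simp add: i_def)
  have sumC: "(\<Sum>z\<in>C. f z) = f u + f v + f x + f y" for f :: "'a \<Rightarrow> nat"
    using sqD by (simp add: C_def add.assoc)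
  have comm: "\<not> E v u" "\<not> E y x" "E x u" "E x v" "E y u" "E y v"
    using sqD E_commute by metis+
  have iC: "i z = 2" if "z \<in> C" for z
    using that sqD comm E_irrefl unfolding i_def C_def
    by (auto simp: degree_insert degree_empty)
  have i4: "i w \<le> 4" for w
    using degree_le_card[OF finC, of E w] cardC by (simp add: i_def)
  have i2: "i w \<le> 2" if "w \<in> W" "w \<notin> P" for w using that by (auto simp: P_def)
  have degC: "(\<Sum>z\<in>C. degree V E z) = 8 + (\<Sum>w\<in>W. i w)"
  proof -
    have "(\<Sum>z\<in>C. degree W E z) = (\<Sum>w\<in>W. i w)"
      unfolding i_def by (rule sum_degree_swap[OF finC finW E_sym])
    moreover have "(\<Sum>z\<in>C. i z) = 8" using iC cardC by simp
    ultimately show ?thesis by (simp add: degV sum.distrib)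
  qed
  have degC16: "16 \<le> (\<Sum>z\<in>C. degree V E z)"
    using deg4[of u] deg4[of v] deg4[of x] deg4[of y] sqD by (simp add: sumC)
  \<comment> \<open>The degree conditions of the two diagonals add up to 2 (n + 1) with n = 4 + |W|;
    the square itself accounts for 8.\<close>
  have weight: "2 * card W + 2 \<le> (\<Sum>w\<in>W. i w)"
  proof -
    have "card V + 1 \<le> degree V E u + degree V E v" "card V + 1 \<le> degree V E x + degree V E y"
      using ore_degree sqD by auto
    then show ?thesis using degC by (simp add: sumC cardV)
  qed
  have D_C: "D C 2" using square_D[OF sq] by (simp add: C_def)
  have zero: False if "D Y 0" "C \<subseteq> Y" "Y \<subseteq> V" for Y
    using D_nonneg[OF sq _ that(3,1)] that(2) by (simp add: C_def)
  have tight: "Y = V" if "D Y 1" "C \<subseteq> Y" "Y \<subseteq> V" "6 \<le> card Y" for Y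
    using tight_extension[OF IH deg4 sq _ _ that(4,1)] that(2,3) by (auto simp: C_def)
  have bonus: "D (insert w Y) (k - 1)"
    if "D Y k" "C \<subseteq> Y" "Y \<subseteq> V" "w \<in> P" "w \<notin> Y" "4 \<le> degree Y E w" for w Y k
  proof -
    have "3 \<le> degree {u, v, x, y} E w" using that(4) by (simp add: P_def i_def C_def)
    then obtain a b where "a \<in> C" "b \<in> C" "E w a" "E w b" "a \<noteq> b" "\<not> E a b"
      using square_neighbours[OF sq] unfolding C_def by metis
    then show ?thesis
      using that PW WV(1) by (intro D_degree4[OF that(1,3) _ that(5,6), of a b]) auto
  qed
  have deg_ge: "i w \<le> degree Y E w" if "C \<subseteq> Y" "Y \<subseteq> V" for w Y
    unfolding i_def by (rule degree_mono[OF fin[OF that(2)] that(1)])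
  have deg_ge2: "i w + 1 \<le> degree (insert a Y) E w"
    if "C \<subseteq> Y" "Y \<subseteq> V" "a \<in> W" "E w a" for w a Y
  proof -
    have "a \<notin> C" using that(3) WV(2) by blast
    then have "i w + 1 = degree (insert a C) E w"
      using finC that(4) by (simp add: degree_insert i_def)
    also have "\<dots> \<le> degree (insert a Y) E w"
      using that WV(1) fin[OF that(2)] by (intro degree_mono) auto
    finally show ?thesis .
  qed
  have addP: "D (insert w Y) k" if "D Y k" "C \<subseteq> Y" "Y \<subseteq> V" "w \<in> P" for w Y k
  proof (cases "w \<in> Y")
    case False
    have "3 \<le> i w" using that(4) by (simp add: P_def)
    then have "3 \<le> degree Y E w" using deg_ge[OF that(2,3), of w] by linarith
    then show ?thesis using D_degree3[OF that(1,3) _ False] that(4) PW WV(1) by blast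
  qed (use that in \<open>simp add: insert_absorb\<close>)
  have addPs: "D (Y \<union> P) k" if "D Y k" "C \<subseteq> Y" "Y \<subseteq> V" for Y k
  proof (rule D_Un[OF that(1,3)])
    show "3 \<le> degree Y E w" if "w \<in> P" for w
      using deg_ge[OF \<open>C \<subseteq> Y\<close> \<open>Y \<subseteq> V\<close>, of w] that by (simp add: P_def)
  qed (use PW WV(1) in auto)
  have deg_sub: "degree A E w \<le> card A - card {a \<in> A. \<not> E w a}" if "finite A" for A w
  proof -
    have "{a \<in> A. E w a} = A - {a \<in> A. \<not> E w a}" by auto
    then have "degree A E w = card (A - {a \<in> A. \<not> E w a})" by (simp add: degree_def)
    then show ?thesis using that by (simp add: card_Diff_subset)
  qed
  \<comment> \<open>If \<open>w\<close> has only three neighbours on the square, minimum degree four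
    yields a neighbour \<open>a\<close> in \<open>W\<close>, which \<open>W = P\<close> allows to be
    added first at no cost.\<close>
  have second_bonus: False
    if "D Y 1" "C \<subseteq> Y" "Y \<subseteq> V" "W = P" "w \<in> P" "w \<notin> Y" for Y w
  proof -
    have wV: "w \<in> V" using that(5) PW WV(1) by blast
    have "4 \<le> i w + degree W E w" using deg4[OF wV] degV by simp
    then consider "4 \<le> i w" | "1 \<le> degree W E w" using i4[of w] by linarith
    then show False
    proof cases
      case 1
      then have "4 \<le> degree Y E w" using deg_ge[OF that(2,3), of w] by linarith
      then have "D (insert w Y) (1 - 1)" by (rule bonus[OF that(1,2,3,5,6)])
      then show False using zero[of "insert w Y"] that(2,3) wV by auto
    next
      case 2
      then obtain a where a: "a \<in> W" "E w a" using degree_posD by metis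
      have "a \<noteq> w" using a(2) E_irrefl by metis
      have aV: "a \<in> V" using a(1) WV(1) by blast
      have D: "D (insert a Y) 1" using addP[OF that(1,2,3)] a(1) that(4) by simp
      have "3 \<le> i w" using that(5) by (simp add: P_def)
      then have "4 \<le> degree (insert a Y) E w" using deg_ge2[OF that(2,3) a] by linarith
      then have "D (insert w (insert a Y)) (1 - 1)"
        using D that \<open>a \<noteq> w\<close> aV by (intro bonus) auto
      then show False using zero[of "insert w (insert a Y)"] that(2,3) wV aV by auto
    qed
  qed
  have WP: "W = P" if "D (C \<union> P) 1" "2 \<le> card P"
  proof -
    have "card (C \<union> P) = 4 + card P"
      using card_Un_disjoint[OF finC finP] PW WV(2) cardC by auto
    then have "C \<union> P = V" using tight[OF that(1)] CV PW WV(1) that(2) by auto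
    then show ?thesis using PW WV by blast
  qed
  have "P \<noteq> {}"
  proof
    assume "P = {}"
    then have "(\<Sum>w\<in>W. i w) \<le> (\<Sum>w\<in>W. 2)" using i2 by (intro sum_mono) auto
    then show False using weight by simp
  qed
  then have "1 \<le> card P" using finP by (simp add: Suc_le_eq card_gt_0_iff)
  then consider "card P = 1" | "2 \<le> card P" by linarith
  then show ?thesis
  proof cases
    case 1
    then obtain z where Pz: "P = {z}" by (metis card_1_singletonE)
    then have z: "z \<in> W" "z \<notin> C" "z \<in> V" "z \<in> P" using PW WV by auto
    have W1: "1 \<le> card W" "card (W - {z}) = card W - 1"
      using z(1) finW by (auto simp: Suc_le_eq card_gt_0_iff)
    have split: "(\<Sum>w\<in>W. i w) = i z + (\<Sum>w\<in>W - {z}. i w)"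
      using sum.remove[OF finW z(1)] by simp
    have rest: "(\<Sum>w\<in>W - {z}. i w) \<le> (\<Sum>w\<in>W - {z}. 2)"
      using i2 Pz by (intro sum_mono) auto
    \<comment> \<open>\<open>weight\<close> leaves no slack: 4 from \<open>z\<close> and 2 from each
      other vertex is the most possible, so both are attained.\<close>
    then have iz: "i z = 4" using weight split i4[of z] W1 by simp
    have eq2: "i w = 2" if "w \<in> W - {z}" for w
    proof (rule ccontr)
      assume "i w \<noteq> 2"
      then have "(\<Sum>w\<in>W - {z}. i w) < (\<Sum>w\<in>W - {z}. 2)"
        using i2 Pz that finW by (intro sum_strict_mono_ex1) (auto intro!: bexI[of _ w] simp: order.strict_iff_order)
      then show False using weight split iz W1 by simp
    qed
    have "4 \<le> degree C E z" using iz by (simp add: i_def)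
    then have "D (insert z C) (2 - 1)" using bonus[OF D_C _ CV z(4,2)] by simp
    then have Dz: "D (insert z C) 1" by simp
    have noadj: "\<not> E w z" if w: "w \<in> W - {z}" for w
    proof
      assume wz: "E w z"
      have w': "w \<in> V" "w \<notin> insert z C" using w WV by auto
      have d: "degree (insert z C) E w = 3"
        using wz z(2) finC eq2[OF w] by (simp add: degree_insert i_def)
      then have "D (insert w (insert z C)) 1"
        using D_degree3[OF Dz _ w'] z(3) CV by simp
      moreover have "card (insert w (insert z C)) = 6" using w' z(2) finC cardC by simp
      ultimately have "insert w (insert z C) = V" using w' z(3) CV by (intro tight) auto
      moreover have "degree (insert w (insert z C)) E w = 3"
        using d degree_insert[of "insert z C" w E w] finC w' E_irrefl by simp
      ultimately show False using deg4[OF w'(1)] by simp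
    qed
    show ?thesis
    proof (cases "W = {z}")
      case True
      have "degree V E u \<le> 3" using degV[of u] iC[of u] degree_le_card[OF finW, of E u] True by (simp add: C_def)
      then show ?thesis using deg4[of u] sqD by simp
    next
      case False
      then obtain w where w: "w \<in> W - {z}" using z(1) by blast
      have wV: "w \<in> V" using w WV(1) by blast
      have nwz: "\<not> E z w" "\<not> E w z" using noadj[OF w] E_commute[of z w] by simp_all
      have "\<not> E z a" if "a \<in> W" for a
        using noadj[of a] that E_irrefl[of z] E_commute[of z a] by (cases "a = z") simp_all
      then have "{a \<in> W. E z a} = {}" by blast
      then have "degree W E z = 0" unfolding degree_def by (simp only: card.empty)
      then have "degree V E z = 4" using degV iz by simp
      \<comment> \<open>\<open>w\<close> misses itself and \<open>z\<close>. Its degree is then at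
        most |W| and that of \<open>z\<close> is 4, one short of n + 1 = |W| + 5.\<close>
      moreover have "degree W E w \<le> card W - 2"
      proof -
        have "{w, z} \<subseteq> {a \<in> W. \<not> E w a}" using w z(1) nwz E_irrefl by auto
        then have "card {w, z} \<le> card {a \<in> W. \<not> E w a}" using finW by (intro card_mono) auto
        then show ?thesis using deg_sub[OF finW, of w] w by auto
      qed
      moreover have "card V + 1 \<le> degree V E z + degree V E w"
        using ore_degree[OF z(3) wV] nwz w by blast
      moreover have "2 \<le> card W" using card_mono[OF finW, of "{w, z}"] w z(1) by auto
      ultimately show ?thesis using degV[of w] eq2[OF w] cardV by simp
    qed
  next
    case 2
    have ge3: "3 \<le> i w" if "w \<in> P" for w using that by (simp add: P_def)
    have PV: "P \<subseteq> V" "P \<inter> C = {}" using PW WV by auto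
    show ?thesis
    proof (cases "\<exists>z\<in>P. 4 \<le> i z")
      case True
      then obtain z where z: "z \<in> P" "4 \<le> i z" by blast
      have "4 \<le> degree C E z" using z(2) by (simp add: i_def)
      then have "D (insert z C) (2 - 1)"
        using bonus[OF D_C _ CV z(1)] z(1) PV(2) by auto
      then have Dz: "D (insert z C) 1" by simp
      have zC: "insert z C \<subseteq> V" using z(1) PV(1) CV by auto
      have "insert z C \<union> P = C \<union> P" using z(1) by auto
      then have "D (C \<union> P) 1" using addPs[OF Dz _ zC] by auto
      then have "W = P" using WP 2 by blast
      moreover have "1 \<le> card (P - {z})" using z(1) 2 finP by simp
      then obtain w where "w \<in> P - {z}" by (metis card.empty ex_in_conv not_one_le_zero)
      ultimately have False
        using second_bonus[OF Dz _ zC, of w] PV(2) by auto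
      then show ?thesis ..
    next
      case False
      then have i3: "i w = 3" if "w \<in> P" for w using that ge3[OF that] by force
      show ?thesis
      proof (cases "\<exists>w\<in>P. \<exists>w'\<in>P. E w w'")
        case True
        then obtain w w' where w: "w \<in> P" "w' \<in> P" "E w' w" using E_commute by blast
        have ww: "w' \<noteq> w" using w(3) E_irrefl by metis
        have sub: "insert w C \<subseteq> V" "insert w' (insert w C) \<subseteq> V" using w PV CV by auto
        have D1: "D (insert w C) 2" using addP[OF D_C _ CV w(1)] by simp
        have "4 \<le> degree (insert w C) E w'"
          using deg_ge2[OF _ CV _ w(3)] w PW ge3[OF w(2)] by force
        then have "D (insert w' (insert w C)) (2 - 1)"
          using D1 w ww PV(2) sub by (intro bonus) auto
        then have D2: "D (insert w' (insert w C)) 1" by simp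
        have "insert w' (insert w C) \<union> P = C \<union> P" using w by auto
        then have "D (C \<union> P) 1" using addPs[OF D2 _ sub(2)] by auto
        then have W: "W = P" using WP 2 by blast
        have "P \<subseteq> {w, w'}"
        proof
          fix a assume "a \<in> P"
          then show "a \<in> {w, w'}" using second_bonus[OF D2 _ sub(2) W, of a] PV(2) by auto
        qed
        then have "W = {w, w'}" using W w by auto
        \<comment> \<open>The corners would have degree sum 8 + 6 = 14, below 16.\<close>
        then have "(\<Sum>w\<in>W. i w) = 6" using i3 w ww by simp
        then show ?thesis using degC degC16 by simp
      next
        case False
        define Y where "Y = W - P"
        have finY: "finite Y" using finW by (simp add: Y_def)
        have YP: "P \<inter> Y = {}" "P \<union> Y = W" using PW by (auto simp: Y_def)
        have cardW: "card W = card P + card Y" using card_Un_disjoint[OF finP finY YP(1)] YP(2) by simp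
        have degP: "degree V E w = 3 + degree Y E w" if "w \<in> P" for w
        proof -
          have "{a \<in> P. E w a} = {}" using False that by blast
          then have "degree P E w = 0" unfolding degree_def by (simp only: card.empty)
          then show ?thesis
            using degV[of w] i3[OF that] degree_Un[OF finP finY YP(1), of E w] YP(2) by simp
        qed
        obtain S where "S \<subseteq> P" "card S = 2" using 2 by (metis obtain_subset_with_card_n)
        then obtain w w' where w: "w \<in> P" "w' \<in> P" "w \<noteq> w'" by (metis card_2_iff insert_subset)
        have nww: "\<not> E w w'" using False w by blast
        have wV: "w \<in> V" "w' \<in> V" using w PV by auto
        have ore_w: "card P + card Y \<le> degree Y E w + degree Y E w' + 1"
          using ore_degree[OF wV w(3) nww] degP w cardV cardW by simp
        \<comment> \<open>\<open>w\<close> and \<open>w'\<close> have at least |P| - 1 common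
          neighbours in \<open>Y\<close>, while \<open>weight\<close> allows at most |P| - 2
          vertices in \<open>?R\<close>. Hence some common neighbour \<open>q\<close> has two
          neighbours on the square and four in \<open>C \<union> P\<close>.\<close>
        let ?A = "{q \<in> Y. E w q}" and ?B = "{q \<in> Y. E w' q}" and ?R = "{q \<in> Y. i q \<le> 1}"
        have "card ?A + card ?B = card (?A \<union> ?B) + card (?A \<inter> ?B)"
          using finY by (intro card_Un_Int) auto
        moreover have "card (?A \<union> ?B) \<le> card Y" using finY by (intro card_mono) auto
        ultimately have common: "card P \<le> card (?A \<inter> ?B) + 1"
          using ore_w by (simp add: degree_def)
        have "(\<Sum>w\<in>W. i w) = (\<Sum>w\<in>P. i w) + (\<Sum>q\<in>Y. i q)"
          using sum.union_disjoint[OF finP finY YP(1), of i] YP(2) by simp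
        moreover have "(\<Sum>w\<in>P. i w) = 3 * card P" using i3 by simp
        moreover have "(\<Sum>q\<in>Y. i q) + card ?R \<le> 2 * card Y"
        proof -
          have "(\<Sum>q\<in>Y. i q + (if i q \<le> 1 then 1 else 0)) \<le> (\<Sum>q\<in>Y. 2)"
            using i2 by (intro sum_mono) (auto simp: Y_def)
          moreover have "card ?R = (\<Sum>q\<in>Y. if i q \<le> 1 then 1 else 0)"
            using finY by (simp flip: sum.inter_filter)
          ultimately show ?thesis by (simp add: sum.distrib)
        qed
        ultimately have "card ?R + 2 \<le> card P" using weight cardW by simp
        then have "card ?R < card (?A \<inter> ?B)" using common by simp
        moreover have "finite ?R" using finY by simp
        ultimately have "\<not> ?A \<inter> ?B \<subseteq> ?R" using card_mono[of ?R "?A \<inter> ?B"] by linarith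
        then obtain q where q: "q \<in> Y" "E w q" "E w' q" "\<not> i q \<le> 1" by blast
        have qW: "q \<in> W" "q \<notin> P" "q \<in> V" "q \<notin> C" using q(1) WV by (auto simp: Y_def)
        have iq: "i q = 2" using i2[OF qW(1,2)] q(4) by simp
        have qE: "E q w" "E q w'" using q(2,3) E_commute by blast+
        have CP: "C \<union> P \<subseteq> V" using CV PV by auto
        have "D (C \<union> P) 2" using addPs[OF D_C _ CV] by simp
        moreover have "4 \<le> degree (C \<union> P) E q"
        proof -
          have "degree {w, w'} E q = 2" using qE w(3) by (simp add: degree_insert degree_empty)
          moreover have "degree {w, w'} E q \<le> degree P E q" using w finP by (intro degree_mono) auto
          moreover have "degree (C \<union> P) E q = degree C E q + degree P E q"
            using degree_Un[OF finC finP, of E q] PV(2) by auto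
          ultimately show ?thesis using iq by (simp add: i_def)
        qed
        ultimately have "D (insert q (C \<union> P)) (2 - 1)"
          using qW w qE nww by (intro D_degree4[OF _ CP, of 2 q w w']) auto
        then have "D (insert q (C \<union> P)) 1" by simp
        moreover have "6 \<le> card (insert q (C \<union> P))"
        proof -
          have "card (C \<union> P) = 4 + card P"
            using card_Un_disjoint[OF finC finP] PV(2) cardC by auto
          moreover have "card (C \<union> P) \<le> card (insert q (C \<union> P))"
            using finC finP by (intro card_mono) auto
          ultimately show ?thesis using 2 by simp
        qed
        ultimately have "insert q (C \<union> P) = V" using CP qW(3) by (intro tight) auto
        then have "Y = {q}" using q(1) WV(2) by (auto simp: Y_def W_def)
        then have Y1: "card Y = 1" by simp
        have P4: "degree V E a = 4" if "a \<in> P" for a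
        proof -
          have "a \<in> V" using that PV by blast
          then show ?thesis
            using deg4[of a] degP[OF that] degree_le_card[OF finY, of E a] Y1 by simp
        qed
        \<comment> \<open>The degree sum 8 of \<open>w\<close> and \<open>w'\<close> must reach n +
          1 = |P| + 6.\<close>
        have P2: "card P = 2"
          using ore_degree[OF wV w(3) nww] P4 w cardV cardW Y1 2 by simp
        have V7: "card V = 7" using cardV cardW P2 Y1 by simp
        have "(\<Sum>w\<in>W. i w) = (\<Sum>w\<in>P. i w) + (\<Sum>q\<in>Y. i q)"
          using sum.union_disjoint[OF finP finY YP(1), of i] YP(2) by simp
        then have "(\<Sum>w\<in>W. i w) = 8" using i3 P2 \<open>Y = {q}\<close> iq by simp
        then have "degree V E u + degree V E v + degree V E x + degree V E y = 16"
          using degC by (simp add: sumC)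
        then have C4: "degree V E a = 4" if "a \<in> C" for a
          using deg4[of u] deg4[of v] deg4[of x] deg4[of y] sqD that by (auto simp: C_def)
        have "degree W E q \<le> 2"
        proof -
          have "degree W E q = degree P E q + degree Y E q"
            using degree_Un[OF finP finY YP(1), of E q] YP(2) by simp
          moreover have "degree Y E q = 0" using \<open>Y = {q}\<close> E_irrefl by (simp add: degree_def)
          ultimately show ?thesis using degree_le_card[OF finP, of E q] P2 by simp
        qed
        then have "degree V E q = 4" using deg4[OF qW(3)] degV iq by simp
        then have "\<forall>z\<in>V. degree V E z = 4"
          using P4 C4 WV(3) YP(2) \<open>Y = {q}\<close> by auto
        then show ?thesis using V7 by (simp add: four_regular7_def)
      qed
    qed
  qed
qed

lemma ore_cases:
  assumes "\<And>W. W \<subset> V \<Longrightarrow> ore E W 2 \<Longrightarrow> complete_on E W"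
  shows "wheel_like E V \<or> B6_like E V \<or> four_regular7 E V"
proof (cases "\<forall>z\<in>V. 4 \<le> degree V E z")
  case True
  then show ?thesis using min_degree_four[OF assms] by blast
next
  case False
  then obtain v where "v \<in> V" "degree V E v \<le> 3" by force
  then show ?thesis using low_degree by blast
qed

end

section \<open>Induction for the strict degree condition\<close>

context dof_graph
begin

text \<open>The degrees of a nonadjacent pair are 3 + 3 in the wheel, 3 + 4 in the graph on six
  vertices and 4 + 4 in the four-regular case.\<close>

lemma exceptional_tight:
  assumes "wheel_like E V \<or> B6_like E V \<or> four_regular7 E V" "s \<in> V" "t \<in> V" "s \<noteq> t" "\<not> E s t"
  shows "degree V E s + degree V E t = card V + 1"
  using assms(1)
proof (elim disjE)
  assume "wheel_like E V"
  then obtain a b c d e where dist: "distinct [a, b, c, d, e]" and V: "V = {a, b, c, d, e}"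
    and L: "complement_is E V {{a, b}, {c, d}}"
    unfolding wheel_like_def by blast
  have E: "E s t \<longleftrightarrow> s \<noteq> t \<and> {s, t} \<notin> {{a, b}, {c, d}}" if "s \<in> V" "t \<in> V" for s t
    by (rule L[unfolded complement_is_def, THEN bspec, THEN bspec, OF that])
  have dist': "distinct [e, d, c, b, a]" using dist by auto
  have deg: "degree V E a = 3" "degree V E b = 3" "degree V E c = 3" "degree V E d = 3"
    using dist dist' E unfolding V by (simp_all add: degree_insert degree_empty doubleton_eq_iff)
  have "{s, t} = {a, b} \<or> {s, t} = {c, d}" using E[OF assms(2,3)] assms(4,5) by simp
  then show ?thesis using deg dist V by (auto simp: doubleton_eq_iff)
next
  assume "B6_like E V"
  then obtain a b c d e f where dist: "distinct [a, b, c, d, e, f]" and V: "V = {a, b, c, d, e, f}"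
    and L: "complement_is E V {{a, b}, {b, c}, {d, e}, {e, f}}"
    unfolding B6_like_def by blast
  have E: "E s t \<longleftrightarrow> s \<noteq> t \<and> {s, t} \<notin> {{a, b}, {b, c}, {d, e}, {e, f}}" if "s \<in> V" "t \<in> V" for s t
    by (rule L[unfolded complement_is_def, THEN bspec, THEN bspec, OF that])
  have dist': "distinct [f, e, d, c, b, a]" using dist by auto
  have deg: "degree V E a = 4" "degree V E b = 3" "degree V E c = 4" "degree V E d = 4"
      "degree V E e = 3" "degree V E f = 4"
    using dist dist' E unfolding V by (simp_all add: degree_insert degree_empty doubleton_eq_iff)
  have "{s, t} = {a, b} \<or> {s, t} = {b, c} \<or> {s, t} = {d, e} \<or> {s, t} = {e, f}"
    using E[OF assms(2,3)] assms(4,5) by simp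
  then show ?thesis using deg dist V by (auto simp: doubleton_eq_iff)
next
  assume "four_regular7 E V"
  then show ?thesis using assms(2,3) by (simp add: four_regular7_def)
qed

text \<open>The induction hypothesis is just what \<open>ore_cases\<close> asks of proper subsets,
  and its three outcomes have surplus exactly 1.\<close>

lemma strict_ore_complete:
  "W \<subseteq> V \<Longrightarrow> ore E W 2 \<Longrightarrow> complete_on E W"
proof (induction "card W" arbitrary: W rule: less_induct)
  case less
  interpret G: dof_graph W E D by (rule dof_graph_subset[OF less.prems(1)])
  show ?case
  proof (rule ccontr)
    assume n: "\<not> complete_on E W"
    have "ore E W 1" using less.prems(2) unfolding ore_def by fastforce
    then interpret O: ore_graph W E D using n by unfold_locales
    have "complete_on E U" if "U \<subset> W" "ore E U 2" for U
      using less.hyps[of U] that less.prems(1) psubset_card_mono[OF G.finV that(1)] by auto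
    then have "wheel_like E W \<or> B6_like E W \<or> four_regular7 E W" by (rule O.ore_cases)
    moreover obtain s t where st: "s \<in> W" "t \<in> W" "s \<noteq> t" "\<not> E s t"
      using n unfolding complete_on_def by blast
    ultimately have "degree W E s + degree W E t = card W + 1"
      using G.exceptional_tight by blast
    moreover have "card W + 2 \<le> degree W E s + degree W E t"
      using less.prems(2) st unfolding ore_def by blast
    ultimately show False by simp
  qed
qed

theorem ore_exceptions:
  assumes "ore E V 1"
  shows "complete_on E V \<or> wheel_like E V \<or> B6_like E V \<or> four_regular7 E V"
proof (cases "complete_on E V")
  case False
  interpret O: ore_graph V E D using assms False by unfold_locales
  have "wheel_like E V \<or> B6_like E V \<or> four_regular7 E V"
    by (rule O.ore_cases) (use strict_ore_complete in auto)
  then show ?thesis by blast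
qed simp

end

section \<open>The exceptional graphs\<close>

text \<open>\<open>xs\<close> labels the vertices by positions, so the isomorphism from
  \<open>V\<close> is the inverse of indexing.\<close>

lemma graph_iso_complete_minus:
  assumes "distinct xs" "V = set xs"
    and "complement_is E V ((\<lambda>(i, j). {xs ! i, xs ! j}) ` set L)"
    and "\<forall>(i, j) \<in> set L. i < length xs \<and> j < length xs"
    and "W = {0..<length xs}" "\<And>i j. F i j \<longleftrightarrow> i \<in> W \<and> j \<in> W \<and> complete_minus L i j"
  shows "graph_iso V E W F"
proof -
  have bij: "bij_betw ((!) xs) W V"
    using bij_betw_nth[OF assms(1)] assms(2,5) by (simp add: lessThan_atLeast0)
  have EF: "E (xs ! i) (xs ! j) \<longleftrightarrow> F i j" if ij: "i \<in> W" "j \<in> W" for i j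
  proof -
    have len: "i < length xs" "j < length xs" using ij assms(5) by auto
    have "{xs ! i, xs ! j} \<in> (\<lambda>(i, j). {xs ! i, xs ! j}) ` set L \<longleftrightarrow> (i, j) \<in> set L \<or> (j, i) \<in> set L"
    proof
      assume "{xs ! i, xs ! j} \<in> (\<lambda>(i, j). {xs ! i, xs ! j}) ` set L"
      then obtain k l where kl: "(k, l) \<in> set L" "{xs ! i, xs ! j} = {xs ! k, xs ! l}" by auto
      then have "k < length xs" "l < length xs" using assms(4) by auto
      then have "i = k \<and> j = l \<or> i = l \<and> j = k"
        using kl(2) len assms(1) by (simp add: doubleton_eq_iff nth_eq_iff_index_eq)
      then show "(i, j) \<in> set L \<or> (j, i) \<in> set L" using kl(1) by auto
    next
      assume "(i, j) \<in> set L \<or> (j, i) \<in> set L"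
      then show "{xs ! i, xs ! j} \<in> (\<lambda>(i, j). {xs ! i, xs ! j}) ` set L"
        by (force simp: insert_commute)
    qed
    moreover have "xs ! i \<noteq> xs ! j \<longleftrightarrow> i \<noteq> j" using len assms(1) by (simp add: nth_eq_iff_index_eq)
    moreover have "xs ! i \<in> V" "xs ! j \<in> V" using len assms(2) by auto
    ultimately show ?thesis
      using assms(3) ij unfolding complement_is_def assms(6) complete_minus_def by simp
  qed
  let ?f = "inv_into W ((!) xs)"
  have "E u v \<longleftrightarrow> F (?f u) (?f v)" if "u \<in> V" "v \<in> V" for u v
    using EF[of "?f u" "?f v"] bij_betw_apply[OF bij_betw_inv_into[OF bij]]
      bij_betw_inv_into_right[OF bij] that by simp
  then show ?thesis
    unfolding graph_iso_def using bij_betw_inv_into[OF bij] by blast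
qed

lemma wheel_like_iso:
  assumes "wheel_like E V"
  shows "graph_iso V E W5_V W5_E"
proof -
  obtain a b c d e where dist: "distinct [a, b, c, d, e]" and V: "V = {a, b, c, d, e}"
    and L: "complement_is E V {{a, b}, {c, d}}"
    using assms unfolding wheel_like_def by blast
  \<comment> \<open>The apex \<open>e\<close> gets label 0, the missing pairs get labels 1, 3 and 2,
    4.\<close>
  show ?thesis
    by (rule graph_iso_complete_minus[where xs = "[e, a, c, b, d]" and L = "[(1,3),(2,4)]"])
      (use dist V L in \<open>auto simp: W5_V_def W5_E_def\<close>)
qed

lemma B6_like_iso:
  assumes "B6_like E V"
  shows "graph_iso V E B6_V B6_E"
proof -
  obtain a b c d e f where dist: "distinct [a, b, c, d, e, f]" and V: "V = {a, b, c, d, e, f}"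
    and L: "complement_is E V {{a, b}, {b, c}, {d, e}, {e, f}}"
    using assms unfolding B6_like_def by blast
  show ?thesis
    by (rule graph_iso_complete_minus[where xs = "[a, b, c, d, e, f]"
          and L = "[(0,1),(1,2),(3,4),(4,5)]"])
      (use dist V L in \<open>auto simp: B6_V_def B6_E_def numeral_eq_Suc\<close>)
qed

section \<open>Complements of 2-regular graphs on seven vertices\<close>

locale four_regular7_graph =
  fixes V :: "'a set" and E :: "'a \<Rightarrow> 'a \<Rightarrow> bool"
  assumes card7: "card V = 7" and regular: "z \<in> V \<Longrightarrow> degree V E z = 4"
    and sym: "E u v \<Longrightarrow> E v u" and irrefl: "\<not> E u u"
begin

text \<open>The complement is 2-regular, hence a disjoint union of cycles of length at least three;
  on seven vertices the lengths are 7 or 3 + 4.\<close>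

definition N :: "'a \<Rightarrow> 'a \<Rightarrow> bool" where
  "N x y \<longleftrightarrow> x \<in> V \<and> y \<in> V \<and> x \<noteq> y \<and> \<not> E x y"

lemma finV: "finite V"
  using card7 card.infinite by fastforce

lemma N_sym: "N x y \<Longrightarrow> N y x"
  unfolding N_def using sym by blast

lemma card_N: "x \<in> V \<Longrightarrow> card {y. N x y} = 2"
proof -
  assume x: "x \<in> V"
  have "{y. N x y} = V - insert x {y \<in> V. E x y}" using x by (auto simp: N_def)
  moreover have "card (insert x {y \<in> V. E x y}) = 5"
    using regular[OF x] irrefl finV by (simp add: degree_def)
  moreover have "insert x {y \<in> V. E x y} \<subseteq> V" using x by auto
  ultimately show ?thesis using finV card7 by (simp add: card_Diff_subset finite_subset)
qed

lemma N_other: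
  assumes "N x y"
  obtains z where "N x z" "z \<noteq> y"
proof -
  have "x \<in> V" using assms by (simp add: N_def)
  then obtain s t where st: "{y. N x y} = {s, t}" "s \<noteq> t"
    using card_N by (metis card_2_iff)
  then have "N x s" "N x t" by blast+
  then show thesis using that st(2) by metis
qed

lemma N_two:
  assumes "N x y" "N x z" "y \<noteq> z"
  shows "N x w \<longleftrightarrow> w = y \<or> w = z"
proof -
  have "x \<in> V" using assms by (simp add: N_def)
  have "finite {y. N x y}" by (rule finite_subset[OF _ finV]) (auto simp: N_def)
  moreover have "{y, z} \<subseteq> {y. N x y}" using assms by auto
  ultimately have "{y, z} = {y. N x y}"
    using card_N[OF \<open>x \<in> V\<close>] assms(3) by (intro card_subset_eq) auto
  then show ?thesis by blast
qed

lemma N_closed: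
  assumes "S \<subseteq> V" "\<forall>s\<in>S. \<forall>t. N s t \<longrightarrow> t \<in> S" "h \<in> V - S"
  obtains y z where "N h y" "N h z" "y \<noteq> z" "y \<in> V - S" "z \<in> V - S"
proof -
  obtain y z where yz: "{y. N h y} = {y, z}" "y \<noteq> z"
    using card_N[of h] assms(3) by (metis DiffD1 card_2_iff)
  then have N: "N h y" "N h z" by blast+
  have out: "w \<in> V - S" if "N h w" for w
    using assms(2) N_sym[OF that] assms(3) that unfolding N_def by blast
  have mem: "y \<in> V - S" "z \<in> V - S" using N out by blast+
  show thesis using that[OF N yz(2) mem] .
qed

text \<open>\<open>S\<close> is a union of cycles; any vertex left over comes with two neighbours
  that are left over too. This excludes cycles of length five and six.\<close>

lemma N_closed_card:
  assumes "S \<subseteq> V" "\<forall>s\<in>S. \<forall>t. N s t \<longrightarrow> t \<in> S" "h \<in> V - S"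
  shows "3 \<le> card (V - S)"
proof -
  obtain y z where yz: "N h y" "N h z" "y \<noteq> z" "y \<in> V - S" "z \<in> V - S"
    by (rule N_closed[OF assms])
  then have "card {h, y, z} = 3" by (auto simp: N_def)
  moreover have "{h, y, z} \<subseteq> V - S" using yz(4,5) assms(3) by blast
  ultimately show ?thesis using card_mono[of "V - S" "{h, y, z}"] finV by simp
qed

lemma complement_N:
  assumes "\<And>s t. s \<in> V \<Longrightarrow> N s t \<longleftrightarrow> {s, t} \<in> L"
  shows "complement_is E V L"
  unfolding complement_is_def
proof (intro ballI)
  fix s t assume "s \<in> V" "t \<in> V"
  then show "E s t \<longleftrightarrow> s \<noteq> t \<and> {s, t} \<notin> L"
    using assms[of s t] irrefl[of s] by (auto simp: N_def)
qed

lemma triangle_square_iso: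
  assumes "distinct [a, b, c, d, e, f, g]" "V = {a, b, c, d, e, f, g}"
    and "N a b" "N b c" "N a c" "N d e" "N e f" "N f g" "N d g"
  shows "graph_iso V E C71_V C71_E"
proof -
  have s: "N b a" "N c b" "N c a" "N e d" "N f e" "N g f" "N g d"
    using assms(3-) by (auto intro: N_sym)
  have ne: "distinct [g, f, e, d, c, b, a]" using assms(1) by auto
  have two: "N a w \<longleftrightarrow> w = b \<or> w = c" "N b w \<longleftrightarrow> w = a \<or> w = c" "N c w \<longleftrightarrow> w = a \<or> w = b"
    "N d w \<longleftrightarrow> w = e \<or> w = g" "N e w \<longleftrightarrow> w = d \<or> w = f" "N f w \<longleftrightarrow> w = e \<or> w = g"
    "N g w \<longleftrightarrow> w = d \<or> w = f" for w
    by (rule N_two; use assms s ne in simp)+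
  let ?L = "{{a, b}, {b, c}, {c, a}, {d, e}, {e, f}, {f, g}, {g, d}}"
  have "complement_is E V ?L"
  proof (rule complement_N)
    fix s t assume "s \<in> V"
    then consider "s = a" | "s = b" | "s = c" | "s = d" | "s = e" | "s = f" | "s = g"
      using assms(2) by auto
    then show "N s t \<longleftrightarrow> {s, t} \<in> ?L"
      using assms(1) ne by cases (simp_all add: two doubleton_eq_iff, auto)
  qed
  then show ?thesis
    by (intro graph_iso_complete_minus[where xs = "[a, b, c, d, e, f, g]"
          and L = "[(0,1),(1,2),(2,0),(3,4),(4,5),(5,6),(6,3)]"])
      (use assms in \<open>auto simp: C71_V_def C71_E_def numeral_eq_Suc\<close>)
qed

lemma heptagon_iso:
  assumes "distinct [a, b, c, d, e, f, g]" "V = {a, b, c, d, e, f, g}"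
    and "N a b" "N b c" "N c d" "N d e" "N e f" "N f g" "N g a"
  shows "graph_iso V E C72_V C72_E"
proof -
  have s: "N b a" "N c b" "N d c" "N e d" "N f e" "N g f" "N a g"
    using assms(3-) by (auto intro: N_sym)
  have ne: "distinct [g, f, e, d, c, b, a]" using assms(1) by auto
  have two: "N a w \<longleftrightarrow> w = b \<or> w = g" "N b w \<longleftrightarrow> w = a \<or> w = c" "N c w \<longleftrightarrow> w = b \<or> w = d"
    "N d w \<longleftrightarrow> w = c \<or> w = e" "N e w \<longleftrightarrow> w = d \<or> w = f" "N f w \<longleftrightarrow> w = e \<or> w = g"
    "N g w \<longleftrightarrow> w = a \<or> w = f" for w
    by (rule N_two; use assms s ne in simp)+
  let ?L = "{{a, b}, {b, c}, {c, d}, {d, e}, {e, f}, {f, g}, {g, a}}"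
  have "complement_is E V ?L"
  proof (rule complement_N)
    fix s t assume "s \<in> V"
    then consider "s = a" | "s = b" | "s = c" | "s = d" | "s = e" | "s = f" | "s = g"
      using assms(2) by auto
    then show "N s t \<longleftrightarrow> {s, t} \<in> ?L"
      using assms(1) ne by cases (simp_all add: two doubleton_eq_iff, auto)
  qed
  then show ?thesis
    by (intro graph_iso_complete_minus[where xs = "[a, b, c, d, e, f, g]"
          and L = "[(0,1),(1,2),(2,3),(3,4),(4,5),(5,6),(6,0)]"])
      (use assms in \<open>auto simp: C72_V_def C72_E_def numeral_eq_Suc\<close>)
qed

lemma V_eq:
  assumes "distinct xs" "length xs = 7" "set xs \<subseteq> V"
  shows "V = set xs"
  using card_subset_eq[OF finV assms(3)] assms(1,2) card7 by (simp add: distinct_card)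

lemma N_ne: "N x y \<Longrightarrow> x \<noteq> y" and N_mem: "N x y \<Longrightarrow> x \<in> V \<and> y \<in> V"
  by (simp_all add: N_def)

text \<open>The cycle through \<open>a\<close> is followed in both directions. If it closes after
  three vertices the other four form a 4-cycle, after four the other three form a triangle, and
  \<open>small\<close> rules out five and six.\<close>

lemma iso: "graph_iso V E C71_V C71_E \<or> graph_iso V E C72_V C72_E"
proof -
  obtain a where a: "a \<in> V" using card7 by (metis card.empty ex_in_conv zero_neq_numeral)
  obtain b c where bc: "N a b" "N a c" "b \<noteq> c"
    by (rule N_closed[of "{}" a]) (use a that in auto)
  note ba = N_sym[OF bc(1)] and ca = N_sym[OF bc(2)]
  have Na: "N a w \<longleftrightarrow> w = b \<or> w = c" for w by (rule N_two[OF bc])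
  have mem: "b \<in> V" "c \<in> V" "a \<noteq> b" "a \<noteq> c" using bc by (auto simp: N_def)
  have big: "\<exists>h. h \<in> V - S" if "finite S" "card S < 7" for S
  proof (rule ccontr)
    assume "\<not> ?thesis"
    then have "V \<subseteq> S" by blast
    then have "card V \<le> card S" by (rule card_mono[OF that(1)])
    then show False using that(2) card7 by simp
  qed
  have small: False
    if "S \<subseteq> V" "\<forall>s\<in>S. \<forall>t. N s t \<longrightarrow> t \<in> S" "5 \<le> card S" "card S < 7" for S
  proof -
    have fS: "finite S" using that(1) finV finite_subset by blast
    have "\<exists>h. h \<in> V - S" by (rule big[OF fS that(4)])
    then obtain h where "h \<in> V - S" by (elim exE)
    then have "3 \<le> card (V - S)" by (rule N_closed_card[OF that(1,2)])
    then show False using card_Diff_subset[OF fS that(1)] card7 that(3) by simp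
  qed
  show ?thesis
  proof (cases "N b c")
    case True
    note cb = N_sym[OF True]
    have Nb: "N b w \<longleftrightarrow> w = a \<or> w = c" for w by (rule N_two[OF ba True]) (use mem in auto)
    have Nc: "N c w \<longleftrightarrow> w = a \<or> w = b" for w by (rule N_two[OF ca cb]) (use mem in auto)
    have closed: "\<forall>s\<in>{a, b, c}. \<forall>t. N s t \<longrightarrow> t \<in> {a, b, c}" using Na Nb Nc by auto
    have S: "{a, b, c} \<subseteq> V" using a mem by auto
    obtain d where d: "d \<in> V - {a, b, c}" using big[of "{a, b, c}"] bc(3) mem by auto
    obtain e f where ef: "N d e" "N d f" "e \<noteq> f" "e \<in> V - {a, b, c}" "f \<in> V - {a, b, c}"
      by (rule N_closed[OF S closed d])
    note ed = N_sym[OF ef(1)] and fd = N_sym[OF ef(2)]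
    have Nd: "N d w \<longleftrightarrow> w = e \<or> w = f" for w by (rule N_two[OF ef(1-3)])
    have de: "d \<noteq> e" "d \<noteq> f" using ef by (auto simp: N_def)
    obtain g where g: "N e g" "g \<noteq> d" using N_other[OF ed] by blast
    note ge = N_sym[OF g(1)]
    have Ne: "N e w \<longleftrightarrow> w = d \<or> w = g" for w by (rule N_two[OF ed g(1)]) (use g in auto)
    have gabc: "g \<notin> {a, b, c}" using closed ge ef(4) by blast
    have eg: "e \<noteq> g" "g \<in> V" using g(1) by (auto simp: N_def)
    \<comment> \<open>\<open>g = f\<close> would close a second triangle and leave a single
      vertex.\<close>
    have gf: "g \<noteq> f"
    proof
      assume gf: "g = f"
      have Nf: "N f w \<longleftrightarrow> w = d \<or> w = e" for w
        by (rule N_two[OF fd]) (use ge gf de in auto)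
      show False
        by (rule small[of "{a, b, c, d, e, f}"])
          (use a mem d ef de bc(3) Na Nb Nc Nd Ne Nf gf in auto)
    qed
    obtain g' where g': "N f g'" "g' \<noteq> d" using N_other[OF fd] by blast
    have Nf: "N f w \<longleftrightarrow> w = d \<or> w = g'" for w by (rule N_two[OF fd g'(1)]) (use g' in auto)
    note gf' = N_sym[OF g'(1)]
    have g'abc: "g' \<notin> {a, b, c}" using closed gf' ef(5) by blast
    have "g' \<noteq> e" using gf' Ne de gf ef(3) g by auto
    have fg: "f \<noteq> g'" "g' \<in> V" using g'(1) by (auto simp: N_def)
    have dist: "distinct [a, b, c, d, e, g, f]"
      using a mem d ef de bc(3) gabc eg gf g by auto
    have "set [a, b, c, d, e, g, f] \<subseteq> V" using a mem d ef eg by auto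
    then have V: "V = {a, b, c, d, e, g, f}" using V_eq[OF dist] by simp
    have "g' = g" using fg g'abc g'(2) \<open>g' \<noteq> e\<close> unfolding V by auto
    then have "graph_iso V E C71_V C71_E"
      using triangle_square_iso[OF dist V bc(1) True bc(2) ef(1) g(1) _ ef(2)] gf' by simp
    then show ?thesis ..
  next
    case False
    obtain d where d: "N b d" "d \<noteq> a" using N_other[OF ba] by blast
    obtain e where e: "N c e" "e \<noteq> a" using N_other[OF ca] by blast
    note db = N_sym[OF d(1)] and ec = N_sym[OF e(1)]
    have Nb: "N b w \<longleftrightarrow> w = a \<or> w = d" for w by (rule N_two[OF ba d(1)]) (use d in auto)
    have Nc: "N c w \<longleftrightarrow> w = a \<or> w = e" for w by (rule N_two[OF ca e(1)]) (use e in auto)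
    have ne: "d \<noteq> b" "d \<noteq> c" "e \<noteq> c" "e \<noteq> b" "d \<in> V" "e \<in> V"
      using d e False N_sym[of c b] by (auto simp: N_def)
    show ?thesis
    proof (cases "d = e")
      case True
      have Nd: "N d w \<longleftrightarrow> w = b \<or> w = c" for w by (rule N_two[OF db]) (use ec True bc in auto)
      let ?S = "{a, b, d, c}"
      have closed: "\<forall>s\<in>?S. \<forall>t. N s t \<longrightarrow> t \<in> ?S" using Na Nb Nc Nd True by auto
      have S: "?S \<subseteq> V" using a mem ne by auto
      have c4: "card ?S = 4" using mem bc(3) ne d(2) by auto
      obtain x where x: "x \<in> V - ?S" using big[of ?S] c4 by auto
      obtain y z where yz: "N x y" "N x z" "y \<noteq> z" "y \<in> V - ?S" "z \<in> V - ?S"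
        by (rule N_closed[OF S closed x])
      have xyz: "x \<noteq> y" "x \<noteq> z" using yz by (auto simp: N_def)
      have dist: "distinct [x, y, z, a, b, d, c]" using x yz xyz mem bc(3) ne d(2) by auto
      have "set [x, y, z, a, b, d, c] \<subseteq> V" using x yz S by auto
      then have V: "V = {x, y, z, a, b, d, c}" using V_eq[OF dist] by simp
      obtain w where w: "N y w" "w \<noteq> x" using N_other[OF N_sym[OF yz(1)]] by blast
      have "w \<notin> ?S" using closed N_sym[OF w(1)] yz(4) by blast
      then have "w = z" using w(2) N_ne[OF w(1)] N_mem[OF w(1)] unfolding V by auto
      then have "graph_iso V E C71_V C71_E"
        using triangle_square_iso[OF dist V yz(1) _ yz(2) bc(1) d(1) _ bc(2)] w(1) ec True N_sym by auto
      then show ?thesis ..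
    next
      case False
      obtain f where f: "N d f" "f \<noteq> b" using N_other[OF db] by blast
      note fd = N_sym[OF f(1)]
      have Nd: "N d w \<longleftrightarrow> w = b \<or> w = f" for w by (rule N_two[OF db f(1)]) (use f in auto)
      have fS: "f \<noteq> a" "f \<noteq> b" "f \<noteq> c" "f \<noteq> d" "f \<in> V"
        using f fd Na Nc ne d False N_ne[OF f(1)] N_mem[OF f(1)] by auto
      have "f \<noteq> e"
      proof
        assume fe: "f = e"
        have Ne: "N e w \<longleftrightarrow> w = c \<or> w = d" for w by (rule N_two[OF ec]) (use fd fe ne in auto)
        show False
          by (rule small[of "{a, b, c, d, e}"])
            (use a mem ne d e bc(3) False Na Nb Nc Nd Ne fe in auto)
      qed
      obtain g where g: "N f g" "g \<noteq> d" using N_other[OF fd] by blast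
      note gf = N_sym[OF g(1)]
      have Nf: "N f w \<longleftrightarrow> w = d \<or> w = g" for w by (rule N_two[OF fd g(1)]) (use g in auto)
      have gS: "g \<noteq> a" "g \<noteq> b" "g \<noteq> c" "g \<noteq> f" "g \<in> V"
        using g gf Na Nb Nc fS \<open>f \<noteq> e\<close> N_ne[OF g(1)] N_mem[OF g(1)] by auto
      have "g \<noteq> e"
      proof
        assume ge: "g = e"
        have Ne: "N e w \<longleftrightarrow> w = c \<or> w = f" for w by (rule N_two[OF ec]) (use gf ge fS in auto)
        show False
          by (rule small[of "{a, b, c, d, e, f}"])
            (use a mem ne d e bc(3) False fS \<open>f \<noteq> e\<close> Na Nb Nc Nd Ne Nf ge in auto)
      qed
      have dist: "distinct [a, b, d, f, g, e, c]"
        using mem bc(3) ne d(2) e(2) False fS gS g(2) \<open>f \<noteq> e\<close> \<open>g \<noteq> e\<close> by auto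
      have "set [a, b, d, f, g, e, c] \<subseteq> V" using a mem ne fS gS by auto
      then have V: "V = {a, b, d, f, g, e, c}" using V_eq[OF dist] by simp
      obtain h where h: "N g h" "h \<noteq> f" using N_other[OF gf] by blast
      have "h \<notin> {a, b, c, d}"
        using N_sym[OF h(1)] Na Nb Nc Nd gS fS g(2) \<open>g \<noteq> e\<close> by auto
      then have "h = e" using h(2) N_ne[OF h(1)] N_mem[OF h(1)] unfolding V by auto
      then have "graph_iso V E C72_V C72_E"
        using heptagon_iso[OF dist V bc(1) d(1) f(1) g(1) _ ec ca] h(1) by simp
      then show ?thesis ..
    qed
  qed
qed

end

text \<open>Together with \<open>exceptional_tight\<close>, this forces a graph to contain every edge that is linked in it
  as soon as the linked pairs form an exceptional graph.\<close>

lemma exceptional_cover: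
  assumes "wheel_like E V \<or> B6_like E V \<or> four_regular7 E V" "s \<in> V" "t \<in> V" "s \<noteq> t"
  shows "\<exists>z\<in>V. z \<noteq> s \<and> \<not> E s z \<or> z \<noteq> t \<and> \<not> E t z"
  using assms(1)
proof (elim disjE)
  assume "wheel_like E V"
  then obtain a b c d e where dist: "distinct [a, b, c, d, e]" and V: "V = {a, b, c, d, e}"
    and L: "complement_is E V {{a, b}, {c, d}}"
    unfolding wheel_like_def by blast
  have "\<not> E a b" "\<not> E b a" "\<not> E c d" "\<not> E d c"
    using L V unfolding complement_is_def by (auto simp: insert_commute)
  then show ?thesis using assms(2-4) dist V by auto
next
  assume "B6_like E V"
  then obtain a b c d e f where dist: "distinct [a, b, c, d, e, f]" and V: "V = {a, b, c, d, e, f}"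
    and L: "complement_is E V {{a, b}, {b, c}, {d, e}, {e, f}}"
    unfolding B6_like_def by blast
  have "\<not> E a b" "\<not> E b a" "\<not> E c b" "\<not> E d e" "\<not> E e d" "\<not> E f e"
    using L V unfolding complement_is_def by (auto simp: insert_commute)
  then show ?thesis using assms(2-4) dist V by auto
next
  assume r: "four_regular7 E V"
  show ?thesis
  proof (rule ccontr)
    assume "\<not> ?thesis"
    then have "V - {s} \<subseteq> {z \<in> V. E s z}" by blast
    moreover have "finite V" using r card.infinite unfolding four_regular7_def by fastforce
    ultimately have "card (V - {s}) \<le> card {z \<in> V. E s z}" by (intro card_mono) auto
    then show False
      using r assms(2) \<open>finite V\<close> by (simp add: four_regular7_def degree_def)
  qed
qed

section \<open>From the closed graph back to the given graph\<close>

theorem theorem5p1: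
  fixes V :: "'a set" and E :: "'a \<Rightarrow> 'a \<Rightarrow> bool"
  assumes "simple_graph V E"
    and "\<not> graph_iso V E W5_V W5_E"
    and "\<not> graph_iso V E B6_V B6_E"
    and "\<not> graph_iso V E C71_V C71_E"
    and "\<not> graph_iso V E C72_V C72_E"
    and "\<forall>u\<in>V. \<forall>v\<in>V. u \<noteq> v \<and> \<not> E u v \<longrightarrow> degree V E u + degree V E v \<ge> card V + 1"
  shows "rigid3 V E"
  unfolding rigid3_def
proof (intro allI impI)
  fix p :: "'a \<Rightarrow> real^3" assume p: "generic3 V p"
  have finV: "finite V" and E_sym: "\<And>u v. E u v \<Longrightarrow> E v u" and E_irrefl: "\<And>u. \<not> E u u"
    using assms(1) unfolding simple_graph_def by blast+
  interpret generic_framework V p by unfold_locales (rule finV p)+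
  define L where "L = linked E"
  have EL: "L u v" if "E u v" for u v
    unfolding L_def using edge_linked[OF assms(1) that] .
  interpret G: dof_graph V L "dof_le L"
  proof
    show "dof_le L (insert w X) (k - 1)"
      if "dof_le L X k" "X \<subseteq> V" "w \<in> V" "w \<notin> X" "{a, b, c, d} \<subseteq> X" "distinct [a, b, c, d]"
        "\<forall>x\<in>{a, b, c, d}. L w x" "\<not> L a b" for X k w a b c d
      using that unfolding L_def by (rule dof_le_insert_nonclique)
    show "dof_le L (insert w X) (k + 3 - int (card N))"
      if "dof_le L X k" "X \<subseteq> V" "w \<in> V" "w \<notin> X" "N \<subseteq> X" "card N \<le> 3" "\<forall>x\<in>N. L w x" for X k w N
      using that unfolding L_def by (rule dof_le_insert)
    show "L u v" if "dof_le L X 0" "X \<subseteq> V" "3 \<le> card X" "u \<in> X" "v \<in> X" "u \<noteq> v" for X u v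
      using that unfolding L_def by (rule dof_le_clique)
    show "L v u" if "L u v" for u v using that linked_sym unfolding L_def by blast
    show "\<not> L u u" for u by (simp add: L_def linked_def)
    show "dof_le L {} (- 6)" by (rule dof_le_empty)
    show "dof_le L X l" if "dof_le L X k" "k \<le> l" for X k l using that by (rule dof_le_mono)
  qed (rule finV)
  have deg_le: "degree V E u \<le> degree V L u" for u
    unfolding degree_def using finV EL by (intro card_mono) auto
  have "ore L V 1"
    unfolding ore_def
  proof (intro ballI impI)
    fix u v assume uv: "u \<in> V" "v \<in> V" "u \<noteq> v \<and> \<not> L u v"
    then have "card V + 1 \<le> degree V E u + degree V E v" using assms(6) EL by blast
    then show "card V + 1 \<le> degree V L u + degree V L v"
      using deg_le[of u] deg_le[of v] by linarith
  qed
  then consider "complete_on L V" | "wheel_like L V \<or> B6_like L V \<or> four_regular7 L V"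
    using G.ore_exceptions by blast
  then show "framework_rigid3 V E p"
  proof cases
    case 1
    then show ?thesis
      using E_irrefl by (intro linked_imp_rigid) (auto simp: complete_on_def L_def)
  next
    case 2
    \<comment> \<open>The degree sum is n + 1 in \<open>L\<close> and at least n + 1 in
      \<open>E\<close>, while no degree in \<open>E\<close> exceeds that in \<open>L\<close>; so the
      neighbourhoods of \<open>s\<close> coincide.\<close>
    have nbrs: "E s w \<longleftrightarrow> L s w" if st: "s \<in> V" "t \<in> V" "s \<noteq> t" "\<not> L s t" and w: "w \<in> V" for s t w
    proof -
      have "degree V L s + degree V L t = card V + 1" using G.exceptional_tight[OF 2 st] .
      moreover have "card V + 1 \<le> degree V E s + degree V E t" using assms(6) EL st by blast
      ultimately have "degree V L s \<le> degree V E s" using deg_le[of t] by linarith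
      then have "{v \<in> V. E s v} = {v \<in> V. L s v}"
        using finV EL unfolding degree_def by (intro card_seteq) auto
      then show ?thesis using w by blast
    qed
    have same: "E s t \<longleftrightarrow> L s t" if st: "s \<in> V" "t \<in> V" for s t
    proof (cases "s = t")
      case True
      then show ?thesis using E_irrefl G.E_irrefl by simp
    next
      case False
      then obtain z where z: "z \<in> V" "z \<noteq> s \<and> \<not> L s z \<or> z \<noteq> t \<and> \<not> L t z"
        using exceptional_cover[OF 2 st] by blast
      then show ?thesis
      proof (elim disjE conjE)
        assume "z \<noteq> s" "\<not> L s z"
        then show ?thesis using nbrs[OF st(1) z(1) _ _ st(2)] by blast
      next
        assume "z \<noteq> t" "\<not> L t z"
        then have "E t s \<longleftrightarrow> L t s" using nbrs[OF st(2) z(1) _ _ st(1)] by blast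
        then show ?thesis using E_sym G.E_commute by blast
      qed
    qed
    have "complement_is L V K \<longleftrightarrow> complement_is E V K" for K
      using same by (simp add: complement_is_def)
    moreover have "degree V L s = degree V E s" if "s \<in> V" for s
    proof -
      have "{v \<in> V. L s v} = {v \<in> V. E s v}" using same[OF that] by blast
      then show ?thesis by (simp add: degree_def)
    qed
    ultimately have "wheel_like E V \<or> B6_like E V \<or> four_regular7 E V"
      using 2 by (simp add: wheel_like_def B6_like_def four_regular7_def)
    then have "four_regular7 E V"
      using wheel_like_iso B6_like_iso assms(2,3) by blast
    then interpret R: four_regular7_graph V E
      using E_sym E_irrefl by unfold_locales (auto simp: four_regular7_def)
    show ?thesis using R.iso assms(4,5) by blast
  qed
qed

end
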